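(* Let $(X,d)$ be a (nonempty) separable metric space. Then the following assertions hold (each for both choices of sign $\pm$). (i) If $X$ is at most countable, then $$s_\pm(X,d)=\lim_N s_\pm(S(X_N))=\sup_N s_\pm(S(X_N))$$ for an arbitrary sequence of finite subsets $X_N\nearrow X$ as $N\to\infty$ (i.e. $X_N\subset X_{N+1}$ and $\bigcup_N X_N=X$). In particular, if $X$ is finite, then $s_\pm(X,d)=s_\pm(S(X))$. (ii) If $X$ is infinite, then $s_\pm(X,d)=s_\pm(\tilde X,d)$, where $\tilde X\subset X$ is an arbitrary countable dense subset of $X$ endowed with the same distance $d$. (iii) If $\mu$ is a Borel probability measure on $X$ with full support, i.e. with $\operatorname{supp}\mu=X$, and $(\xi_i)_{i\ge 1}$ is a sequence of i.i.d. random elements of $X$ with law $\mu$, then almost surely $$s_\pm(X,d)=\lim_{m\to\infty} s_\pm(S(X_m))=\lim_{m\to\infty} s_\pm(S(\hat X_{N(m)})),$$ where $X_m:=(\xi_i)_{i=1}^m$ is the random finite sequence and $\hat X_{N(m)}$ is the random finite set of the $N(m)$ distinct elements of $X_m$. (iv) If $\mu$ is a Borel probability measure on $X$ with finite $4$-th moment and full support in $X$, then $$s_\pm(K_\mu)=s_\pm(X,d)$$ (whereas the numbers $s_\pm(X,d)$ do not depend on $\mu$). Furthermore, $$s_\pm(K_\mu)-1\le s_\pm(T_\mu)\le s_\pm(K_\mu),$$ and if $\mathbf 1\not\perp\ker K_\mu$, then $s_\pm(T_\mu)=s_\pm(K_\mu)$. (v) $s_\pm(T_\mu)$ also does not depend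 on $\mu$, once $\mu$ is a Borel probability measure with finite $4$-th moment and full support in $X$.
   Context: For a real symmetric matrix or a compact self-adjoint operator $A$ on a Hilbert space, $s_+(A)$ and $s_-(A)$ denote the numbers (possibly $+\infty$) of strictly positive, respectively strictly negative, eigenvalues of $A$, counted with multiplicity. For a finite subset $X_N=\{x_1,\dots,x_N\}$ (with distinct $x_i$) of a metric space $(X,d)$, $S(X_N):=\left(-\tfrac12 d^2(x_i,x_j)\right)_{i,j=1}^N$; for a finite sequence $X_m=(\xi_i)_{i=1}^m$ of points of $X$ with possible repetitions, $S(X_m):=\left(-\tfrac12 d^2(\xi_i,\xi_j)\right)_{i,j=1}^m$ (an $m\times m$ matrix). The limit distance signature of a metric space $(X,d)$ is the couple $(s_-(X,d),s_+(X,d))$, where $$s_\pm(X,d):=\sup\{s_\pm(S(X_N)) : X_N\subset X \text{ finite}\}\in\{0,1,2,\dots\}\cup\{+\infty\}.$$ A Borel probability measure $\mu$ on $X$ has finite $4$-th moment if $\int_X d^4(x_0,y)\,d\mu(y)<+\infty$ for some (hence all) $x_0\in X$. For such $\mu$, the operators $K_\mu,T_\mu\colon L^2(X,\mu)\to L^2(X,\mu)$ (self-adjoint and Hilbert–Schmidt) are defined by $$(K_\mu u)(x):=-\frac12\int_X d^2(x,y)u(y)\,d\mu(y),\qquad T_\mu:=P_\mu K_\mu P_\mu,$$ where $P_\mu$ is the orthogonal projector of $L^2(X,\mu)$ onto $\mathbf 1^\perp$, the orthogonal complement of the constant function $\mathbf 1$. The notation $\mathbf 1\not\perp\ker K_\mu$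 means that $\mathbf 1$ is not orthogonal to $\ker K_\mu$. *)

theory Defs
  imports
    "HOL-Probability.Probability"
    "HOL-Combinatorics.Combinatorics"
    "Jordan_Normal_Form.Char_Poly"
begin

section \<open>Signature of matrices and of a metric space\<close>

text \<open>
  The sign in \<open>s\<^sub>\<plusminus>\<close> is a parameter \<open>\<sigma> \<in> {1, -1}\<close>: an eigenvalue \<open>k\<close> is counted when
  \<open>sgn k = \<sigma>\<close>.  For a real symmetric matrix the multiset of roots of the characteristic polynomial
  is the spectrum with multiplicities.
\<close>

definition sig_mat :: "real \<Rightarrow> real mat \<Rightarrow> nat" where
  "sig_mat \<sigma> A = size (filter_mset (\<lambda>k. sgn k = \<sigma>) (proots (char_poly A)))"

definition S_seq :: "'a::metric_space list \<Rightarrow> real mat" where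
  "S_seq xs = Matrix.mat (length xs) (length xs) (\<lambda>(i, j). - (1/2) * (dist (xs ! i) (xs ! j))\<^sup>2)"

text \<open>
  The matrix of a finite set depends on the enumeration of the set, but only up to a simultaneous
  permutation of rows and columns; lemma \<open>sig_mat_S_set\<close> below shows that the choice is immaterial
  for the signature.
\<close>

definition S_set :: "'a::metric_space set \<Rightarrow> real mat" where
  "S_set F = S_seq (SOME xs. distinct xs \<and> set xs = F)"

definition limit_sig :: "real \<Rightarrow> 'a::metric_space set \<Rightarrow> enat" where
  "limit_sig \<sigma> X = (SUP F\<in>{F. finite F \<and> F \<subseteq> X}. enat (sig_mat \<sigma> (S_set F)))"

lemma sig_mat_S_seq_perm:
  fixes xs ys :: "'a::metric_space list"
  assumes "mset xs = mset ys"
  shows "sig_mat \<sigma> (S_seq xs) = sig_mat \<sigma> (S_seq ys)"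
proof -
  define n where "n = length ys"
  obtain p where p: "p permutes {..<n}" and xs: "permute_list p ys = xs"
    using mset_eq_permutation[OF assms] unfolding n_def by blast
  have len: "length xs = n"
    using xs by (auto simp: n_def)
  have nth: "xs ! i = ys ! p i" if "i < n" for i
    using permute_list_nth[of p ys i] p that xs by (simp add: n_def)
  have pn: "p i < n" if "i < n" for i
    using permutes_in_image[OF p, of i] that by auto
  have inj: "p i = p j \<longleftrightarrow> i = j" for i j
    using permutes_inj[OF p] by (auto simp: inj_def)
  define P where "P = Matrix.mat n n (\<lambda>(i, j). if j = p i then 1 else 0 :: real)"
  define Q where "Q = Matrix.mat n n (\<lambda>(i, j). if i = p j then 1 else 0 :: real)"
  have delta: "(\<Sum>k = 0..<n. (if k = p i then 1 else 0) * g k) = g (p i)"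
      "(\<Sum>k = 0..<n. g k * (if k = p i then 1 else 0)) = g (p i)"
    if "i < n" for g :: "nat \<Rightarrow> real" and i
    using pn[OF that] by (simp_all add: if_distrib if_distribR cong: if_cong)
  have PQ: "P * Q = 1\<^sub>m n"
  proof (rule eq_matI)
    fix i j assume ij: "i < dim_row (1\<^sub>m n :: real mat)" "j < dim_col (1\<^sub>m n :: real mat)"
    then have "(P * Q) $$ (i, j) =
        (\<Sum>k = 0..<n. (if k = p i then 1 else 0) * (if k = p j then 1 else 0))"
      by (simp add: P_def Q_def scalar_prod_def)
    also have "\<dots> = (if p i = p j then 1 else 0)"
      using ij by (subst delta(1)) auto
    finally show "(P * Q) $$ (i, j) = 1\<^sub>m n $$ (i, j)"
      using ij by (simp add: inj)
  qed (auto simp: P_def Q_def)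
  have carr: "P \<in> carrier_mat n n" "Q \<in> carrier_mat n n"
      "S_seq xs \<in> carrier_mat n n" "S_seq ys \<in> carrier_mat n n"
    by (auto simp: P_def Q_def S_seq_def len n_def)
  have QP: "Q * P = 1\<^sub>m n"
    using mat_mult_left_right_inverse[OF carr(1,2) PQ] .
  have PS: "P * S_seq ys = Matrix.mat n n (\<lambda>(i, j). - (1/2) * (dist (ys ! p i) (ys ! j))\<^sup>2)"
    (is "_ = ?M")
  proof (rule eq_matI)
    fix i j assume ij: "i < dim_row ?M" "j < dim_col ?M"
    then have "(P * S_seq ys) $$ (i, j) =
        (\<Sum>k = 0..<n. (if k = p i then 1 else 0) * (- (1/2) * (dist (ys ! k) (ys ! j))\<^sup>2))"
      by (simp add: P_def S_seq_def scalar_prod_def n_def[symmetric])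
    also have "\<dots> = - (1/2) * (dist (ys ! p i) (ys ! j))\<^sup>2"
      using ij by (subst delta(1)) auto
    finally show "(P * S_seq ys) $$ (i, j) = ?M $$ (i, j)"
      using ij by simp
  qed (auto simp: P_def S_seq_def n_def)
  have "P * S_seq ys * Q = S_seq xs"
    unfolding PS
  proof (rule eq_matI)
    fix i j assume ij: "i < dim_row (S_seq xs)" "j < dim_col (S_seq xs)"
    then have ij': "i < n" "j < n"
      by (simp_all add: S_seq_def len)
    then have "(?M * Q) $$ (i, j) =
        (\<Sum>k = 0..<n. (- (1/2) * (dist (ys ! p i) (ys ! k))\<^sup>2) * (if k = p j then 1 else 0))"
      by (simp add: Q_def scalar_prod_def)
    also have "\<dots> = - (1/2) * (dist (ys ! p i) (ys ! p j))\<^sup>2"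
      using ij' by (subst delta(2)) auto
    finally show "(?M * Q) $$ (i, j) = S_seq xs $$ (i, j)"
      using ij' by (simp add: S_seq_def len nth)
  qed (auto simp: Q_def S_seq_def len)
  then have "similar_mat_wit (S_seq xs) (S_seq ys) P Q"
    using carr PQ QP by (intro similar_mat_witI[of _ _ n]) auto
  then have "similar_mat (S_seq xs) (S_seq ys)"
    unfolding similar_mat_def by blast
  then show ?thesis
    unfolding sig_mat_def by (simp add: char_poly_similar)
qed

lemma sig_mat_S_set:
  assumes "distinct xs"
  shows "sig_mat \<sigma> (S_set (set xs)) = sig_mat \<sigma> (S_seq xs)"
proof -
  let ?ys = "SOME ys. distinct ys \<and> set ys = set xs"
  have "distinct ?ys \<and> set ?ys = set xs"
    by (rule someI[of _ xs]) (use assms in auto)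
  then have "mset ?ys = mset xs"
    using assms set_eq_iff_mset_eq_distinct by blast
  then show ?thesis
    unfolding S_set_def by (rule sig_mat_S_seq_perm)
qed


section \<open>Measures on a metric space\<close>

definition borel_prob :: "'a::topological_space measure \<Rightarrow> bool" where
  "borel_prob \<mu> \<longleftrightarrow> prob_space \<mu> \<and> sets \<mu> = sets borel"

definition msupport :: "'a::topological_space measure \<Rightarrow> 'a set" where
  "msupport \<mu> = {x. \<forall>U. open U \<and> x \<in> U \<longrightarrow> emeasure \<mu> U > 0}"

definition finite_4th_moment :: "'a::metric_space measure \<Rightarrow> bool" where
  "finite_4th_moment \<mu> \<longleftrightarrow> (\<exists>x0. (\<integral>\<^sup>+ y. ennreal (dist x0 y ^ 4) \<partial>\<mu>) < \<infinity>)"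


section \<open>Operators on \<open>L\<^sup>2\<close>\<close>

text \<open>
  Elements of the real Hilbert space \<open>L\<^sup>2(X, \<mu>)\<close> are represented by square integrable functions,
  and equality in \<open>L\<^sup>2(X, \<mu>)\<close> by equality almost everywhere.
\<close>

definition L2 :: "'a measure \<Rightarrow> ('a \<Rightarrow> real) set" where
  "L2 \<mu> = {u \<in> borel_measurable \<mu>. integrable \<mu> (\<lambda>x. (u x)\<^sup>2)}"

definition L2_inner :: "'a measure \<Rightarrow> ('a \<Rightarrow> real) \<Rightarrow> ('a \<Rightarrow> real) \<Rightarrow> real" where
  "L2_inner \<mu> u v = (LINT x|\<mu>. u x * v x)"

definition L2_indep :: "'a measure \<Rightarrow> ('a \<Rightarrow> real) set \<Rightarrow> bool" where
  "L2_indep \<mu> U \<longleftrightarrow>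
     (\<forall>c. (AE x in \<mu>. (\<Sum>u\<in>U. c u * u x) = 0) \<longrightarrow> (\<forall>u\<in>U. c u = 0))"

definition L2_eigenspace ::
    "'a measure \<Rightarrow> (('a \<Rightarrow> real) \<Rightarrow> 'a \<Rightarrow> real) \<Rightarrow> real \<Rightarrow> ('a \<Rightarrow> real) set" where
  "L2_eigenspace \<mu> A k = {u \<in> L2 \<mu>. AE x in \<mu>. A u x = k * u x}"

abbreviation L2_ker ::
    "'a measure \<Rightarrow> (('a \<Rightarrow> real) \<Rightarrow> 'a \<Rightarrow> real) \<Rightarrow> ('a \<Rightarrow> real) set" where
  "L2_ker \<mu> A \<equiv> L2_eigenspace \<mu> A 0"

text \<open>
  The dimension of the eigenspace as a subspace of \<open>L\<^sup>2(X, \<mu>)\<close>; it is 0 iff \<open>k\<close> is not an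
  eigenvalue.
\<close>

definition L2_mult :: "'a measure \<Rightarrow> (('a \<Rightarrow> real) \<Rightarrow> 'a \<Rightarrow> real) \<Rightarrow> real \<Rightarrow> enat" where
  "L2_mult \<mu> A k =
     (SUP U\<in>{U. finite U \<and> U \<subseteq> L2_eigenspace \<mu> A k \<and> L2_indep \<mu> U}. enat (card U))"

text \<open>The sum of the multiplicities over all real \<open>k\<close> of sign \<open>\<sigma>\<close>.\<close>

definition sig_op :: "real \<Rightarrow> 'a measure \<Rightarrow> (('a \<Rightarrow> real) \<Rightarrow> 'a \<Rightarrow> real) \<Rightarrow> enat" where
  "sig_op \<sigma> \<mu> A = (SUP E\<in>{E. finite E \<and> (\<forall>k\<in>E. sgn k = \<sigma>)}. \<Sum>k\<in>E. L2_mult \<mu> A k)"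

definition K_op :: "'a::metric_space measure \<Rightarrow> ('a \<Rightarrow> real) \<Rightarrow> 'a \<Rightarrow> real" where
  "K_op \<mu> u = (\<lambda>x. - (1/2) * (LINT y|\<mu>. (dist x y)\<^sup>2 * u y))"

text \<open>
  For a probability measure the constant function \<open>1\<close> is a unit vector, so that
  \<open>u \<mapsto> u - \<langle>u, 1\<rangle> 1\<close> is the orthogonal projector onto \<open>1\<^sup>\<bottom>\<close>; see \<open>P_op_orthogonal_projector\<close>.
\<close>

definition P_op :: "'a measure \<Rightarrow> ('a \<Rightarrow> real) \<Rightarrow> 'a \<Rightarrow> real" where
  "P_op \<mu> u = (\<lambda>x. u x - L2_inner \<mu> u (\<lambda>_. 1))"

definition T_op :: "'a::metric_space measure \<Rightarrow> ('a \<Rightarrow> real) \<Rightarrow> 'a \<Rightarrow> real" where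
  "T_op \<mu> u = P_op \<mu> (K_op \<mu> (P_op \<mu> u))"

lemma P_op_orthogonal_projector:
  assumes "prob_space \<mu>" and u: "u \<in> L2 \<mu>"
  shows "P_op \<mu> u \<in> L2 \<mu>"
    and "L2_inner \<mu> (P_op \<mu> u) (\<lambda>_. 1) = 0"
    and "\<And>w. w \<in> L2 \<mu> \<Longrightarrow> L2_inner \<mu> w (\<lambda>_. 1) = 0 \<Longrightarrow>
           L2_inner \<mu> (\<lambda>x. u x - P_op \<mu> u x) w = 0"
proof -
  interpret prob_space \<mu> by fact
  have meas [measurable]: "u \<in> borel_measurable \<mu>" and sq: "integrable \<mu> (\<lambda>x. (u x)\<^sup>2)"
    using u by (auto simp: L2_def)
  have int: "integrable \<mu> u"
    using square_integrable_imp_integrable[OF meas sq] .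
  show "P_op \<mu> u \<in> L2 \<mu>"
    using int sq unfolding L2_def P_op_def by (auto simp: power2_diff)
  show "L2_inner \<mu> (P_op \<mu> u) (\<lambda>_. 1) = 0"
    using int by (simp add: L2_inner_def P_op_def prob_space)
  show "L2_inner \<mu> (\<lambda>x. u x - P_op \<mu> u x) w = 0"
    if "w \<in> L2 \<mu>" "L2_inner \<mu> w (\<lambda>_. 1) = 0" for w
    using that by (simp add: L2_inner_def P_op_def)
qed

end

theory Submission
  imports Defs "HOL-Complex_Analysis.Great_Picard"
begin

text \<open>
  Everything rests on the variational description of the signature: for a real symmetric matrix as
  well as for a compact symmetric operator on \<open>L\<^sup>2\<close>, \<open>s\<^sub>\<sigma> \<ge> n\<close> holds iff there are \<open>n\<close> vectors on whose
  span the quadratic form, multiplied by \<open>\<sigma>\<close>, is positive definite, that is, iff some \<open>n \<times> n\<close> Gram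
  matrix is positive definite. One direction takes eigenvectors; in the other direction, orthogonality
  to the eigenvectors found so far still leaves a vector with a positive value of the form, and
  maximising the form there yields a further eigenvector.

  Positive definiteness of a Gram matrix survives small perturbations. For matrices \<open>S(X\<^sub>m)\<close> this gives
  monotonicity under inclusion, insensitivity to repetitions and the passage to dense subsets, hence
  (i)--(iii), as an i.i.d. sequence is almost surely dense. For \<open>K\<^sub>\<mu>\<close>, point masses are replaced by
  normalised indicators of small balls, and conversely functions by the point masses obtained from
  integrating over the cells of the nearest-point projection to the first \<open>N\<close> members of a dense sequence;
  both keep the Gram matrix approximately unchanged, so \<open>s\<^sub>\<sigma>(K\<^sub>\<mu>) = s\<^sub>\<sigma>(X, d)\<close>. Both also preserve the
  total mass. Since \<open>T\<^sub>\<mu>\<close> is \<open>K\<^sub>\<mu>\<close> restricted to functions of mass 0, \<open>s\<^sub>\<sigma>(T\<^sub>\<mu>)\<close> is likewise described by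
  finite configurations with weights of mass 0 and does not depend on \<open>\<mu>\<close>.
\<close>

section \<open>Positive definite Gram matrices\<close>

text \<open>\<open>posdef {..<n}\<close> of a Gram matrix records in one condition that the n
  vectors are independent and that the form is positive on their span. Signatures may be infinite,
  so every comparison is made at finite levels \<open>enat n \<le> ...\<close>, where only finitely
  many vectors occur.

  The matrix signature is defined through the characteristic polynomial, the operator signature
  through eigenspaces. Both reduce to one eigenvector lemma, a symmetric matrix being viewed as an
  operator on L2 of a counting measure. The polynomial requires a full eigenbasis, hence also
  eigenvectors in a complement on which the form vanishes.

  The maximising sequence in that lemma has no reason to converge. It is bounded, so its images
  under the compact operator have a convergent subsequence, and near-maximality forces the vectors
  to follow their images.

  The nearest-point discretisation does more than compare forms: \<open>K_op\<close> applied to a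
  function is a pointwise limit of step functions, which gives measurability, and its form is a
  limit of symmetric finite sums, which gives symmetry.\<close>

definition posdef :: "'i set \<Rightarrow> ('i \<Rightarrow> 'i \<Rightarrow> real) \<Rightarrow> bool" where
  "posdef I G \<longleftrightarrow>
     (\<forall>c. (\<exists>i\<in>I. c i \<noteq> 0) \<longrightarrow> 0 < (\<Sum>i\<in>I. \<Sum>j\<in>I. c i * c j * G i j))"

lemma posdefD:
  assumes "posdef I G" "i \<in> I" "c i \<noteq> 0"
  shows "0 < (\<Sum>i\<in>I. \<Sum>j\<in>I. c i * c j * G i j)"
  using assms unfolding posdef_def by blast

lemma posdef_cong:
  assumes "I = J" "\<And>i j. i \<in> J \<Longrightarrow> j \<in> J \<Longrightarrow> G i j = H i j"
  shows "posdef I G \<longleftrightarrow> posdef J H"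
  unfolding posdef_def assms(1) using assms(2) by (auto cong: sum.cong)

lemma posdef_reindex:
  assumes pd: "posdef I G" and fin: "finite I" and inj: "inj_on f J" and sub: "f ` J \<subseteq> I"
  shows "posdef J (\<lambda>i j. G (f i) (f j))"
  unfolding posdef_def
proof (intro allI impI)
  fix c :: "'b \<Rightarrow> real" assume "\<exists>i\<in>J. c i \<noteq> 0"
  then obtain p where p: "p \<in> J" "c p \<noteq> 0" by blast
  define d where "d i = (if i \<in> f ` J then c (the_inv_into J f i) else 0)" for i
  have df: "d (f i) = c i" if "i \<in> J" for i
    using that inj by (simp add: d_def the_inv_into_f_f)
  have "0 < (\<Sum>i\<in>I. \<Sum>j\<in>I. d i * d j * G i j)"
    using pd p sub df[OF p(1)] by (intro posdefD[of I G "f p"]) auto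
  also have "\<dots> = (\<Sum>i\<in>f ` J. \<Sum>j\<in>f ` J. d i * d j * G i j)"
    using fin sub by (intro sum.mono_neutral_cong_right ballI) (auto simp: d_def)
  also have "\<dots> = (\<Sum>i\<in>J. \<Sum>j\<in>J. c i * c j * G (f i) (f j))"
    using inj df by (simp add: sum.reindex)
  finally show "0 < (\<Sum>i\<in>J. \<Sum>j\<in>J. c i * c j * G (f i) (f j))" .
qed

lemma posdef_le_card:
  assumes "posdef I G" "finite I" "n \<le> card I"
  obtains f where "f ` {..<n} \<subseteq> I" "inj_on f {..<n}" "posdef {..<n} (\<lambda>i j. G (f i) (f j))"
proof -
  obtain h where "bij_betw h {0..<card I} I"
    using ex_bij_betw_nat_finite[OF assms(2)] by blast
  then have "h ` {..<n} \<subseteq> I" "inj_on h {..<n}"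
    using assms(3) by (auto simp: bij_betw_def inj_on_def)
  then show ?thesis
    using that[of h] posdef_reindex[OF assms(1,2)] by blast
qed

text \<open>On the unit sphere of R^I the form attains its minimum, which is positive; homogeneity
  extends the bound to all c. Coefficient vectors are functions on the whole index type, so those in
  \<open>B\<close> are pinned to 0 outside I, and compactness of a product of compact sets
  applies.\<close>

lemma posdef_coercive:
  assumes pd: "posdef I G" and fin: "finite I"
  shows "\<exists>e>0. \<forall>c. e * (\<Sum>i\<in>I. (c i)\<^sup>2) \<le> (\<Sum>i\<in>I. \<Sum>j\<in>I. c i * c j * G i j)"
proof -
  define q where "q c = (\<Sum>i\<in>I. \<Sum>j\<in>I. c i * c j * G i j)" for c :: "'a \<Rightarrow> real"
  define s where "s c = (\<Sum>i\<in>I. (c i)\<^sup>2)" for c :: "'a \<Rightarrow> real"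
  define B where "B = Pi\<^sub>E UNIV (\<lambda>i. if i \<in> I then {-1..1::real} else {0})"
  define S where "S = B \<inter> s -` {1}"
  have "compactin (product_topology (\<lambda>_. euclidean) UNIV) B"
    unfolding B_def compactin_PiE by auto
  then have "compact B"
    by (simp add: euclidean_product_topology)
  moreover have cs: "continuous_on UNIV s"
    unfolding s_def by (intro continuous_intros continuous_on_product_coordinates)
  then have "closed (s -` {1})"
    using continuous_on_closed_vimage[of UNIV s] by auto
  ultimately have cpt: "compact S"
    unfolding S_def by (rule compact_Int_closed)
  have cq: "continuous_on UNIV q"
    unfolding q_def by (intro continuous_intros continuous_on_product_coordinates)
  have hom: "q (\<lambda>i. r * c i) = r\<^sup>2 * q c" for r c
    by (simp add: q_def sum_distrib_left power2_eq_square algebra_simps)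
  have normalize: "q c \<ge> e * s c" if e: "\<And>c. c \<in> S \<Longrightarrow> e \<le> q c" "e > 0" for c e
  proof (cases "s c = 0")
    case True
    then have "\<forall>i\<in>I. c i = 0"
      using fin by (simp add: s_def sum_nonneg_eq_0_iff)
    then show ?thesis using True by (simp add: q_def)
  next
    case False
    have s0: "s c > 0" using False by (simp add: s_def order.not_eq_order_implies_strict sum_nonneg)
    define r where "r = 1 / sqrt (s c)"
    have r: "r\<^sup>2 * s c = 1" using s0 by (simp add: r_def power_divide)
    define d where "d i = (if i \<in> I then r * c i else 0)" for i
    have sd: "s d = 1"
      using r by (simp add: s_def d_def power_mult_distrib sum_distrib_left)
    have "(d i)\<^sup>2 \<le> 1" if "i \<in> I" for i
      using member_le_sum[of i I "\<lambda>i. (d i)\<^sup>2"] fin that sd by (simp add: s_def)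
    then have "\<bar>d i\<bar> \<le> 1" if "i \<in> I" for i
      using that abs_square_le_1 by blast
    then have "d \<in> S"
      using sd by (auto simp: S_def B_def d_def abs_le_iff split: if_splits)
    then have "e \<le> q d" by (rule e)
    also have "q d = q (\<lambda>i. r * c i)"
      by (simp add: q_def d_def)
    finally have "e \<le> r\<^sup>2 * q c" by (simp add: hom)
    then have "e * s c \<le> (r\<^sup>2 * q c) * s c"
      using s0 by (intro mult_right_mono) auto
    also have "\<dots> = q c" using r by (metis mult.assoc mult.commute mult.right_neutral)
    finally show ?thesis .
  qed
  show ?thesis
  proof (cases "S = {}")
    case True
    \<comment> \<open>The sphere is empty only for empty I; both sides are then 0 and any constant
      serves.\<close>
    then show ?thesis using normalize[of 1] by (intro exI[of _ 1]) (simp add: q_def s_def)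
  next
    case False
    then obtain d where d: "d \<in> S" "\<And>c. c \<in> S \<Longrightarrow> q d \<le> q c"
      using continuous_attains_inf[OF cpt False, of q] continuous_on_subset[OF cq] by auto
    have "\<exists>i\<in>I. d i \<noteq> 0"
    proof (rule ccontr)
      assume "\<not> ?thesis"
      then have "s d = 0" by (simp add: s_def)
      then show False using d(1) by (simp add: S_def)
    qed
    then have "q d > 0" using pd unfolding posdef_def q_def by blast
    then show ?thesis
      using normalize[of "q d"] d(2) by (intro exI[of _ "q d"]) (simp add: q_def s_def)
  qed
qed

lemma posdef_open:
  assumes pd: "posdef I G" and fin: "finite I"
  shows "\<exists>e>0. \<forall>H. (\<forall>i\<in>I. \<forall>j\<in>I. \<bar>H i j - G i j\<bar> < e) \<longrightarrow> posdef I H"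
proof -
  obtain e where e: "e > 0" "\<And>c. e * (\<Sum>i\<in>I. (c i)\<^sup>2) \<le> (\<Sum>i\<in>I. \<Sum>j\<in>I. c i * c j * G i j)"
    using posdef_coercive[OF assms] by blast
  \<comment> \<open>Entries off by less than d change the form by at most d times
    \<open>card I\<close> times the squared length of c. The summand 1 makes this strictly less than
    the coercivity bound.\<close>
  define d where "d = e / (real (card I) + 1)"
  have d: "d > 0" using e by (simp add: d_def)
  have "posdef I H" if H: "\<forall>i\<in>I. \<forall>j\<in>I. \<bar>H i j - G i j\<bar> < d" for H
    unfolding posdef_def
  proof (intro allI impI)
    fix c :: "'a \<Rightarrow> real" assume "\<exists>i\<in>I. c i \<noteq> 0"
    then have s0: "(\<Sum>i\<in>I. (c i)\<^sup>2) > 0"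
      using fin by (metis sum_pos2 zero_le_power2 zero_less_power2)
    have "\<bar>\<Sum>i\<in>I. \<Sum>j\<in>I. c i * c j * (G i j - H i j)\<bar> \<le> (\<Sum>i\<in>I. \<Sum>j\<in>I. \<bar>c i * c j * (G i j - H i j)\<bar>)"
      by (intro order.trans[OF sum_abs] sum_mono order.refl)
    also have "\<dots> \<le> (\<Sum>i\<in>I. \<Sum>j\<in>I. d * (((c i)\<^sup>2 + (c j)\<^sup>2) / 2))"
    proof (intro sum_mono)
      fix i j assume ij: "i \<in> I" "j \<in> I"
      have "\<bar>c i * c j\<bar> \<le> ((c i)\<^sup>2 + (c j)\<^sup>2) / 2"
        using sum_squares_bound[of "\<bar>c i\<bar>" "\<bar>c j\<bar>"] by (simp add: abs_mult)
      then show "\<bar>c i * c j * (G i j - H i j)\<bar> \<le> d * (((c i)\<^sup>2 + (c j)\<^sup>2) / 2)"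
        using mult_mono[of "\<bar>G i j - H i j\<bar>" d "\<bar>c i * c j\<bar>" "((c i)\<^sup>2 + (c j)\<^sup>2) / 2"] H ij d
        by (simp add: abs_mult[of "c i * c j"] abs_minus_commute mult.commute[of "\<bar>c i * c j\<bar>"]
            mult.commute[of d] less_imp_le)
    qed
    also have "\<dots> = d * (real (card I) * (\<Sum>i\<in>I. (c i)\<^sup>2))"
      by (simp add: sum_distrib_left[symmetric] sum.distrib add_divide_distrib
          sum_divide_distrib[symmetric])
    also have "\<dots> < e * (\<Sum>i\<in>I. (c i)\<^sup>2)"
      using s0 e(1) by (simp add: d_def field_simps)
    also note e(2)[rule_format, of c]
    finally show "0 < (\<Sum>i\<in>I. \<Sum>j\<in>I. c i * c j * H i j)"
      by (simp add: right_diff_distrib sum_subtractf)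
  qed
  then show ?thesis using d by blast
qed

lemma eventually_posdef:
  assumes lim: "\<And>i j. i \<in> I \<Longrightarrow> j \<in> I \<Longrightarrow> ((\<lambda>k. H k i j) \<longlongrightarrow> G i j) F"
    and pd: "posdef I G" and fin: "finite I"
  shows "eventually (\<lambda>k. posdef I (H k)) F"
proof -
  obtain e where e: "e > 0" "\<And>H. (\<forall>i\<in>I. \<forall>j\<in>I. \<bar>H i j - G i j\<bar> < e) \<Longrightarrow> posdef I H"
    using posdef_open[OF pd fin] by blast
  have "eventually (\<lambda>k. \<forall>i\<in>I. \<forall>j\<in>I. \<bar>H k i j - G i j\<bar> < e) F"
    using fin tendstoD[OF lim e(1)] by (auto intro!: eventually_ball_finite simp: dist_real_def)
  then show ?thesis
    by eventually_elim (use e(2) in blast)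
qed

text \<open>Gaussian elimination by induction on the equations: equation j is solved for an unknown
  p with nonzero coefficient, and the result is substituted into the other equations. This is the
  dimension count behind all orthogonality arguments below.\<close>

lemma exists_nontrivial_solution:
  fixes L :: "'j \<Rightarrow> 'i \<Rightarrow> real"
  assumes "finite J" "finite I" "card J < card I"
  shows "\<exists>c. (\<exists>i\<in>I. c i \<noteq> 0) \<and> (\<forall>j\<in>J. (\<Sum>i\<in>I. c i * L j i) = 0)"
  using assms
proof (induction J arbitrary: I L rule: finite_induct)
  case empty
  then obtain i where "i \<in> I" by fastforce
  then show ?case by (intro exI[of _ "\<lambda>_. 1"]) auto
next
  case (insert j J)
  show ?case
  proof (cases "\<forall>i\<in>I. L j i = 0")
    case True
    then show ?thesis using insert.IH[of I L] insert by auto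
  next
    case False
    then obtain p where p: "p \<in> I" "L j p \<noteq> 0" by blast
    define I' where "I' = I - {p}"
    have I: "I = insert p I'" "p \<notin> I'" "finite I'" using p insert by (auto simp: I'_def)
    have "card J < card I'" using I insert by auto
    from insert.IH[OF I(3) this, of "\<lambda>k i. L k i - L k p * L j i / L j p"]
    obtain c where c: "\<exists>i\<in>I'. c i \<noteq> 0"
      "\<And>k. k \<in> J \<Longrightarrow> (\<Sum>i\<in>I'. c i * (L k i - L k p * L j i / L j p)) = 0" by blast
    define d where "d = c(p := - (\<Sum>i\<in>I'. c i * L j i) / L j p)"
    have dI: "(\<Sum>i\<in>I'. d i * f i) = (\<Sum>i\<in>I'. c i * f i)" for f
      using I(2) by (intro sum.cong) (auto simp: d_def)
    have "(\<Sum>i\<in>I. d i * L k i) = 0" if "k \<in> J" for k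
    proof -
      have "(\<Sum>i\<in>I'. c i * (L k i - L k p * L j i / L j p)) =
          (\<Sum>i\<in>I'. c i * L k i) - L k p / L j p * (\<Sum>i\<in>I'. c i * L j i)"
        by (simp add: right_diff_distrib sum_subtractf sum_distrib_left algebra_simps)
      then show ?thesis
        using c(2)[OF that] I dI by (simp add: d_def field_simps)
    qed
    moreover have "(\<Sum>i\<in>I. d i * L j i) = 0"
      using I dI p by (simp add: d_def)
    moreover have "\<exists>i\<in>I. d i \<noteq> 0"
      using c(1) I by (auto simp: d_def)
    ultimately show ?thesis by blast
  qed
qed

section \<open>Finite levels of extended natural numbers\<close>

lemma enat_le_SUP_iff:
  fixes f :: "'b \<Rightarrow> enat"
  assumes "S \<noteq> {}"
  shows "enat n \<le> (SUP x\<in>S. f x) \<longleftrightarrow> (\<exists>x\<in>S. enat n \<le> f x)"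
proof (cases n)
  case 0
  then show ?thesis using assms by (auto simp: zero_enat_def[symmetric])
next
  case (Suc m)
  \<comment> \<open>A weak bound by a positive n is a strict bound by n - 1, and strict bounds below
    a supremum are inherited by some member.\<close>
  have "enat n \<le> z \<longleftrightarrow> enat m < z" for z :: enat
    using Suc by (metis Suc_ile_eq)
  then show ?thesis by (simp add: less_SUP_iff)
qed

text \<open>An extended natural number is determined by the finite numbers below it. This reduces
  equalities of signatures to criteria with n vectors.\<close>

lemma enat_eqI:
  assumes "\<And>n. enat n \<le> x \<longleftrightarrow> enat n \<le> y"
  shows "x = y"
proof -
  have "a \<le> b" if "\<And>n. enat n \<le> a \<Longrightarrow> enat n \<le> b" for a b :: enat
  proof (cases a)
    case infinity
    then have "enat n \<le> b" for n using that by simp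
    then show ?thesis by (cases b) (auto, meson not_less_eq_eq)
  qed (use that in auto)
  then show ?thesis using assms by (meson antisym)
qed

text \<open>Multiplicities may be infinite. If one of them is, it alone absorbs n; otherwise they
  serve as the parts themselves.\<close>

lemma enat_le_sum:
  fixes f :: "'b \<Rightarrow> enat"
  assumes "finite E" "enat n \<le> (\<Sum>k\<in>E. f k)"
  shows "\<exists>a. (\<forall>k\<in>E. enat (a k) \<le> f k) \<and> n \<le> (\<Sum>k\<in>E. a k)"
proof (cases "\<exists>p\<in>E. f p = \<infinity>")
  case True
  then obtain p where p: "p \<in> E" "f p = \<infinity>" by blast
  have "(\<Sum>k\<in>E. if k = p then n else 0) = n" using p assms(1) by simp
  then show ?thesis
    using p by (intro exI[of _ "\<lambda>k. if k = p then n else 0"]) (auto simp: zero_enat_def[symmetric])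
next
  case False
  then have f: "f k = enat (the_enat (f k))" if "k \<in> E" for k using that by force
  have "(\<Sum>k\<in>E. f k) = (\<Sum>k\<in>E. enat (the_enat (f k)))" using f by (intro sum.cong) auto
  also have "\<dots> = enat (\<Sum>k\<in>E. the_enat (f k))"
    using assms(1) by (induction E rule: finite_induct) (auto simp: zero_enat_def)
  finally show ?thesis
    using assms f by (intro exI[of _ "\<lambda>k. the_enat (f k)"]) (metis enat_ord_simps(1) order.refl)
qed

section \<open>The space L2\<close>

text \<open>Stated for bare numbers because it is applied both to the inner product and to the
  semidefinite form that measures the distance from the maximum.\<close>

lemma quadratic_form_Cauchy_Schwarz:
  fixes a b c :: real
  assumes "\<And>s t. 0 \<le> s\<^sup>2 * a + 2 * (s * t * b) + t\<^sup>2 * c"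
  shows "b\<^sup>2 \<le> a * c"
proof (cases "c = 0")
  case True
  have "b = 0"
  proof (rule ccontr)
    assume b: "b \<noteq> 0"
    \<comment> \<open>This value of t makes the form equal to a - (a + 1) = -1.\<close>
    show False
      using assms[of 1 "- (a + 1) / (2 * b)"] b True by (simp add: field_simps)
  qed
  then show ?thesis using True by simp
next
  case False
  then have c: "c > 0" using assms[of 0 1] by simp
  \<comment> \<open>The choice s = c, t = -b minimises the form up to scaling.\<close>
  have "0 \<le> c * (a * c - b\<^sup>2)"
    using assms[of c "- b"] by (simp add: algebra_simps power2_eq_square)
  then show ?thesis using c by (simp add: zero_le_mult_iff)
qed

context
  fixes \<mu> :: "'a measure"
begin

lemma L2_measurable: "u \<in> L2 \<mu> \<Longrightarrow> u \<in> borel_measurable \<mu>"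
  by (simp add: L2_def)

lemma L2_integrable_mult:
  assumes u: "u \<in> L2 \<mu>" and v: "v \<in> L2 \<mu>"
  shows "integrable \<mu> (\<lambda>x. u x * v x)"
proof (rule Bochner_Integration.integrable_bound)
  show "integrable \<mu> (\<lambda>x. (u x)\<^sup>2 + (v x)\<^sup>2)"
    using u v by (auto simp: L2_def)
  show "(\<lambda>x. u x * v x) \<in> borel_measurable \<mu>"
    using L2_measurable[OF u] L2_measurable[OF v] by measurable
  show "AE x in \<mu>. norm (u x * v x) \<le> norm ((u x)\<^sup>2 + (v x)\<^sup>2)"
  proof (rule AE_I2)
    fix x
    have "2 * (\<bar>u x\<bar> * \<bar>v x\<bar>) \<le> (u x)\<^sup>2 + (v x)\<^sup>2"
      using sum_squares_bound[of "\<bar>u x\<bar>" "\<bar>v x\<bar>"] by simp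
    moreover have "0 \<le> \<bar>u x\<bar> * \<bar>v x\<bar>" by simp
    ultimately show "norm (u x * v x) \<le> norm ((u x)\<^sup>2 + (v x)\<^sup>2)"
      by (simp only: real_norm_def abs_mult)
  qed
qed

lemma L2_lin:
  assumes u: "u \<in> L2 \<mu>" and v: "v \<in> L2 \<mu>"
  shows "(\<lambda>x. a * u x + b * v x) \<in> L2 \<mu>"
proof -
  have "integrable \<mu> (\<lambda>x. a\<^sup>2 * (u x)\<^sup>2 + b\<^sup>2 * (v x)\<^sup>2 + 2 * a * b * (u x * v x))"
    using u v L2_integrable_mult[OF u v] by (auto simp: L2_def)
  moreover have "a\<^sup>2 * (u x)\<^sup>2 + b\<^sup>2 * (v x)\<^sup>2 + 2 * a * b * (u x * v x) = (a * u x + b * v x)\<^sup>2" for x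
    by (simp add: power2_eq_square algebra_simps)
  ultimately show ?thesis
    using u v by (auto simp: L2_def)
qed

lemma L2_zero: "(\<lambda>_. 0) \<in> L2 \<mu>"
  by (simp add: L2_def)

lemma L2_scale: "u \<in> L2 \<mu> \<Longrightarrow> (\<lambda>x. a * u x) \<in> L2 \<mu>"
  using L2_lin[of u u a 0] by simp

lemma L2_add: "u \<in> L2 \<mu> \<Longrightarrow> v \<in> L2 \<mu> \<Longrightarrow> (\<lambda>x. u x + v x) \<in> L2 \<mu>"
  using L2_lin[of u v 1 1] by simp

lemma L2_diff: "u \<in> L2 \<mu> \<Longrightarrow> v \<in> L2 \<mu> \<Longrightarrow> (\<lambda>x. u x - v x) \<in> L2 \<mu>"
  using L2_lin[of u v 1 "-1"] by simp

lemma L2_sum: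
  assumes "\<And>i. i \<in> I \<Longrightarrow> u i \<in> L2 \<mu>"
  shows "(\<lambda>x. \<Sum>i\<in>I. c i * u i x) \<in> L2 \<mu>"
  using assms
proof (induction I rule: infinite_finite_induct)
  case (insert i I)
  then show ?case using L2_lin[of "u i" "\<lambda>x. \<Sum>i\<in>I. c i * u i x" "c i" 1] by simp
qed (auto simp: L2_zero)

lemma L2_inner_commute: "L2_inner \<mu> u v = L2_inner \<mu> v u"
  by (simp add: L2_inner_def mult.commute)

lemma L2_inner_lin_left:
  assumes "u \<in> L2 \<mu>" "v \<in> L2 \<mu>" "w \<in> L2 \<mu>"
  shows "L2_inner \<mu> (\<lambda>x. a * u x + b * v x) w = a * L2_inner \<mu> u w + b * L2_inner \<mu> v w"
proof -
  have "L2_inner \<mu> (\<lambda>x. a * u x + b * v x) w = (LINT x|\<mu>. a * (u x * w x) + b * (v x * w x))"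
    by (simp add: L2_inner_def algebra_simps)
  then show ?thesis
    using assms by (simp add: L2_integrable_mult L2_inner_def)
qed

lemma L2_inner_lin_right:
  assumes "u \<in> L2 \<mu>" "v \<in> L2 \<mu>" "w \<in> L2 \<mu>"
  shows "L2_inner \<mu> w (\<lambda>x. a * u x + b * v x) = a * L2_inner \<mu> w u + b * L2_inner \<mu> w v"
  using L2_inner_lin_left[OF assms] by (simp add: L2_inner_commute)

lemma L2_inner_scale_left: "L2_inner \<mu> (\<lambda>x. a * u x) w = a * L2_inner \<mu> u w"
  by (simp add: L2_inner_def mult.assoc)

lemma L2_inner_scale_right: "L2_inner \<mu> w (\<lambda>x. a * u x) = a * L2_inner \<mu> w u"
  using L2_inner_scale_left by (simp add: L2_inner_commute)

lemma L2_inner_add_left: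
  assumes "u \<in> L2 \<mu>" "v \<in> L2 \<mu>" "w \<in> L2 \<mu>"
  shows "L2_inner \<mu> (\<lambda>x. u x + v x) w = L2_inner \<mu> u w + L2_inner \<mu> v w"
  using L2_inner_lin_left[OF assms, of 1 1] by simp

lemma L2_inner_add_right:
  assumes "u \<in> L2 \<mu>" "v \<in> L2 \<mu>" "w \<in> L2 \<mu>"
  shows "L2_inner \<mu> w (\<lambda>x. u x + v x) = L2_inner \<mu> w u + L2_inner \<mu> w v"
  using L2_inner_lin_right[OF assms, of 1 1] by simp

lemma L2_inner_diff_left:
  assumes "u \<in> L2 \<mu>" "v \<in> L2 \<mu>" "w \<in> L2 \<mu>"
  shows "L2_inner \<mu> (\<lambda>x. u x - v x) w = L2_inner \<mu> u w - L2_inner \<mu> v w"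
  using L2_inner_lin_left[OF assms, of 1 "-1"] by simp

lemma L2_inner_sum_left:
  assumes "\<And>i. i \<in> I \<Longrightarrow> u i \<in> L2 \<mu>" "w \<in> L2 \<mu>"
  shows "L2_inner \<mu> (\<lambda>x. \<Sum>i\<in>I. c i * u i x) w = (\<Sum>i\<in>I. c i * L2_inner \<mu> (u i) w)"
  using assms
proof (induction I rule: infinite_finite_induct)
  case (insert i I)
  then show ?case
    using L2_inner_lin_left[of "u i" "\<lambda>x. \<Sum>i\<in>I. c i * u i x" w "c i" 1] L2_sum[of I u c] by simp
qed (auto simp: L2_inner_def)

lemma L2_inner_sum_right:
  assumes "\<And>i. i \<in> I \<Longrightarrow> u i \<in> L2 \<mu>" "w \<in> L2 \<mu>"
  shows "L2_inner \<mu> w (\<lambda>x. \<Sum>i\<in>I. c i * u i x) = (\<Sum>i\<in>I. c i * L2_inner \<mu> w (u i))"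
  using L2_inner_sum_left[OF assms] by (simp add: L2_inner_commute)

lemma L2_inner_self_nonneg: "0 \<le> L2_inner \<mu> u u"
  by (simp add: L2_inner_def)

lemma L2_inner_self_eq_0_iff:
  assumes "u \<in> L2 \<mu>"
  shows "L2_inner \<mu> u u = 0 \<longleftrightarrow> (AE x in \<mu>. u x = 0)"
proof -
  have "L2_inner \<mu> u u = (LINT x|\<mu>. (u x)\<^sup>2)"
    by (simp add: L2_inner_def power2_eq_square)
  then show ?thesis
    using assms by (simp add: L2_def integral_nonneg_eq_0_iff_AE)
qed

lemma L2_inner_cong_AE:
  assumes "AE x in \<mu>. u x = u' x" "u \<in> L2 \<mu>" "u' \<in> L2 \<mu>" "w \<in> L2 \<mu>"
  shows "L2_inner \<mu> u w = L2_inner \<mu> u' w"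
  unfolding L2_inner_def using assms
  by (intro integral_cong_AE) (auto intro: borel_measurable_times L2_measurable)

lemma L2_Cauchy_Schwarz_sq:
  assumes u: "u \<in> L2 \<mu>" and v: "v \<in> L2 \<mu>"
  shows "(L2_inner \<mu> u v)\<^sup>2 \<le> L2_inner \<mu> u u * L2_inner \<mu> v v"
proof (rule quadratic_form_Cauchy_Schwarz)
  fix s t
  have "0 \<le> L2_inner \<mu> (\<lambda>x. s * u x + t * v x) (\<lambda>x. s * u x + t * v x)"
    by (rule L2_inner_self_nonneg)
  also have "\<dots> = s\<^sup>2 * L2_inner \<mu> u u + 2 * (s * t * L2_inner \<mu> u v) + t\<^sup>2 * L2_inner \<mu> v v"
    by (simp add: L2_inner_lin_left L2_inner_lin_right L2_lin u v L2_inner_commute[of v u]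
        algebra_simps power2_eq_square)
  finally show "0 \<le> s\<^sup>2 * L2_inner \<mu> u u + 2 * (s * t * L2_inner \<mu> u v) + t\<^sup>2 * L2_inner \<mu> v v" .
qed

definition L2_norm :: "('a \<Rightarrow> real) \<Rightarrow> real" where
  "L2_norm u = sqrt (L2_inner \<mu> u u)"

lemma L2_norm_nonneg [simp]: "0 \<le> L2_norm u"
  by (simp add: L2_norm_def L2_inner_self_nonneg)

lemma L2_norm_sq: "(L2_norm u)\<^sup>2 = L2_inner \<mu> u u"
  by (simp add: L2_norm_def L2_inner_self_nonneg)

lemma L2_norm_scale: "L2_norm (\<lambda>x. a * u x) = \<bar>a\<bar> * L2_norm u"
  by (simp add: L2_norm_def L2_inner_scale_left L2_inner_scale_right real_sqrt_mult
      flip: mult.assoc)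

lemma L2_Cauchy_Schwarz:
  assumes "u \<in> L2 \<mu>" "v \<in> L2 \<mu>"
  shows "\<bar>L2_inner \<mu> u v\<bar> \<le> L2_norm u * L2_norm v"
  using real_sqrt_le_mono[OF L2_Cauchy_Schwarz_sq[OF assms]] by (simp add: L2_norm_def real_sqrt_mult)

lemma L2_norm_triangle:
  assumes u: "u \<in> L2 \<mu>" and v: "v \<in> L2 \<mu>"
  shows "L2_norm (\<lambda>x. u x + v x) \<le> L2_norm u + L2_norm v"
proof (rule power2_le_imp_le)
  have "(L2_norm (\<lambda>x. u x + v x))\<^sup>2 = L2_inner \<mu> u u + 2 * L2_inner \<mu> u v + L2_inner \<mu> v v"
    using L2_inner_lin_left[OF u v L2_add[OF u v], of 1 1] L2_inner_lin_right[OF u v u, of 1 1]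
      L2_inner_lin_right[OF u v v, of 1 1]
    by (simp add: L2_norm_sq L2_inner_commute[of v u])
  also have "\<dots> \<le> (L2_norm u + L2_norm v)\<^sup>2"
    using L2_Cauchy_Schwarz[OF u v] by (simp add: power2_sum L2_norm_sq)
  finally show "(L2_norm (\<lambda>x. u x + v x))\<^sup>2 \<le> (L2_norm u + L2_norm v)\<^sup>2" .
qed simp

lemma L2_norm_diff_triangle:
  assumes u: "u \<in> L2 \<mu>" and v: "v \<in> L2 \<mu>" and w: "w \<in> L2 \<mu>"
  shows "L2_norm (\<lambda>x. u x - w x) \<le> L2_norm (\<lambda>x. u x - v x) + L2_norm (\<lambda>x. v x - w x)"
  using L2_norm_triangle[OF L2_diff[OF u v] L2_diff[OF v w]] by simp

lemma L2_norm_minus: "L2_norm (\<lambda>x. v x - u x) = L2_norm (\<lambda>x. u x - v x)"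
  using L2_norm_scale[of "-1" "\<lambda>x. u x - v x"] by simp

end

section \<open>Compact symmetric operators\<close>

text \<open>Operators act on functions rather than on classes. Linearity is an identity at every
  point, as satisfied by integral operators and matrices, so that combinations can be rewritten
  inside A. Compactness is sequential: images of vectors of the unit ball have norm convergent
  subsequences.\<close>

locale compact_L2_operator =
  fixes \<mu> :: "'a measure" and A :: "('a \<Rightarrow> real) \<Rightarrow> 'a \<Rightarrow> real" and C :: real
  assumes A_L2: "u \<in> L2 \<mu> \<Longrightarrow> A u \<in> L2 \<mu>"
    and A_lin: "u \<in> L2 \<mu> \<Longrightarrow> v \<in> L2 \<mu> \<Longrightarrow> A (\<lambda>x. a * u x + b * v x) = (\<lambda>x. a * A u x + b * A v x)"
    and A_sym: "u \<in> L2 \<mu> \<Longrightarrow> v \<in> L2 \<mu> \<Longrightarrow> L2_inner \<mu> (A u) v = L2_inner \<mu> u (A v)"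
    and A_bdd: "u \<in> L2 \<mu> \<Longrightarrow> L2_norm \<mu> (A u) \<le> C * L2_norm \<mu> u"
    and A_compact: "(\<And>n. U n \<in> L2 \<mu>) \<Longrightarrow> (\<And>n. L2_norm \<mu> (U n) \<le> 1) \<Longrightarrow>
      \<exists>r g. strict_mono (r :: nat \<Rightarrow> nat) \<and> g \<in> L2 \<mu> \<and>
        (\<lambda>n. L2_norm \<mu> (\<lambda>x. A (U (r n)) x - g x)) \<longlonglongrightarrow> 0"
begin

lemma A_zero: "A (\<lambda>_. 0) = (\<lambda>_. 0)"
  using A_lin[OF L2_zero L2_zero, of 0 0] by simp

lemma A_add: "u \<in> L2 \<mu> \<Longrightarrow> v \<in> L2 \<mu> \<Longrightarrow> A (\<lambda>x. u x + v x) = (\<lambda>x. A u x + A v x)"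
  using A_lin[of u v 1 1] by simp

lemma A_scale: "u \<in> L2 \<mu> \<Longrightarrow> A (\<lambda>x. a * u x) = (\<lambda>x. a * A u x)"
  using A_lin[of u u a 0] by simp

lemma A_sum:
  assumes "\<And>i. i \<in> I \<Longrightarrow> u i \<in> L2 \<mu>"
  shows "A (\<lambda>x. \<Sum>i\<in>I. c i * u i x) = (\<lambda>x. \<Sum>i\<in>I. c i * A (u i) x)"
  using assms
proof (induction I rule: infinite_finite_induct)
  case (insert i I)
  then show ?case
    using A_lin[of "u i" "\<lambda>x. \<Sum>i\<in>I. c i * u i x" "c i" 1] L2_sum[of I u \<mu> c] by simp
qed (auto simp: A_zero)

lemma inner_A_sum:
  assumes "\<And>i. i \<in> I \<Longrightarrow> u i \<in> L2 \<mu>"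
  shows "L2_inner \<mu> (A (\<lambda>x. \<Sum>i\<in>I. c i * u i x)) (\<lambda>x. \<Sum>i\<in>I. c i * u i x) =
    (\<Sum>i\<in>I. \<Sum>j\<in>I. c i * c j * L2_inner \<mu> (A (u i)) (u j))"
  using assms
  by (simp add: A_sum L2_inner_sum_left L2_inner_sum_right A_L2 L2_sum sum_distrib_left mult.assoc)

text \<open>Through this identity \<open>posdef\<close> of a Gram matrix becomes positivity of the
  form on the span.\<close>

lemma scaled_inner_A_sum:
  assumes "\<And>i. i \<in> I \<Longrightarrow> u i \<in> L2 \<mu>"
  shows "s * L2_inner \<mu> (A (\<lambda>x. \<Sum>i\<in>I. c i * u i x)) (\<lambda>x. \<Sum>i\<in>I. c i * u i x) =
    (\<Sum>i\<in>I. \<Sum>j\<in>I. c i * c j * (s * L2_inner \<mu> (A (u i)) (u j)))"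
  using inner_A_sum[of I u c, OF assms] by (simp add: sum_distrib_left mult.left_commute)

end

text \<open>Let \<open>M\<close> be the supremum of the form on the unit ball of the orthogonal
  complement \<open>H\<close> of the \<open>e j\<close>; it is positive because of \<open>w\<close>.
  On \<open>H\<close>, the form \<open>M\<close> times the inner product minus \<sigma> times the
  form of A is semidefinite, so a vector that nearly attains \<open>M\<close> is nearly an
  eigenvector. Invariance of \<open>H\<close> under A keeps the residuals in
  \<open>H\<close>.\<close>

lemma eigenvector_in_complement:
  fixes e :: "'j \<Rightarrow> 'a \<Rightarrow> real"
  assumes "compact_L2_operator \<mu> A C" and \<sigma>: "\<sigma> \<in> {1, -1}"
    and e: "\<And>j. j \<in> J \<Longrightarrow> e j \<in> L2_eigenspace \<mu> A (k j)"
    and w: "w \<in> L2 \<mu>" "\<And>j. j \<in> J \<Longrightarrow> L2_inner \<mu> w (e j) = 0" "\<sigma> * L2_inner \<mu> (A w) w > 0"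
  shows "\<exists>g l. g \<in> L2_eigenspace \<mu> A l \<and> sgn l = \<sigma> \<and> L2_inner \<mu> g g > 0 \<and>
    (\<forall>j\<in>J. L2_inner \<mu> g (e j) = 0)"
proof -
  interpret compact_L2_operator \<mu> A C by fact
  note [simp] = L2_inner_lin_left L2_inner_lin_right L2_lin L2_scale A_L2 L2_inner_scale_left
    L2_inner_scale_right A_lin A_scale
  have \<sigma>\<sigma>: "\<sigma> * \<sigma> = 1" "\<bar>\<sigma>\<bar> = 1" using \<sigma> by auto
  define H where "H = {u \<in> L2 \<mu>. \<forall>j\<in>J. L2_inner \<mu> u (e j) = 0}"
  have e2: "e j \<in> L2 \<mu>" "AE x in \<mu>. A (e j) x = k j * e j x" if "j \<in> J" for j
    using e[OF that] by (auto simp: L2_eigenspace_def)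
  have HL: "u \<in> L2 \<mu>" if "u \<in> H" for u using that by (simp add: H_def)
  have H_lin: "(\<lambda>x. a * u x + b * v x) \<in> H" if "u \<in> H" "v \<in> H" for u v a b
    using that e2(1) by (auto simp: H_def)
  have H_scale: "(\<lambda>x. a * u x) \<in> H" if "u \<in> H" for u a
    using that by (auto simp: H_def)
  have HA: "A u \<in> H" if "u \<in> H" for u
  proof -
    have "L2_inner \<mu> (A u) (e j) = 0" if j: "j \<in> J" for j
    proof -
      have "L2_inner \<mu> (A u) (e j) = L2_inner \<mu> (A (e j)) u"
        using A_sym[OF HL[OF \<open>u \<in> H\<close>] e2(1)[OF j]] by (simp add: L2_inner_commute)
      also have "\<dots> = L2_inner \<mu> (\<lambda>x. k j * e j x) u"
        using e2[OF j] HL[OF \<open>u \<in> H\<close>] by (intro L2_inner_cong_AE) auto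
      also have "\<dots> = 0"
        using \<open>u \<in> H\<close> j by (simp add: H_def L2_inner_commute)
      finally show ?thesis .
    qed
    then show ?thesis using that by (simp add: H_def)
  qed
  define q where "q u = \<sigma> * L2_inner \<mu> (A u) u" for u
  \<comment> \<open>A nonnegative bound; C itself can be negative if all vectors have norm
    0.\<close>
  define D where "D = max C 0"
  have D: "D \<ge> 0" by (simp add: D_def)
  have AD: "L2_norm \<mu> (A u) \<le> D * L2_norm \<mu> u" if "u \<in> L2 \<mu>" for u
    using A_bdd[OF that] mult_right_mono[of C D "L2_norm \<mu> u"] by (simp add: D_def)
  have q_bound: "\<bar>q u\<bar> \<le> D * L2_inner \<mu> u u" if "u \<in> L2 \<mu>" for u
  proof -
    have "\<bar>q u\<bar> \<le> L2_norm \<mu> (A u) * L2_norm \<mu> u"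
      using L2_Cauchy_Schwarz[of "A u" \<mu> u] that \<sigma>\<sigma> by (simp add: q_def abs_mult)
    also have "\<dots> \<le> (D * L2_norm \<mu> u) * L2_norm \<mu> u"
      using AD[OF that] by (rule mult_right_mono) simp
    also have "\<dots> = D * L2_inner \<mu> u u"
      by (simp flip: L2_norm_sq add: power2_eq_square)
    finally show ?thesis .
  qed
  define S where "S = {q u | u. u \<in> H \<and> L2_inner \<mu> u u \<le> 1}"
  have S_bdd: "bdd_above S"
  proof (rule bdd_aboveI)
    fix y assume "y \<in> S"
    then obtain u where u: "u \<in> H" "L2_inner \<mu> u u \<le> 1" "y = q u" by (auto simp: S_def)
    then have "y \<le> D * L2_inner \<mu> u u" using q_bound[OF HL[OF u(1)]] by simp
    also have "\<dots> \<le> D" using u D by (simp add: mult_left_le)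
    finally show "y \<le> D" .
  qed
  define M where "M = Sup S"
  have q_scale: "q (\<lambda>x. a * u x) = a\<^sup>2 * q u" if "u \<in> L2 \<mu>" for a u
    using that by (simp add: q_def power2_eq_square)
  have q_le: "q u \<le> M * L2_inner \<mu> u u" if u: "u \<in> H" for u
  proof (cases "L2_inner \<mu> u u = 0")
    case True
    then show ?thesis using q_bound[OF HL[OF u]] by simp
  next
    case False
    then have pos: "L2_inner \<mu> u u > 0" using L2_inner_self_nonneg[of \<mu> u] by simp
    define a where "a = 1 / L2_norm \<mu> u"
    have a: "a\<^sup>2 * L2_inner \<mu> u u = 1"
      using pos by (simp add: a_def power_divide L2_norm_sq)
    have "L2_inner \<mu> (\<lambda>x. a * u x) (\<lambda>x. a * u x) \<le> 1"
      using a by (simp add: power2_eq_square)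
    then have "q (\<lambda>x. a * u x) \<in> S" using H_scale[OF u] by (auto simp: S_def)
    then have "a\<^sup>2 * q u \<le> M"
      unfolding M_def q_scale[OF HL[OF u], symmetric] by (rule cSup_upper[OF _ S_bdd])
    then have "(a\<^sup>2 * q u) * L2_inner \<mu> u u \<le> M * L2_inner \<mu> u u"
      using pos by (intro mult_right_mono) auto
    also have "(a\<^sup>2 * q u) * L2_inner \<mu> u u = q u"
      using a by (metis mult.assoc mult.commute mult.right_neutral)
    finally show ?thesis .
  qed
  have wH: "w \<in> H" using w by (simp add: H_def)
  have M: "M > 0"
  proof -
    have "0 < M * L2_inner \<mu> w w"
      using q_le[OF wH] w(3) by (simp add: q_def)
    then show ?thesis using L2_inner_self_nonneg[of \<mu> w] by (simp add: zero_less_mult_iff)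
  qed
  have "\<exists>u. u \<in> H \<and> L2_inner \<mu> u u \<le> 1 \<and> M - 1 / real (Suc n) < q u" for n
  proof -
    have "q (\<lambda>_. 0) \<in> S" by (auto simp: S_def H_def L2_zero L2_inner_def)
    then have "S \<noteq> {}" by auto
    then show ?thesis
      using less_cSupD[of S "M - 1 / real (Suc n)"] by (auto simp: M_def S_def)
  qed
  then obtain u where u: "\<And>n. u n \<in> H" "\<And>n. L2_inner \<mu> (u n) (u n) \<le> 1"
    "\<And>n. M - 1 / real (Suc n) < q (u n)" by metis
  have uL: "u n \<in> L2 \<mu>" for n using HL[OF u(1)] .
  \<comment> \<open>The residual of the equation \<open>A u = \<sigma> * M * u\<close>, up to
    sign.\<close>
  define z where "z n = (\<lambda>x. M * u n x + (- \<sigma>) * A (u n) x)" for n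
  have zH: "z n \<in> H" for n unfolding z_def by (intro H_lin HA u(1))
  have zL: "z n \<in> L2 \<mu>" for n using HL[OF zH] .
  \<comment> \<open>Cauchy--Schwarz for the form \<open>M \<langle>u, v\<rangle> - \<sigma> \<langle>A u, v\<rangle>\<close>, which is positive semidefinite on \<open>H\<close>\<close>
  have z_small: "L2_inner \<mu> (z n) (z n) \<le> (M + D) * (1 / real (Suc n))" for n
  proof -
    define f where "f a b = M * L2_inner \<mu> a b - \<sigma> * L2_inner \<mu> (A a) b" for a b
    have f_nonneg: "0 \<le> f a a" if "a \<in> H" for a
      using q_le[OF that] by (simp add: f_def q_def)
    have "(f (u n) (z n))\<^sup>2 \<le> f (u n) (u n) * f (z n) (z n)"
    proof (rule quadratic_form_Cauchy_Schwarz)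
      fix s t
      have "f (\<lambda>x. s * u n x + t * z n x) (\<lambda>x. s * u n x + t * z n x) =
          s\<^sup>2 * f (u n) (u n) + s * t * (f (u n) (z n) + f (z n) (u n)) + t\<^sup>2 * f (z n) (z n)"
        using uL[of n] zL[of n] by (simp add: f_def algebra_simps power2_eq_square)
      also have "f (z n) (u n) = f (u n) (z n)"
        using A_sym[OF uL zL, of n n] by (simp add: f_def L2_inner_commute)
      finally show "0 \<le> s\<^sup>2 * f (u n) (u n) + 2 * (s * t * f (u n) (z n)) + t\<^sup>2 * f (z n) (z n)"
        using f_nonneg[OF H_lin[OF u(1) zH], of s n t n] by (simp add: algebra_simps)
    qed
    \<comment> \<open>The functional \<open>f (u n)\<close> is represented by \<open>z n\<close>, so
      its value there is the squared norm.\<close>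
    moreover have "f (u n) (z n) = L2_inner \<mu> (z n) (z n)"
    proof -
      have "L2_inner \<mu> (z n) (z n) = M * L2_inner \<mu> (u n) (z n) + (- \<sigma>) * L2_inner \<mu> (A (u n)) (z n)"
        by (subst (1) z_def) (rule L2_inner_lin_left[OF uL A_L2[OF uL] zL])
      then show ?thesis by (simp add: f_def)
    qed
    \<comment> \<open>At most the gap between \<open>M\<close> and \<open>q (u n)\<close>, hence
      small by the choice of \<open>u n\<close>.\<close>
    moreover have "f (u n) (u n) \<le> 1 / real (Suc n)"
    proof -
      have "f (u n) (u n) \<le> M - q (u n)"
        using u(2)[of n] M by (simp add: f_def q_def mult_left_le)
      then show ?thesis using u(3)[of n] by simp
    qed
    moreover have "f (z n) (z n) \<le> (M + D) * L2_inner \<mu> (z n) (z n)"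
      using q_bound[OF zL, of n] by (simp add: f_def q_def algebra_simps)
    ultimately have "(L2_inner \<mu> (z n) (z n))\<^sup>2 \<le>
        (1 / real (Suc n)) * ((M + D) * L2_inner \<mu> (z n) (z n))"
      using mult_mono[of "f (u n) (u n)" "1 / real (Suc n)" "f (z n) (z n)"]
        f_nonneg[OF u(1)[of n]] f_nonneg[OF zH[of n]] by (metis order.trans of_nat_0_le_iff zero_le_divide_1_iff)
    then have *: "L2_inner \<mu> (z n) (z n) * L2_inner \<mu> (z n) (z n) \<le>
        ((M + D) * (1 / real (Suc n))) * L2_inner \<mu> (z n) (z n)"
      by (simp add: power2_eq_square mult_ac)
    show ?thesis
    proof (cases "L2_inner \<mu> (z n) (z n) = 0")
      case True
      then show ?thesis using M D by simp
    next
      case False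
      then show ?thesis
        using mult_right_le_imp_le[OF *] L2_inner_self_nonneg[of \<mu> "z n"] by simp
    qed
  qed
  have z_lim: "(\<lambda>n. L2_norm \<mu> (z n)) \<longlonglongrightarrow> 0"
  proof -
    have "(\<lambda>n. (M + D) * (1 / real (Suc n))) \<longlonglongrightarrow> 0"
      using tendsto_mult_right_zero[OF LIMSEQ_Suc[OF lim_1_over_n], of "M + D"] .
    then have "(\<lambda>n. L2_inner \<mu> (z n) (z n)) \<longlonglongrightarrow> 0"
      by (rule Lim_null_comparison[rotated])
        (simp only: real_norm_def abs_of_nonneg[OF L2_inner_self_nonneg] z_small eventually_True)
    from tendsto_real_sqrt[OF this] show ?thesis
      by (simp add: L2_norm_def)
  qed
  have "L2_norm \<mu> (u n) \<le> 1" for n using u(2) by (simp add: L2_norm_def)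
  then obtain r g where r: "strict_mono (r :: nat \<Rightarrow> nat)" and g: "g \<in> L2 \<mu>"
    and lim: "(\<lambda>n. L2_norm \<mu> (\<lambda>x. A (u (r n)) x - g x)) \<longlonglongrightarrow> 0"
    using A_compact[of u] uL by blast
  \<comment> \<open>M u = z + \<sigma> A u, with z tending to 0 and A u tending to g along the
    subsequence; so \<sigma> g is the limit of \<open>M * u (r n)\<close>.\<close>
  define h where "h = (\<lambda>x. \<sigma> * g x)"
  have hL: "h \<in> L2 \<mu>" using g by (simp add: h_def)
  define y where "y n = (\<lambda>x. M * u (r n) x)" for n
  have yL: "y n \<in> L2 \<mu>" for n using uL by (simp add: y_def)
  have AgL: "(\<lambda>x. A (u (r n)) x - g x) \<in> L2 \<mu>" for n
    using g uL by (intro L2_diff) auto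
  have y_lim: "(\<lambda>n. L2_norm \<mu> (\<lambda>x. y n x - h x)) \<longlonglongrightarrow> 0"
  proof (rule real_tendsto_sandwich[OF _ _ tendsto_const])
    have "(\<lambda>n. L2_norm \<mu> (z (r n)) + L2_norm \<mu> (\<lambda>x. A (u (r n)) x - g x)) \<longlonglongrightarrow> 0 + 0"
      using LIMSEQ_subseq_LIMSEQ[OF z_lim r] lim by (intro tendsto_add) (auto simp: o_def)
    then show "(\<lambda>n. L2_norm \<mu> (z (r n)) + L2_norm \<mu> (\<lambda>x. A (u (r n)) x - g x)) \<longlonglongrightarrow> 0"
      by simp
    have "L2_norm \<mu> (\<lambda>x. y n x - h x) \<le> L2_norm \<mu> (z (r n)) + L2_norm \<mu> (\<lambda>x. A (u (r n)) x - g x)" for n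
    proof -
      have "(\<lambda>x. y n x - h x) = (\<lambda>x. z (r n) x + \<sigma> * (A (u (r n)) x - g x))"
        by (auto simp: y_def h_def z_def algebra_simps)
      then show ?thesis
        using L2_norm_triangle[OF zL L2_scale[OF AgL], of "r n" \<sigma> n] \<sigma>\<sigma> by (simp add: L2_norm_scale)
    qed
    then show "\<forall>\<^sub>F n in sequentially. L2_norm \<mu> (\<lambda>x. y n x - h x)
        \<le> L2_norm \<mu> (z (r n)) + L2_norm \<mu> (\<lambda>x. A (u (r n)) x - g x)" by simp
  qed simp
  have inner_lim: "(\<lambda>n. L2_inner \<mu> (y n) v) \<longlonglongrightarrow> L2_inner \<mu> h v" if v: "v \<in> L2 \<mu>" for v
  proof -
    have "(\<lambda>n. L2_norm \<mu> (\<lambda>x. y n x - h x) * L2_norm \<mu> v) \<longlonglongrightarrow> 0"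
      using tendsto_mult_right[OF y_lim, of "L2_norm \<mu> v"] by simp
    moreover have "\<bar>L2_inner \<mu> (y n) v - L2_inner \<mu> h v\<bar> \<le> L2_norm \<mu> (\<lambda>x. y n x - h x) * L2_norm \<mu> v" for n
      using L2_Cauchy_Schwarz[OF L2_diff[OF yL hL] v] L2_inner_diff_left[OF yL hL v] by simp
    ultimately have "(\<lambda>n. L2_inner \<mu> (y n) v - L2_inner \<mu> h v) \<longlonglongrightarrow> 0"
      by (rule_tac Lim_null_comparison) (auto intro: always_eventually)
    then show ?thesis by (simp add: LIM_zero_iff)
  qed
  have hH: "L2_inner \<mu> h (e j) = 0" if "j \<in> J" for j
  proof -
    have "L2_inner \<mu> (y n) (e j) = 0" for n
      using u(1)[of "r n"] that by (simp add: y_def H_def)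
    then show ?thesis using inner_lim[OF e2(1)[OF that]] by (simp add: LIMSEQ_const_iff)
  qed
  \<comment> \<open>\<open>A (y n)\<close> tends to \<open>A h\<close> by boundedness and equals
    \<open>M\<close> times the image of \<open>u (r n)\<close>, which tends to \<open>M * g\<close>.
    Since \<sigma> squares to 1, this limit is \<open>\<sigma> * M * h\<close>.\<close>
  have Ah: "AE x in \<mu>. A h x = (\<sigma> * M) * h x"
  proof -
    have "(\<lambda>n. D * L2_norm \<mu> (\<lambda>x. y n x - h x) + M * L2_norm \<mu> (\<lambda>x. A (u (r n)) x - g x)) \<longlonglongrightarrow> D * 0 + M * 0"
      by (intro tendsto_intros y_lim lim)
    moreover have "L2_norm \<mu> (\<lambda>x. A h x - M * g x) \<le>
        D * L2_norm \<mu> (\<lambda>x. y n x - h x) + M * L2_norm \<mu> (\<lambda>x. A (u (r n)) x - g x)" for n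
    proof -
      have "A (\<lambda>x. y n x - h x) = (\<lambda>x. M * A (u (r n)) x - A h x)"
        using A_lin[OF yL[of n] hL, of 1 "-1"] A_scale[OF uL[of "r n"], of M] by (simp add: y_def)
      then have "L2_norm \<mu> (\<lambda>x. M * A (u (r n)) x - A h x) \<le> D * L2_norm \<mu> (\<lambda>x. y n x - h x)"
        using AD[OF L2_diff[OF yL hL], of n] by simp
      moreover have "L2_norm \<mu> (\<lambda>x. A h x - M * g x) \<le> L2_norm \<mu> (\<lambda>x. A h x - M * A (u (r n)) x) +
          L2_norm \<mu> (\<lambda>x. M * A (u (r n)) x - M * g x)"
        using hL g uL by (intro L2_norm_diff_triangle) auto
      moreover have "L2_norm \<mu> (\<lambda>x. M * A (u (r n)) x - M * g x) = M * L2_norm \<mu> (\<lambda>x. A (u (r n)) x - g x)"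
        using L2_norm_scale[of \<mu> M "\<lambda>x. A (u (r n)) x - g x"] M by (simp add: right_diff_distrib)
      ultimately show ?thesis by (simp add: L2_norm_minus)
    qed
    ultimately have "L2_norm \<mu> (\<lambda>x. A h x - M * g x) \<le> 0"
      by (intro LIMSEQ_le_const) auto
    then have "L2_inner \<mu> (\<lambda>x. A h x - M * g x) (\<lambda>x. A h x - M * g x) = 0"
      by (simp add: L2_norm_def L2_inner_self_nonneg antisym)
    moreover have "(\<lambda>x. A h x - M * g x) \<in> L2 \<mu>"
      using hL g by (intro L2_diff) auto
    ultimately have "AE x in \<mu>. A h x - M * g x = 0"
      by (simp add: L2_inner_self_eq_0_iff)
    moreover have eq: "(\<sigma> * M) * h x = M * g x" for x
      using \<sigma> by (auto simp: h_def)
    ultimately show ?thesis unfolding eq by simp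
  qed
  \<comment> \<open>If h were 0, then \<open>y n\<close> would tend to 0. But its squared norm is at
    least \<open>M * q (u (r n))\<close>, which stays near the square of \<open>M\<close>.\<close>
  have h_pos: "L2_inner \<mu> h h > 0"
  proof (rule ccontr)
    assume "\<not> ?thesis"
    then have h0: "L2_norm \<mu> h = 0"
      using L2_inner_self_nonneg[of \<mu> h] by (simp add: L2_norm_def)
    have "L2_norm \<mu> (y n) \<le> L2_norm \<mu> (\<lambda>x. y n x - h x)" for n
      using L2_norm_triangle[OF L2_diff[OF yL hL] hL, of n] h0 by simp
    then have "(\<lambda>n. L2_norm \<mu> (y n)) \<longlonglongrightarrow> 0"
      by (intro real_tendsto_sandwich[OF _ _ tendsto_const y_lim]) (auto intro: always_eventually)
    from tendsto_power[OF this, of 2] have "(\<lambda>n. L2_inner \<mu> (y n) (y n)) \<longlonglongrightarrow> 0"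
      by (simp add: L2_norm_sq)
    moreover have "M * (M - 1 / real (Suc n)) \<le> L2_inner \<mu> (y n) (y n)" for n
    proof -
      have "1 / real (Suc (r n)) \<le> 1 / real (Suc n)"
        using seq_suble[OF r, of n] by (intro divide_left_mono) auto
      then have "M - 1 / real (Suc n) \<le> M * L2_inner \<mu> (u (r n)) (u (r n))"
        using u(3)[of "r n"] q_le[OF u(1)[of "r n"]] by linarith
      then show ?thesis using M uL by (simp add: y_def mult_left_mono)
    qed
    moreover have "(\<lambda>n. M * (M - 1 / real (Suc n))) \<longlonglongrightarrow> M * (M - 0)"
      using LIMSEQ_Suc[OF lim_1_over_n] by (intro tendsto_intros)
    ultimately have "M * (M - 0) \<le> 0"
      by (intro LIMSEQ_le) auto
    then show False using M by (simp add: mult_le_0_iff)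
  qed
  have "sgn (\<sigma> * M) = \<sigma>" using \<sigma> M by (auto simp: sgn_mult)
  then show ?thesis
    using hL Ah h_pos hH by (intro exI[of _ h] exI[of _ "\<sigma> * M"]) (auto simp: L2_eigenspace_def)
qed

lemma L2_indep_orthogonal:
  assumes fin: "finite U" and U: "U \<subseteq> L2 \<mu>" "\<And>u. u \<in> U \<Longrightarrow> L2_inner \<mu> u u > 0"
    and orth: "\<And>u v. u \<in> U \<Longrightarrow> v \<in> U \<Longrightarrow> u \<noteq> v \<Longrightarrow> L2_inner \<mu> u v = 0"
  shows "L2_indep \<mu> U"
  unfolding L2_indep_def
proof (intro allI impI ballI)
  fix c v assume AE: "AE x in \<mu>. (\<Sum>u\<in>U. c u * u x) = 0" and v: "v \<in> U"
  have "0 = L2_inner \<mu> (\<lambda>x. \<Sum>u\<in>U. c u * u x) v"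
    using L2_inner_cong_AE[OF AE _ L2_zero] L2_sum[of U "\<lambda>u. u"] U v by (auto simp: L2_inner_def)
  also have "\<dots> = (\<Sum>u\<in>U. c u * L2_inner \<mu> u v)"
    using U v by (intro L2_inner_sum_left) auto
  also have "\<dots> = (\<Sum>u\<in>U. if u = v then c v * L2_inner \<mu> v v else 0)"
    using orth v by (intro sum.cong) auto
  also have "\<dots> = c v * L2_inner \<mu> v v"
    using v fin by simp
  finally show "c v = 0" using U(2)[OF v] by simp
qed

lemma eigenvectors_orthogonal:
  assumes "compact_L2_operator \<mu> A C"
    and u: "u \<in> L2_eigenspace \<mu> A k" and v: "v \<in> L2_eigenspace \<mu> A l" and kl: "k \<noteq> l"
  shows "L2_inner \<mu> u v = 0"
proof -
  interpret compact_L2_operator \<mu> A C by fact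
  have uv: "u \<in> L2 \<mu>" "v \<in> L2 \<mu>" "AE x in \<mu>. A u x = k * u x" "AE x in \<mu>. A v x = l * v x"
    using u v by (auto simp: L2_eigenspace_def)
  have "k * L2_inner \<mu> u v = L2_inner \<mu> (A u) v"
    using L2_inner_cong_AE[OF uv(3)] uv by (simp add: A_L2 L2_scale L2_inner_scale_left)
  also have "\<dots> = L2_inner \<mu> (A v) u"
    using A_sym[OF uv(1,2)] by (simp add: L2_inner_commute)
  also have "\<dots> = l * L2_inner \<mu> u v"
    using L2_inner_cong_AE[OF uv(4)] uv
    by (simp add: A_L2 L2_scale L2_inner_scale_left L2_inner_commute)
  finally show ?thesis using kl by simp
qed

text \<open>The n test vectors are kept throughout. While m < n eigenvectors are known,
  orthogonality to them imposes m conditions on n coefficients, so a nonzero combination satisfies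
  them, and positive definiteness makes the form positive there.\<close>

lemma posdef_imp_orthogonal_eigenvectors:
  fixes m n :: nat
  assumes op: "compact_L2_operator \<mu> A C" and \<sigma>: "\<sigma> \<in> {1, -1}"
    and u: "\<And>i. i < n \<Longrightarrow> u i \<in> L2 \<mu>"
    and pd: "posdef {..<n} (\<lambda>i j. \<sigma> * L2_inner \<mu> (A (u i)) (u j))"
    and "m \<le> n"
  shows "\<exists>g k. \<forall>i<m. g i \<in> L2_eigenspace \<mu> A (k i) \<and> sgn (k i) = \<sigma> \<and> L2_inner \<mu> (g i) (g i) > 0 \<and>
    (\<forall>j<i. L2_inner \<mu> (g i) (g j) = 0)"
  using \<open>m \<le> n\<close>
proof (induction m)
  case 0
  then show ?case by simp
next
  case (Suc m)
  then obtain g k where gk: "\<And>i. i < m \<Longrightarrow> g i \<in> L2_eigenspace \<mu> A (k i)"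
    "\<And>i. i < m \<Longrightarrow> sgn (k i) = \<sigma>" "\<And>i. i < m \<Longrightarrow> L2_inner \<mu> (g i) (g i) > 0"
    "\<And>i j. i < m \<Longrightarrow> j < i \<Longrightarrow> L2_inner \<mu> (g i) (g j) = 0"
    using Suc_leD by blast
  interpret compact_L2_operator \<mu> A C by fact
  obtain c where c: "\<exists>i\<in>{..<n}. c i \<noteq> 0"
    "\<And>j. j < m \<Longrightarrow> (\<Sum>i<n. c i * L2_inner \<mu> (u i) (g j)) = 0"
    using exists_nontrivial_solution[of "{..<m}" "{..<n}" "\<lambda>j i. L2_inner \<mu> (u i) (g j)"] Suc.prems
    by auto
  define w where "w = (\<lambda>x. \<Sum>i<n. c i * u i x)"
  have w: "w \<in> L2 \<mu>" unfolding w_def using u by (intro L2_sum) auto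
  have "L2_inner \<mu> w (g j) = 0" if "j < m" for j
    unfolding w_def using u gk(1)[OF that] c(2)[OF that]
    by (subst L2_inner_sum_left) (auto simp: L2_eigenspace_def)
  moreover have "\<sigma> * L2_inner \<mu> (A w) w > 0"
  proof -
    have "\<sigma> * L2_inner \<mu> (A w) w =
        (\<Sum>i<n. \<Sum>j<n. c i * c j * (\<sigma> * L2_inner \<mu> (A (u i)) (u j)))"
      unfolding w_def using u by (intro scaled_inner_A_sum) auto
    then show ?thesis using pd c(1) unfolding posdef_def by simp
  qed
  ultimately obtain h l where h: "h \<in> L2_eigenspace \<mu> A l" "sgn l = \<sigma>" "L2_inner \<mu> h h > 0"
    "\<And>j. j < m \<Longrightarrow> L2_inner \<mu> h (g j) = 0"
    using eigenvector_in_complement[OF op \<sigma>, of "{..<m}" g k w] gk(1) w by auto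
  then show ?case
    using gk by (intro exI[of _ "g(m := h)"] exI[of _ "k(m := l)"]) (auto simp: less_Suc_eq)
qed

text \<open>A bound on the sum of multiplicities yields independent vectors in several eigenspaces;
  on their joint span the form is the sum of \<sigma> * k times the squared norms of the components.
  Conversely, the eigenvectors obtained from a positive definite Gram matrix are sorted by
  eigenvalue and counted.\<close>

lemma enat_le_sig_op_iff:
  assumes op: "compact_L2_operator \<mu> A C" and \<sigma>: "\<sigma> \<in> {1, -1}"
  shows "enat n \<le> sig_op \<sigma> \<mu> A \<longleftrightarrow>
    (\<exists>u. (\<forall>i<n. u i \<in> L2 \<mu>) \<and> posdef {..<n} (\<lambda>i j. \<sigma> * L2_inner \<mu> (A (u i)) (u j)))"
    (is "?L \<longleftrightarrow> ?R")
proof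
  interpret compact_L2_operator \<mu> A C by fact
  assume ?L
  moreover have "{E. finite E \<and> (\<forall>k\<in>E. sgn k = \<sigma>)} \<noteq> {}" by auto
  ultimately obtain E where E: "finite E" "\<And>k. k \<in> E \<Longrightarrow> sgn k = \<sigma>" "enat n \<le> (\<Sum>k\<in>E. L2_mult \<mu> A k)"
    unfolding sig_op_def by (subst (asm) enat_le_SUP_iff) auto
  then obtain a where a: "\<And>k. k \<in> E \<Longrightarrow> enat (a k) \<le> L2_mult \<mu> A k" "n \<le> (\<Sum>k\<in>E. a k)"
    using enat_le_sum[of E n] by blast
  have "\<exists>U. finite U \<and> U \<subseteq> L2_eigenspace \<mu> A k \<and> L2_indep \<mu> U \<and> a k \<le> card U" if "k \<in> E" for k
  proof -
    have "{U. finite U \<and> U \<subseteq> L2_eigenspace \<mu> A k \<and> L2_indep \<mu> U} \<noteq> {}"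
      by (auto intro!: exI[of _ "{}"] simp: L2_indep_def)
    then show ?thesis
      using a(1)[OF that] unfolding L2_mult_def by (subst (asm) enat_le_SUP_iff) auto
  qed
  then obtain U where U: "\<And>k. k \<in> E \<Longrightarrow> finite (U k)" "\<And>k. k \<in> E \<Longrightarrow> U k \<subseteq> L2_eigenspace \<mu> A k"
    "\<And>k. k \<in> E \<Longrightarrow> L2_indep \<mu> (U k)" "\<And>k. k \<in> E \<Longrightarrow> a k \<le> card (U k)"
    by metis
  \<comment> \<open>Indexing by pairs (eigenvalue, vector) makes the size of the family the sum of
    the cardinalities of the \<open>U k\<close>.\<close>
  define I where "I = Sigma E U"
  have UL: "u \<in> L2 \<mu>" if "k \<in> E" "u \<in> U k" for k u
    using U(2)[OF that(1)] that(2) by (auto simp: L2_eigenspace_def)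
  have fin: "finite I" using E(1) U(1) by (auto simp: I_def)
  have card: "n \<le> card I"
    using a(2) sum_mono[of E a "\<lambda>k. card (U k)"] U(4) E(1) U(1) by (simp add: I_def card_SigmaI)
  have sum_I: "(\<Sum>i\<in>I. f i) = (\<Sum>k\<in>E. \<Sum>u\<in>U k. f (k, u))" for f :: "_ \<Rightarrow> real"
    using sum.Sigma[of E U "\<lambda>k u. f (k, u)"] E(1) U(1) by (simp add: I_def)
  have "posdef I (\<lambda>i j. \<sigma> * L2_inner \<mu> (A (snd i)) (snd j))"
    unfolding posdef_def
  proof (intro allI impI)
    fix c :: "real \<times> ('a \<Rightarrow> real) \<Rightarrow> real"
    assume "\<exists>i\<in>I. c i \<noteq> 0"
    then obtain k0 v0 where kv: "k0 \<in> E" "v0 \<in> U k0" "c (k0, v0) \<noteq> 0" by (auto simp: I_def)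
    \<comment> \<open>The component of the combination in the eigenspace of k. The vectors of one
      \<open>U k\<close> need not be orthogonal, so each eigenspace is summed up before
      orthogonality of different eigenspaces removes the cross terms.\<close>
    define w where "w k = (\<lambda>x. \<Sum>u\<in>U k. c (k, u) * u x)" for k
    have wL: "w k \<in> L2 \<mu>" if "k \<in> E" for k
      unfolding w_def using UL[OF that] by (intro L2_sum) auto
    have Aw: "AE x in \<mu>. A (w k) x = k * w k x" if "k \<in> E" for k
    proof -
      have "AE x in \<mu>. \<forall>u\<in>U k. A u x = k * u x"
        using U(1,2)[OF that] by (intro AE_finite_allI) (auto simp: L2_eigenspace_def)
      then show ?thesis
        using UL[OF that] by (simp add: w_def A_sum)
          (auto elim!: eventually_mono simp: sum_distrib_left mult_ac intro!: sum.cong)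
    qed
    have we: "w k \<in> L2_eigenspace \<mu> A k" if "k \<in> E" for k
      using wL Aw that by (simp add: L2_eigenspace_def)
    have inner: "L2_inner \<mu> (A (w k)) (w l) = (if k = l then k * L2_inner \<mu> (w k) (w k) else 0)"
      if "k \<in> E" "l \<in> E" for k l
    proof -
      have "L2_inner \<mu> (A (w k)) (w l) = k * L2_inner \<mu> (w k) (w l)"
        using L2_inner_cong_AE[OF Aw[OF that(1)]] wL that by (simp add: A_L2 L2_scale L2_inner_scale_left)
      then show ?thesis using eigenvectors_orthogonal[OF op we we] that by auto
    qed
    have "(\<Sum>i\<in>I. \<Sum>j\<in>I. c i * c j * (\<sigma> * L2_inner \<mu> (A (snd i)) (snd j))) =
        (\<Sum>k\<in>E. \<Sum>u\<in>U k. \<Sum>l\<in>E. \<Sum>v\<in>U l. c (k, u) * c (l, v) * (\<sigma> * L2_inner \<mu> (A u) v))"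
      by (simp add: sum_I)
    also have "\<dots> = (\<Sum>k\<in>E. \<Sum>l\<in>E. \<sigma> * L2_inner \<mu> (A (w k)) (w l))"
    proof (intro sum.cong refl)
      fix k assume k: "k \<in> E"
      have "(\<Sum>u\<in>U k. \<Sum>l\<in>E. \<Sum>v\<in>U l. c (k, u) * c (l, v) * (\<sigma> * L2_inner \<mu> (A u) v)) =
        (\<Sum>l\<in>E. \<Sum>u\<in>U k. \<Sum>v\<in>U l. c (k, u) * c (l, v) * (\<sigma> * L2_inner \<mu> (A u) v))"
        by (rule sum.swap)
      also have "\<dots> = (\<Sum>l\<in>E. \<sigma> * L2_inner \<mu> (A (w k)) (w l))"
      proof (intro sum.cong refl)
        fix l assume l: "l \<in> E"
        show "(\<Sum>u\<in>U k. \<Sum>v\<in>U l. c (k, u) * c (l, v) * (\<sigma> * L2_inner \<mu> (A u) v)) =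
          \<sigma> * L2_inner \<mu> (A (w k)) (w l)"
          unfolding w_def using UL[OF k] UL[OF l]
          by (simp add: A_sum L2_inner_sum_left L2_inner_sum_right A_L2 L2_sum sum_distrib_left)
            (intro sum.cong refl, simp add: mult_ac)
      qed
      finally show "(\<Sum>u\<in>U k. \<Sum>l\<in>E. \<Sum>v\<in>U l. c (k, u) * c (l, v) * (\<sigma> * L2_inner \<mu> (A u) v)) =
        (\<Sum>l\<in>E. \<sigma> * L2_inner \<mu> (A (w k)) (w l))" .
    qed
    also have "\<dots> = (\<Sum>k\<in>E. (\<sigma> * k) * L2_inner \<mu> (w k) (w k))"
      using E(1) by (simp add: inner if_distrib mult.assoc cong: if_cong)
    also have "\<dots> > 0"
    proof (rule sum_pos2[OF E(1) kv(1)])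
      have \<sigma>k: "\<sigma> * k > 0" if "k \<in> E" for k
        using E(2)[OF that] \<sigma> by (auto simp: sgn_if split: if_splits)
      then show "0 \<le> \<sigma> * k * L2_inner \<mu> (w k) (w k)" if "k \<in> E" for k
        using that by (simp add: L2_inner_self_nonneg less_imp_le)
      have "\<not> (AE x in \<mu>. w k0 x = 0)"
        using U(3)[OF kv(1), unfolded L2_indep_def, rule_format, of "\<lambda>u. c (k0, u)" v0] kv(2,3)
        unfolding w_def by blast
      then have "L2_inner \<mu> (w k0) (w k0) \<noteq> 0"
        using wL[OF kv(1)] by (simp add: L2_inner_self_eq_0_iff)
      then show "0 < \<sigma> * k0 * L2_inner \<mu> (w k0) (w k0)"
        using \<sigma>k[OF kv(1)] L2_inner_self_nonneg[of \<mu> "w k0"] by simp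
    qed
    finally show "0 < (\<Sum>i\<in>I. \<Sum>j\<in>I. c i * c j * (\<sigma> * L2_inner \<mu> (A (snd i)) (snd j)))" .
  qed
  from posdef_le_card[OF this fin card] obtain f where f: "f ` {..<n} \<subseteq> I"
    "posdef {..<n} (\<lambda>i j. \<sigma> * L2_inner \<mu> (A (snd (f i))) (snd (f j)))" .
  show ?R
    using f UL by (intro exI[of _ "\<lambda>i. snd (f i)"]) (fastforce simp: I_def)
next
  assume ?R
  then obtain u where u: "\<And>i. i < n \<Longrightarrow> u i \<in> L2 \<mu>"
    and pd: "posdef {..<n} (\<lambda>i j. \<sigma> * L2_inner \<mu> (A (u i)) (u j))" by blast
  obtain g k where gk: "\<And>i. i < n \<Longrightarrow> g i \<in> L2_eigenspace \<mu> A (k i)"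
    "\<And>i. i < n \<Longrightarrow> sgn (k i) = \<sigma>" "\<And>i. i < n \<Longrightarrow> L2_inner \<mu> (g i) (g i) > 0"
    "\<And>i j. i < n \<Longrightarrow> j < i \<Longrightarrow> L2_inner \<mu> (g i) (g j) = 0"
    using posdef_imp_orthogonal_eigenvectors[OF op \<sigma> u pd order.refl] by blast
  have orth: "L2_inner \<mu> (g i) (g j) = 0" if "i < n" "j < n" "i \<noteq> j" for i j
    using gk(4)[of i j] gk(4)[of j i] that by (cases i j rule: linorder_cases) (auto simp: L2_inner_commute)
  have inj: "inj_on g {..<n}"
    using orth gk(3) by (auto simp: inj_on_def) (metis less_irrefl)
  \<comment> \<open>The fibres of k partition the n indices. As g is injective, the cardinalities of
    the \<open>U l\<close> add up to n.\<close>
  define E where "E = k ` {..<n}"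
  define U where "U l = g ` {i \<in> {..<n}. k i = l}" for l
  have U_card: "card (U l) = card {i \<in> {..<n}. k i = l}" for l
    unfolding U_def using inj by (intro card_image) (auto simp: inj_on_def)
  have "enat (card (U l)) \<le> L2_mult \<mu> A l" for l
  proof -
    have "L2_indep \<mu> (U l)"
      using gk(1,3) orth unfolding U_def
      by (intro L2_indep_orthogonal) (auto simp: L2_eigenspace_def)
    moreover have "U l \<subseteq> L2_eigenspace \<mu> A l" using gk(1) by (auto simp: U_def)
    ultimately show ?thesis unfolding L2_mult_def by (intro SUP_upper) (auto simp: U_def)
  qed
  then have "(\<Sum>l\<in>E. enat (card (U l))) \<le> (\<Sum>l\<in>E. L2_mult \<mu> A l)"
    by (rule sum_mono)
  moreover have "(\<Sum>l\<in>E. enat (card (U l))) = enat (\<Sum>l\<in>E. card (U l))"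
    by (induction E rule: infinite_finite_induct) (auto simp: zero_enat_def)
  moreover have "(\<Sum>l\<in>E. card (U l)) = n"
    using sum.image_gen[of "{..<n}" "\<lambda>_. 1::nat" k] by (simp add: E_def U_card)
  moreover have "(\<Sum>l\<in>E. L2_mult \<mu> A l) \<le> sig_op \<sigma> \<mu> A"
    unfolding sig_op_def using gk(2) by (intro SUP_upper) (auto simp: E_def)
  ultimately show ?L by simp
qed

section \<open>Symmetric matrices\<close>

text \<open>Here the eigenvalue may be any real number, including 0, as an eigenbasis of a matrix
  requires. A nonzero value of the form leads back to the lemma with prescribed sign; the remaining
  case is a form vanishing on the whole complement.\<close>

lemma exists_eigenvector_in_complement:
  fixes e :: "'j \<Rightarrow> 'a \<Rightarrow> real"
  assumes op: "compact_L2_operator \<mu> A C"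
    and e: "\<And>j. j \<in> J \<Longrightarrow> e j \<in> L2_eigenspace \<mu> A (k j)"
    and u: "u \<in> L2 \<mu>" "\<And>j. j \<in> J \<Longrightarrow> L2_inner \<mu> u (e j) = 0" "L2_inner \<mu> u u > 0"
  shows "\<exists>g l. g \<in> L2_eigenspace \<mu> A l \<and> L2_inner \<mu> g g > 0 \<and> (\<forall>j\<in>J. L2_inner \<mu> g (e j) = 0)"
proof -
  interpret compact_L2_operator \<mu> A C by fact
  define H where "H = {u \<in> L2 \<mu>. \<forall>j\<in>J. L2_inner \<mu> u (e j) = 0}"
  have e2: "e j \<in> L2 \<mu>" "AE x in \<mu>. A (e j) x = k j * e j x" if "j \<in> J" for j
    using e[OF that] by (auto simp: L2_eigenspace_def)
  show ?thesis
  proof (cases "\<exists>w\<in>H. L2_inner \<mu> (A w) w \<noteq> 0")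
    case True
    then obtain w where w: "w \<in> H" "L2_inner \<mu> (A w) w \<noteq> 0" by blast
    then have "sgn (L2_inner \<mu> (A w) w) \<in> {1, -1}" "sgn (L2_inner \<mu> (A w) w) * L2_inner \<mu> (A w) w > 0"
      by (auto simp: sgn_if)
    with eigenvector_in_complement[OF op this(1), where J = J and e = e and k = k and w = w] e w(1)
    show ?thesis unfolding H_def by blast
  next
    case False
    have Au: "A u \<in> L2 \<mu>" using A_L2[OF u(1)] .
    have "L2_inner \<mu> (A u) (e j) = 0" if j: "j \<in> J" for j
    proof -
      have "L2_inner \<mu> (A u) (e j) = L2_inner \<mu> (A (e j)) u"
        using A_sym[OF u(1) e2(1)[OF j]] by (simp add: L2_inner_commute)
      also have "\<dots> = L2_inner \<mu> (\<lambda>x. k j * e j x) u"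
        using e2[OF j] u by (intro L2_inner_cong_AE) (auto intro: A_L2 L2_scale)
      finally show ?thesis
        using u(2)[OF j] by (simp add: L2_inner_scale_left L2_inner_commute)
    qed
    \<comment> \<open>The form vanishes at u, A u and u + A u. Expanding the third value by symmetry
      leaves twice the squared norm of A u, so u lies in the kernel.\<close>
    then have "u \<in> H" "A u \<in> H" "(\<lambda>x. u x + A u x) \<in> H"
      using u Au e2(1) by (auto simp: H_def L2_inner_add_left L2_add)
    then have "L2_inner \<mu> (A u) u = 0" "L2_inner \<mu> (A (A u)) (A u) = 0"
      "L2_inner \<mu> (A (\<lambda>x. u x + A u x)) (\<lambda>x. u x + A u x) = 0"
      using False by blast+
    then have "L2_inner \<mu> (A u) (A u) = 0"
      using u(1) Au A_sym[OF Au u(1)]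
      by (simp add: A_add L2_inner_add_left L2_inner_add_right A_L2 L2_add)
    then have "AE x in \<mu>. A u x = 0"
      using L2_inner_self_eq_0_iff[OF Au] by simp
    then have "u \<in> L2_eigenspace \<mu> A 0"
      using u(1) by (simp add: L2_eigenspace_def)
    then show ?thesis using u by blast
  qed
qed

text \<open>The matrix acts on L2 of the counting measure on \<open>{..<N}\<close>, a copy of R^N in
  which functions agreeing below N are the same vector.\<close>

definition mat_op :: "nat \<Rightarrow> (nat \<Rightarrow> nat \<Rightarrow> real) \<Rightarrow> (nat \<Rightarrow> real) \<Rightarrow> nat \<Rightarrow> real" where
  "mat_op N A u = (\<lambda>a. \<Sum>b<N. A a b * u b)"

lemma L2_count_space: "L2 (count_space {..<N}) = (UNIV :: (nat \<Rightarrow> real) set)"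
  by (auto simp: L2_def integrable_count_space)

lemma L2_inner_count_space:
  fixes N :: nat
  shows "L2_inner (count_space {..<N}) u v = (\<Sum>a<N. u a * v a)"
  by (simp add: L2_inner_def lebesgue_integral_count_space_finite)

lemma L2_norm_count_space: "L2_norm (count_space {..<N}) u = L2_set u {..<N :: nat}"
  by (simp add: L2_norm_def L2_inner_count_space L2_set_def power2_eq_square)

lemma L2_inner_mat_op:
  "L2_inner (count_space {..<N}) (mat_op N A u) v = (\<Sum>a<N. \<Sum>b<N. v a * u b * A a b)"
  by (simp add: L2_inner_count_space mat_op_def sum_distrib_left sum_distrib_right mult_ac)

text \<open>Compactness is Bolzano-Weierstrass: a subsequence of the bounded vectors converges in
  each of the N coordinates, and the matrix is continuous.\<close>

lemma compact_L2_operator_mat_op: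
  assumes sym: "\<And>a b. a < N \<Longrightarrow> b < N \<Longrightarrow> A a b = A b a"
  shows "compact_L2_operator (count_space {..<N}) (mat_op N A) (\<Sum>a<N. \<Sum>b<N. \<bar>A a b\<bar>)"
proof
  fix u v :: "nat \<Rightarrow> real" and r s :: real
  show "mat_op N A u \<in> L2 (count_space {..<N})" by (simp add: L2_count_space)
  show "mat_op N A (\<lambda>x. r * u x + s * v x) = (\<lambda>x. r * mat_op N A u x + s * mat_op N A v x)"
    by (simp add: mat_op_def sum_distrib_left sum.distrib algebra_simps)
  have "L2_inner (count_space {..<N}) u (mat_op N A v) = (\<Sum>a<N. \<Sum>b<N. u a * v b * A a b)"
    by (subst L2_inner_commute) (rule L2_inner_mat_op)
  also have "\<dots> = (\<Sum>b<N. \<Sum>a<N. u a * v b * A a b)" by (rule sum.swap)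
  also have "\<dots> = (\<Sum>b<N. \<Sum>a<N. v b * u a * A b a)"
    using sym by (intro sum.cong) auto
  finally show "L2_inner (count_space {..<N}) (mat_op N A u) v = L2_inner (count_space {..<N}) u (mat_op N A v)"
    by (simp add: L2_inner_mat_op)
  show "L2_norm (count_space {..<N}) (mat_op N A u) \<le> (\<Sum>a<N. \<Sum>b<N. \<bar>A a b\<bar>) * L2_norm (count_space {..<N}) u"
  proof -
    have "L2_set (mat_op N A u) {..<N} \<le> (\<Sum>a<N. \<bar>mat_op N A u a\<bar>)"
      by (rule L2_set_le_sum_abs)
    also have "\<dots> \<le> (\<Sum>a<N. \<Sum>b<N. \<bar>A a b\<bar> * L2_set u {..<N})"
    proof (rule sum_mono)
      fix a assume "a \<in> {..<N}"
      have "\<bar>mat_op N A u a\<bar> \<le> (\<Sum>b<N. \<bar>A a b * u b\<bar>)"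
        unfolding mat_op_def by (rule sum_abs)
      also have "\<dots> \<le> (\<Sum>b<N. \<bar>A a b\<bar> * L2_set u {..<N})"
      proof (rule sum_mono)
        fix b assume "b \<in> {..<N}"
        then have "\<bar>u b\<bar> \<le> L2_set u {..<N}"
          using member_le_L2_set[of "{..<N}" b "\<lambda>b. \<bar>u b\<bar>"] by (simp add: L2_set_def)
        then show "\<bar>A a b * u b\<bar> \<le> \<bar>A a b\<bar> * L2_set u {..<N}"
          by (simp add: abs_mult mult_left_mono)
      qed
      finally show "\<bar>mat_op N A u a\<bar> \<le> (\<Sum>b<N. \<bar>A a b\<bar> * L2_set u {..<N})" .
    qed
    finally show ?thesis by (simp add: L2_norm_count_space sum_distrib_right)
  qed
next
  fix U :: "nat \<Rightarrow> nat \<Rightarrow> real"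
  assume U: "\<And>n. L2_norm (count_space {..<N}) (U n) \<le> 1"
  have bound: "norm (U n b) \<le> 1" if "b \<in> {..<N}" for n b
  proof -
    have "\<bar>U n b\<bar> \<le> L2_set (U n) {..<N}"
      using member_le_L2_set[of "{..<N}" b "\<lambda>b. \<bar>U n b\<bar>"] that by (simp add: L2_set_def)
    then show ?thesis using U[of n] by (simp add: L2_norm_count_space)
  qed
  obtain r where r: "strict_mono (r :: nat \<Rightarrow> nat)"
    "\<And>b. b \<in> {..<N} \<Longrightarrow> \<exists>l. (\<lambda>n. U (r n) b) \<longlonglongrightarrow> l"
    by (rule function_convergent_subsequence[of "{..<N}" U 1]) (use bound in auto)
  then obtain l where l: "\<And>b. b < N \<Longrightarrow> (\<lambda>n. U (r n) b) \<longlonglongrightarrow> l b" by (metis lessThan_iff)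
  have "(\<lambda>n. L2_norm (count_space {..<N}) (\<lambda>x. mat_op N A (U (r n)) x - mat_op N A l x)) \<longlonglongrightarrow>
      L2_set (\<lambda>x. mat_op N A l x - mat_op N A l x) {..<N}"
    unfolding L2_norm_count_space L2_set_def mat_op_def using l by (intro tendsto_intros) auto
  then show "\<exists>r g. strict_mono (r :: nat \<Rightarrow> nat) \<and> g \<in> L2 (count_space {..<N}) \<and>
      (\<lambda>n. L2_norm (count_space {..<N}) (\<lambda>x. mat_op N A (U (r n)) x - g x)) \<longlonglongrightarrow> 0"
    using r(1) by (intro exI[of _ r] exI[of _ "mat_op N A l"]) (simp add: L2_count_space L2_set_def)
qed

lemma orthogonal_complement_count_space:
  fixes m N :: nat
  assumes "m < N"
  shows "\<exists>u. (\<forall>j<m. L2_inner (count_space {..<N}) u (e j) = 0) \<and>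
    L2_inner (count_space {..<N}) u u > 0"
proof -
  obtain u where u: "\<exists>a\<in>{..<N}. u a \<noteq> 0" "\<forall>j\<in>{..<m}. (\<Sum>a<N. u a * e j a) = 0"
    using exists_nontrivial_solution[of "{..<m}" "{..<N}" e] assms by auto
  from u(1) obtain a where "a < N" "u a \<noteq> 0" by auto
  then have "(\<Sum>a<N. u a * u a) > 0"
    by (intro sum_pos2[of _ a]) (auto simp: zero_less_mult_iff not_less linorder_neq_iff)
  then show ?thesis using u(2) by (auto simp: L2_inner_count_space)
qed

lemma symmetric_matrix_eigenbasis:
  fixes m N :: nat
  assumes sym: "\<And>a b. a < N \<Longrightarrow> b < N \<Longrightarrow> A a b = A b a" and "m \<le> N"
  shows "\<exists>e k. \<forall>i<m. e i \<in> L2_eigenspace (count_space {..<N}) (mat_op N A) (k i) \<and>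
    L2_inner (count_space {..<N}) (e i) (e i) > 0 \<and>
    (\<forall>j<i. L2_inner (count_space {..<N}) (e i) (e j) = 0)"
  using \<open>m \<le> N\<close>
proof (induction m)
  case 0
  then show ?case by simp
next
  case (Suc m)
  let ?\<mu> = "count_space {..<N}"
  from Suc obtain e k where ek: "\<And>i. i < m \<Longrightarrow> e i \<in> L2_eigenspace ?\<mu> (mat_op N A) (k i)"
    "\<And>i. i < m \<Longrightarrow> L2_inner ?\<mu> (e i) (e i) > 0"
    "\<And>i j. i < m \<Longrightarrow> j < i \<Longrightarrow> L2_inner ?\<mu> (e i) (e j) = 0"
    using Suc_leD by blast
  have op: "compact_L2_operator ?\<mu> (mat_op N A) (\<Sum>a<N. \<Sum>b<N. \<bar>A a b\<bar>)"
    using sym by (rule compact_L2_operator_mat_op)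
  obtain u where "\<And>j. j < m \<Longrightarrow> L2_inner ?\<mu> u (e j) = 0" "L2_inner ?\<mu> u u > 0"
    using orthogonal_complement_count_space[of m N e] Suc.prems by auto
  then obtain g l where "g \<in> L2_eigenspace ?\<mu> (mat_op N A) l" "L2_inner ?\<mu> g g > 0"
    "\<And>j. j < m \<Longrightarrow> L2_inner ?\<mu> g (e j) = 0"
    using exists_eigenvector_in_complement[OF op, where J = "{..<m}" and e = e and k = k and u = u] ek(1)
      by (auto simp: L2_count_space)
  then show ?case
    using ek by (intro exI[of _ "e(m := g)"] exI[of _ "k(m := l)"]) (auto simp: less_Suc_eq)
qed

text \<open>An orthogonal eigenbasis makes A similar to a diagonal matrix, so the characteristic
  polynomial splits and its roots, with multiplicities, are the k i.\<close>

lemma sig_mat_diagonalized: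
  assumes A: "A \<in> carrier_mat N N"
    and eig: "\<And>i a. i < N \<Longrightarrow> a < N \<Longrightarrow> (\<Sum>b<N. A $$ (a, b) * e i b) = k i * e i a"
    and pos: "\<And>i. i < N \<Longrightarrow> (\<Sum>a<N. e i a * e i a) > 0"
    and orth: "\<And>i j. i < N \<Longrightarrow> j < N \<Longrightarrow> i \<noteq> j \<Longrightarrow> (\<Sum>a<N. e i a * e j a) = 0"
  shows "sig_mat \<sigma> A = card {i \<in> {..<N}. sgn (k i) = \<sigma>}"
proof -
  define s where "s i = (\<Sum>a<N. e i a * e i a)" for i
  define P where "P = Matrix.mat N N (\<lambda>(a, i). e i a)"
  \<comment> \<open>The inverse of P: its transpose with row i divided by the squared length of
    \<open>e i\<close>, because the basis is orthogonal but not normalised.\<close>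
  define Q where "Q = Matrix.mat N N (\<lambda>(i, a). e i a / s i)"
  define D where "D = Matrix.mat N N (\<lambda>(i, j). if i = j then k i else 0)"
  have carr: "P \<in> carrier_mat N N" "Q \<in> carrier_mat N N" "D \<in> carrier_mat N N"
    by (auto simp: P_def Q_def D_def)
  have QP: "Q * P = 1\<^sub>m N"
  proof (rule eq_matI)
    fix i j assume "i < dim_row (1\<^sub>m N :: real mat)" "j < dim_col (1\<^sub>m N :: real mat)"
    then have ij: "i < N" "j < N" by auto
    then have "(Q * P) $$ (i, j) = (\<Sum>a<N. e i a * e j a) / s i"
      by (simp add: P_def Q_def scalar_prod_def sum_divide_distrib lessThan_atLeast0)
    then show "(Q * P) $$ (i, j) = 1\<^sub>m N $$ (i, j)"
      using ij orth pos[of i] by (cases "i = j") (auto simp: s_def)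
  qed (auto simp: P_def Q_def)
  have PQ: "P * Q = 1\<^sub>m N"
    using mat_mult_left_right_inverse[OF carr(2,1) QP] .
  have "A * P = P * D"
  proof (rule eq_matI)
    fix a i assume "a < dim_row (P * D)" "i < dim_col (P * D)"
    then have ai: "a < N" "i < N" by (auto simp: P_def D_def)
    then have "(A * P) $$ (a, i) = k i * e i a"
      using A eig[of i a] by (simp add: P_def scalar_prod_def lessThan_atLeast0)
    moreover have "(P * D) $$ (a, i) = (\<Sum>j<N. e j a * (if j = i then k j else 0))"
      using ai by (simp add: P_def D_def scalar_prod_def lessThan_atLeast0)
    moreover have "\<dots> = e i a * k i"
      using ai by (simp add: if_distrib cong: if_cong)
    ultimately show "(A * P) $$ (a, i) = (P * D) $$ (a, i)" by simp
  qed (use A in \<open>auto simp: P_def D_def\<close>)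
  then have "P * D * Q = A * P * Q" by simp
  also have "\<dots> = A * (P * Q)" using A carr(1,2) by (rule assoc_mult_mat)
  finally have "P * D * Q = A * (P * Q)" .
  then have "A = P * D * Q" using PQ A by simp
  then have "similar_mat_wit A D P Q"
    using A carr PQ QP by (intro similar_mat_witI[of _ _ N]) auto
  then have "char_poly A = char_poly D"
    by (intro char_poly_similar) (auto simp: similar_mat_def)
  also have "\<dots> = (\<Prod>a\<leftarrow>diag_mat D. [:- a, 1:])"
    using carr(3) by (intro char_poly_upper_triangular) (auto simp: D_def)
  also have "\<dots> = (\<Prod>i<N. [:- k i, 1:])"
    by (simp add: diag_mat_def D_def prod.distinct_set_conv_list[symmetric] lessThan_atLeast0 o_def
        cong: map_cong)
  finally have "proots (char_poly A) = (\<Sum>i<N. {# k i #})"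
    by (simp add: proots_prod proots_linear_factor)
  moreover have "size (filter_mset (\<lambda>k. sgn k = \<sigma>) (\<Sum>i<n. {# k i #})) = card {i \<in> {..<n}. sgn (k i) = \<sigma>}" for n
  proof (induction n)
    case (Suc n)
    have "{i \<in> {..<Suc n}. sgn (k i) = \<sigma>} =
        (if sgn (k n) = \<sigma> then insert n {i \<in> {..<n}. sgn (k i) = \<sigma>} else {i \<in> {..<n}. sgn (k i) = \<sigma>})"
      by (auto simp: less_Suc_eq)
    then show ?case using Suc by simp
  qed simp
  ultimately show ?thesis by (simp add: sig_mat_def)
qed

text \<open>A form of the law of inertia. If fewer than n eigenvalues had sign \<sigma>, the test
  vectors would produce a further eigenvector of this sign, orthogonal to a complete eigenbasis: one
  vector too many in R^N.\<close>

lemma le_sig_mat_iff: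
  assumes A: "A \<in> carrier_mat N N" and sym: "\<And>a b. a < N \<Longrightarrow> b < N \<Longrightarrow> A $$ (a, b) = A $$ (b, a)"
    and \<sigma>: "\<sigma> \<in> {1, -1}"
  shows "n \<le> sig_mat \<sigma> A \<longleftrightarrow>
    (\<exists>v. posdef {..<n} (\<lambda>i j. \<sigma> * (\<Sum>a<N. \<Sum>b<N. v i a * v j b * A $$ (a, b))))"
    (is "?L \<longleftrightarrow> ?R")
proof -
  let ?\<mu> = "count_space {..<N}"
  define B where "B = mat_op N (\<lambda>a b. A $$ (a, b))"
  have op: "compact_L2_operator ?\<mu> B (\<Sum>a<N. \<Sum>b<N. \<bar>A $$ (a, b)\<bar>)"
    unfolding B_def using sym by (intro compact_L2_operator_mat_op) auto
  interpret compact_L2_operator ?\<mu> B "\<Sum>a<N. \<Sum>b<N. \<bar>A $$ (a, b)\<bar>" by (rule op)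
  have form: "(\<Sum>a<N. \<Sum>b<N. u a * v b * A $$ (a, b)) = L2_inner ?\<mu> (B u) v" for u v
    using A_sym[of u v] by (simp add: B_def L2_count_space L2_inner_mat_op L2_inner_commute[of _ u])
  have "\<exists>e k. \<forall>i<N. e i \<in> L2_eigenspace ?\<mu> B (k i) \<and> L2_inner ?\<mu> (e i) (e i) > 0 \<and>
      (\<forall>j<i. L2_inner ?\<mu> (e i) (e j) = 0)"
    unfolding B_def using sym by (intro symmetric_matrix_eigenbasis) auto
  then obtain e k where ek: "\<And>i. i < N \<Longrightarrow> e i \<in> L2_eigenspace ?\<mu> B (k i)"
    "\<And>i. i < N \<Longrightarrow> L2_inner ?\<mu> (e i) (e i) > 0"
    "\<And>i j. i < N \<Longrightarrow> j < i \<Longrightarrow> L2_inner ?\<mu> (e i) (e j) = 0"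
    by blast
  have orth: "L2_inner ?\<mu> (e i) (e j) = 0" if "i < N" "j < N" "i \<noteq> j" for i j
    using ek(3)[of i j] ek(3)[of j i] that
    by (cases i j rule: linorder_cases) (auto simp: L2_inner_commute)
  have eig: "B (e i) a = k i * e i a" if "i < N" "a < N" for i a
    using ek(1)[OF that(1)] that(2) by (simp add: L2_eigenspace_def AE_count_space)
  define S where "S = {i \<in> {..<N}. sgn (k i) = \<sigma>}"
  have sig: "sig_mat \<sigma> A = card S"
    unfolding S_def using eig ek(2) orth
    by (intro sig_mat_diagonalized[OF A, where e = e]) (auto simp: B_def mat_op_def L2_inner_count_space)
  have B_inner: "L2_inner ?\<mu> (B (e i)) (e j) = k i * L2_inner ?\<mu> (e i) (e j)" if "i < N" for i j
    using eig[OF that] by (simp add: L2_inner_count_space sum_distrib_left mult.assoc)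
  show ?thesis
  proof
    assume ?L
    then obtain f where f: "f ` {..<n} \<subseteq> S" "inj_on f {..<n}"
      using card_le_inj[of "{..<n}" S] sig by (auto simp: S_def)
    have "posdef {..<n} (\<lambda>i j. \<sigma> * L2_inner ?\<mu> (B (e (f i))) (e (f j)))"
      unfolding posdef_def
    proof (intro allI impI)
      fix c :: "nat \<Rightarrow> real" assume "\<exists>i\<in>{..<n}. c i \<noteq> 0"
      then obtain p where p: "p < n" "c p \<noteq> 0" by auto
      have fN: "f i < N" "\<sigma> * k (f i) > 0" if "i < n" for i
      proof -
        have "f i \<in> S" using f(1) that by auto
        then show "f i < N" "\<sigma> * k (f i) > 0"
          using \<sigma> by (auto simp: S_def sgn_if split: if_splits)
      qed
      define d where "d i = \<sigma> * k (f i) * L2_inner ?\<mu> (e (f i)) (e (f i))" for i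
      have d: "d i > 0" if "i < n" for i
        using fN[OF that] ek(2) by (simp add: d_def)
      have "(\<Sum>i<n. \<Sum>j<n. c i * c j * (\<sigma> * L2_inner ?\<mu> (B (e (f i))) (e (f j)))) =
          (\<Sum>i<n. \<Sum>j<n. if j = i then (c i)\<^sup>2 * d i else 0)"
      proof (intro sum.cong refl)
        fix i j assume "i \<in> {..<n}" "j \<in> {..<n}"
        then show "c i * c j * (\<sigma> * L2_inner ?\<mu> (B (e (f i))) (e (f j))) =
            (if j = i then (c i)\<^sup>2 * d i else 0)"
          using fN orth[of "f i" "f j"] inj_onD[OF f(2), of i j]
          by (auto simp: B_inner d_def power2_eq_square)
      qed
      also have "\<dots> = (\<Sum>i<n. (c i)\<^sup>2 * d i)" by simp
      also have "\<dots> > 0"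
        using p d by (intro sum_pos2[of _ p]) (auto simp: less_imp_le)
      finally show "0 < (\<Sum>i<n. \<Sum>j<n. c i * c j * (\<sigma> * L2_inner ?\<mu> (B (e (f i))) (e (f j))))" .
    qed
    then show ?R unfolding form by (intro exI[of _ "\<lambda>i. e (f i)"])
  next
    assume ?R
    then obtain v where pd: "posdef {..<n} (\<lambda>i j. \<sigma> * L2_inner ?\<mu> (B (v i)) (v j))"
      unfolding form by blast
    show ?L
    proof (rule ccontr)
      assume "\<not> ?L"
      then have "card S < card {..<n}" using sig by simp
      then obtain c where c: "\<exists>i\<in>{..<n}. c i \<noteq> 0"
        "\<And>j. j \<in> S \<Longrightarrow> (\<Sum>i<n. c i * L2_inner ?\<mu> (v i) (e j)) = 0"
        using exists_nontrivial_solution[of S "{..<n}" "\<lambda>j i. L2_inner ?\<mu> (v i) (e j)"]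
        by (auto simp: S_def)
      define z where "z = (\<lambda>x. \<Sum>i<n. c i * v i x)"
      have "L2_inner ?\<mu> z (e j) = 0" if "j \<in> S" for j
        unfolding z_def using c(2)[OF that] by (subst L2_inner_sum_left) (auto simp: L2_count_space)
      moreover have "\<sigma> * L2_inner ?\<mu> (B z) z > 0"
      proof -
        have "\<sigma> * L2_inner ?\<mu> (B z) z =
            (\<Sum>i<n. \<Sum>j<n. c i * c j * (\<sigma> * L2_inner ?\<mu> (B (v i)) (v j)))"
          unfolding z_def by (intro scaled_inner_A_sum) (simp add: L2_count_space)
        then show ?thesis using pd c(1) unfolding posdef_def by simp
      qed
      ultimately obtain g l where g: "g \<in> L2_eigenspace ?\<mu> B l" "sgn l = \<sigma>" "L2_inner ?\<mu> g g > 0"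
        "\<And>j. j \<in> S \<Longrightarrow> L2_inner ?\<mu> g (e j) = 0"
        using eigenvector_in_complement[OF op \<sigma>, of S e k z] ek(1) by (auto simp: L2_count_space S_def)
      \<comment> \<open>For j outside \<open>S\<close> the eigenvalues of g and \<open>e j\<close>
        have different signs, so they differ and the vectors are orthogonal.\<close>
      have g_orth: "L2_inner ?\<mu> g (e j) = 0" if "j < N" for j
      proof (cases "j \<in> S")
        case False
        then show ?thesis
          using that g(2) by (intro eigenvectors_orthogonal[OF op g(1) ek(1)]) (auto simp: S_def)
      qed (use g in auto)
      \<comment> \<open>Position N receives g. These N + 1 vectors have only N coordinates and must
        be dependent, which contradicts their orthogonality.\<close>
      define h where "h = e(N := g)"
      obtain c where c: "\<exists>i\<in>{..N}. c i \<noteq> 0" "\<forall>a\<in>{..<N}. (\<Sum>i\<le>N. c i * h i a) = 0"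
        using exists_nontrivial_solution[of "{..<N}" "{..N}" "\<lambda>a i. h i a"] by auto
      have "c i = 0" if i: "i \<le> N" for i
      proof -
        have "0 = L2_inner ?\<mu> (\<lambda>a. \<Sum>i\<le>N. c i * h i a) (h i)"
          using c(2) by (simp add: L2_inner_count_space)
        also have "\<dots> = (\<Sum>j\<le>N. c j * L2_inner ?\<mu> (h j) (h i))"
          by (rule L2_inner_sum_left) (auto simp: L2_count_space)
        also have "\<dots> = (\<Sum>j\<le>N. if j = i then c i * L2_inner ?\<mu> (h i) (h i) else 0)"
        proof (intro sum.cong refl)
          fix j assume "j \<in> {..N}"
          then show "c j * L2_inner ?\<mu> (h j) (h i) = (if j = i then c i * L2_inner ?\<mu> (h i) (h i) else 0)"
            using i orth[of j i] g_orth[of i] g_orth[of j] L2_inner_commute[of ?\<mu> "e j" g]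
            by (cases "j = N"; cases "i = N") (auto simp: h_def)
        qed
        also have "\<dots> = c i * L2_inner ?\<mu> (h i) (h i)" using i by simp
        finally show ?thesis using i ek(2)[of i] g(3) by (auto simp: h_def split: if_splits)
      qed
      then show False using c(1) by auto
    qed
  qed
qed

section \<open>Finite metric configurations\<close>

definition sq_kernel :: "'a::metric_space \<Rightarrow> 'a \<Rightarrow> real" where
  "sq_kernel x y = - (1/2) * (dist x y)\<^sup>2"

lemma sq_kernel_commute: "sq_kernel x y = sq_kernel y x"
  by (simp add: sq_kernel_def dist_commute)

lemma tendsto_sq_kernel:
  "(f \<longlongrightarrow> x) F \<Longrightarrow> (g \<longlongrightarrow> y) F \<Longrightarrow> ((\<lambda>k. sq_kernel (f k) (g k)) \<longlongrightarrow> sq_kernel x y) F"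
  unfolding sq_kernel_def by (intro tendsto_intros)

text \<open>
  With \<open>Z\<close>, only the coefficient vectors of total mass 0 are admitted; this variant plays the
  role for \<open>T_op\<close> that the unrestricted one plays for \<open>K_op\<close>.
\<close>

definition form_index_ge :: "real \<Rightarrow> bool \<Rightarrow> nat \<Rightarrow> 'a::metric_space list \<Rightarrow> bool" where
  "form_index_ge \<sigma> Z n xs \<longleftrightarrow>
     (\<exists>v. (Z \<longrightarrow> (\<forall>i<n. (\<Sum>a<length xs. v i a) = 0)) \<and>
       posdef {..<n} (\<lambda>i j. \<sigma> * (\<Sum>a<length xs. \<Sum>b<length xs.
         v i a * v j b * sq_kernel (xs ! a) (xs ! b))))"

lemma le_sig_mat_S_seq_iff:
  assumes "\<sigma> \<in> {1, -1}"
  shows "n \<le> sig_mat \<sigma> (S_seq xs) \<longleftrightarrow> form_index_ge \<sigma> False n xs"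
proof -
  have "n \<le> sig_mat \<sigma> (S_seq xs) \<longleftrightarrow> (\<exists>v. posdef {..<n} (\<lambda>i j. \<sigma> *
      (\<Sum>a<length xs. \<Sum>b<length xs. v i a * v j b * S_seq xs $$ (a, b))))"
    using assms by (intro le_sig_mat_iff) (auto simp: S_seq_def dist_commute)
  moreover have "(\<Sum>a<length xs. \<Sum>b<length xs. v i a * v j b * S_seq xs $$ (a, b)) =
      (\<Sum>a<length xs. \<Sum>b<length xs. v i a * v j b * sq_kernel (xs ! a) (xs ! b))"
    for v :: "nat \<Rightarrow> nat \<Rightarrow> real" and i j
    by (intro sum.cong) (auto simp: S_seq_def sq_kernel_def)
  ultimately show ?thesis by (simp add: form_index_ge_def)
qed

text \<open>The weights are pushed forward along a map of positions that keeps the points. Masses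
  and form are unchanged, and positions carrying equal points may be merged, so only the set of
  points of a list matters.\<close>

lemma form_index_ge_mono:
  assumes xs: "form_index_ge \<sigma> Z n xs" and sub: "set xs \<subseteq> set ys"
  shows "form_index_ge \<sigma> Z n ys"
proof -
  obtain v where v: "Z \<longrightarrow> (\<forall>i<n. (\<Sum>a<length xs. v i a) = 0)"
    and pd: "posdef {..<n} (\<lambda>i j. \<sigma> * (\<Sum>a<length xs. \<Sum>b<length xs.
         v i a * v j b * sq_kernel (xs ! a) (xs ! b)))"
    using xs unfolding form_index_ge_def by blast
  have "\<exists>b<length ys. ys ! b = xs ! a" if "a < length xs" for a
    using sub that by (metis in_set_conv_nth nth_mem subsetD)
  then obtain f where f: "\<And>a. a < length xs \<Longrightarrow> f a < length ys" "\<And>a. a < length xs \<Longrightarrow> ys ! f a = xs ! a"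
    by metis
  define w where "w i b = (\<Sum>a\<in>{a \<in> {..<length xs}. f a = b}. v i a)" for i b
  have w: "(\<Sum>b<length ys. w i b * h b) = (\<Sum>a<length xs. v i a * h (f a))" for i h
  proof -
    have "(\<Sum>b<length ys. w i b * h b) = (\<Sum>b<length ys. \<Sum>a\<in>{a \<in> {..<length xs}. f a = b}. v i a * h (f a))"
      by (simp add: w_def sum_distrib_right)
    also have "\<dots> = (\<Sum>a<length xs. v i a * h (f a))"
      using f(1) by (intro sum.group) auto
    finally show ?thesis .
  qed
  have "(\<Sum>a<length ys. \<Sum>b<length ys. w i a * w j b * sq_kernel (ys ! a) (ys ! b)) =
      (\<Sum>a<length xs. \<Sum>b<length xs. v i a * v j b * sq_kernel (xs ! a) (xs ! b))" for i j
  proof -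
    have "(\<Sum>a<length ys. \<Sum>b<length ys. w i a * w j b * sq_kernel (ys ! a) (ys ! b)) =
        (\<Sum>a<length ys. w i a * (\<Sum>b<length ys. w j b * sq_kernel (ys ! a) (ys ! b)))"
      by (simp add: sum_distrib_left mult.assoc)
    also have "\<dots> = (\<Sum>a<length xs. v i a * (\<Sum>b<length xs. v j b * sq_kernel (ys ! f a) (ys ! f b)))"
      by (simp add: w)
    also have "\<dots> = (\<Sum>a<length xs. \<Sum>b<length xs. v i a * v j b * sq_kernel (xs ! a) (xs ! b))"
      using f(2) by (simp add: sum_distrib_left mult.assoc)
    finally show ?thesis .
  qed
  moreover have "(\<Sum>b<length ys. w i b) = (\<Sum>a<length xs. v i a)" for i
    using w[of i "\<lambda>_. 1"] by simp
  ultimately show ?thesis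
    unfolding form_index_ge_def using v pd by (intro exI[of _ w]) simp
qed

text \<open>The points move to nearby points of D while the weights stay. Hence total mass 0 is kept
  exactly, and continuity of the kernel controls the Gram matrix.\<close>

lemma form_index_ge_dense:
  fixes D :: "'a::metric_space set" and xs :: "'a list"
  assumes xs: "form_index_ge \<sigma> Z n xs" and D: "closure D = UNIV"
  shows "\<exists>ys. set ys \<subseteq> D \<and> form_index_ge \<sigma> Z n ys"
proof -
  define m where "m = length xs"
  obtain v where v: "Z \<longrightarrow> (\<forall>i<n. (\<Sum>a<m. v i a) = 0)"
    and pd: "posdef {..<n} (\<lambda>i j. \<sigma> * (\<Sum>a<m. \<Sum>b<m. v i a * v j b * sq_kernel (xs ! a) (xs ! b)))"
    using xs unfolding form_index_ge_def m_def by blast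
  have "\<exists>s. (\<forall>k. s k \<in> D) \<and> s \<longlonglongrightarrow> xs ! a" for a
    using D closure_sequential[of "xs ! a" D] by auto
  then obtain s where s: "\<And>a k. s a k \<in> D" "\<And>a. s a \<longlonglongrightarrow> xs ! a" by metis
  have "\<forall>\<^sub>F k in sequentially. posdef {..<n} (\<lambda>i j. \<sigma> * (\<Sum>a<m. \<Sum>b<m. v i a * v j b * sq_kernel (s a k) (s b k)))"
    by (rule eventually_posdef[OF _ pd]) (intro tendsto_intros tendsto_sq_kernel s finite_lessThan)+
  then obtain k where "posdef {..<n} (\<lambda>i j. \<sigma> * (\<Sum>a<m. \<Sum>b<m. v i a * v j b * sq_kernel (s a k) (s b k)))"
    by (meson eventually_happens trivial_limit_sequentially)
  moreover have "(\<Sum>a<m. \<Sum>b<m. v i a * v j b * sq_kernel (map (\<lambda>a. s a k) [0..<m] ! a) (map (\<lambda>a. s a k) [0..<m] ! b)) =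
      (\<Sum>a<m. \<Sum>b<m. v i a * v j b * sq_kernel (s a k) (s b k))" for i j
    by (intro sum.cong) auto
  ultimately have "form_index_ge \<sigma> Z n (map (\<lambda>a. s a k) [0..<m])"
    unfolding form_index_ge_def using v by (intro exI[of _ v]) simp
  then show ?thesis using s(1) by (intro exI[of _ "map (\<lambda>a. s a k) [0..<m]"]) auto
qed

text \<open>A list and its duplicate-free version have the same set of points, so monotonicity
  applies in both directions.\<close>

lemma sig_mat_S_set_eq_S_seq:
  assumes "\<sigma> \<in> {1, -1}"
  shows "sig_mat \<sigma> (S_set (set xs)) = sig_mat \<sigma> (S_seq xs)"
proof -
  have "sig_mat \<sigma> (S_set (set xs)) = sig_mat \<sigma> (S_seq (remdups xs))"
    using sig_mat_S_set[of "remdups xs" \<sigma>] by simp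
  moreover
  have "n \<le> sig_mat \<sigma> (S_seq (remdups xs)) \<longleftrightarrow> n \<le> sig_mat \<sigma> (S_seq xs)" for n
    unfolding le_sig_mat_S_seq_iff[OF assms]
    using form_index_ge_mono[of \<sigma> False n xs "remdups xs"] form_index_ge_mono[of \<sigma> False n "remdups xs" xs]
    by auto
  from this[of "sig_mat \<sigma> (S_seq xs)"] this[of "sig_mat \<sigma> (S_seq (remdups xs))"]
  have "sig_mat \<sigma> (S_seq (remdups xs)) = sig_mat \<sigma> (S_seq xs)" by simp
  ultimately show ?thesis by simp
qed

lemma sig_mat_S_set_mono:
  assumes "\<sigma> \<in> {1, -1}" "F \<subseteq> G" "finite G"
  shows "sig_mat \<sigma> (S_set F) \<le> sig_mat \<sigma> (S_set G)"
proof -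
  obtain xs ys where xy: "set xs = F" "set ys = G"
    using assms(2,3) finite_list finite_subset by metis
  have "form_index_ge \<sigma> False (sig_mat \<sigma> (S_seq xs)) xs"
    using le_sig_mat_S_seq_iff[OF assms(1)] by blast
  from form_index_ge_mono[OF this, of ys] have "form_index_ge \<sigma> False (sig_mat \<sigma> (S_seq xs)) ys"
    using xy assms(2) by simp
  then show ?thesis
    unfolding xy[symmetric] sig_mat_S_set_eq_S_seq[OF assms(1)] le_sig_mat_S_seq_iff[OF assms(1)] .
qed

lemma enat_le_limit_sig_iff:
  fixes X :: "'a::metric_space set"
  assumes "\<sigma> \<in> {1, -1}"
  shows "enat n \<le> limit_sig \<sigma> X \<longleftrightarrow> (\<exists>xs. set xs \<subseteq> X \<and> form_index_ge \<sigma> False n xs)"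
proof -
  have ex_list: "(\<exists>F. finite F \<and> Q F) \<longleftrightarrow> (\<exists>xs. Q (set xs))" for Q :: "'a set \<Rightarrow> bool"
    by (metis finite_list List.finite_set)
  have "{F. finite F \<and> F \<subseteq> X} \<noteq> {}" by auto
  then have "enat n \<le> limit_sig \<sigma> X \<longleftrightarrow> (\<exists>F. finite F \<and> F \<subseteq> X \<and> n \<le> sig_mat \<sigma> (S_set F))"
    unfolding limit_sig_def by (subst enat_le_SUP_iff) auto
  also have "\<dots> \<longleftrightarrow> (\<exists>xs. set xs \<subseteq> X \<and> n \<le> sig_mat \<sigma> (S_set (set xs)))"
    using ex_list[of "\<lambda>F. F \<subseteq> X \<and> n \<le> sig_mat \<sigma> (S_set F)"] by simp
  finally show ?thesis
    by (simp only: sig_mat_S_set_eq_S_seq[OF assms] le_sig_mat_S_seq_iff[OF assms])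
qed

lemma limit_sig_dense:
  fixes D :: "'a::metric_space set"
  assumes "\<sigma> \<in> {1, -1}" "closure D = UNIV"
  shows "limit_sig \<sigma> D = limit_sig \<sigma> (UNIV :: 'a set)"
proof (rule enat_eqI)
  fix n
  show "enat n \<le> limit_sig \<sigma> D \<longleftrightarrow> enat n \<le> limit_sig \<sigma> (UNIV :: 'a set)"
    unfolding enat_le_limit_sig_iff[OF assms(1)]
    using form_index_ge_dense[OF _ assms(2), of \<sigma> False n] by blast
qed

lemma limit_sig_finite:
  assumes "\<sigma> \<in> {1, -1}" "finite X"
  shows "limit_sig \<sigma> X = enat (sig_mat \<sigma> (S_set X))"
  unfolding limit_sig_def using assms
  by (intro antisym SUP_least SUP_upper) (auto intro: sig_mat_S_set_mono)

text \<open>A finite subset of an increasing union lies in one member of the chain. The union is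
  arbitrary, since the statement also serves the random set of sampled points.\<close>

lemma limit_sig_exhaustion:
  fixes F :: "nat \<Rightarrow> 'a::metric_space set"
  assumes \<sigma>: "\<sigma> \<in> {1, -1}" and F: "\<And>N. finite (F N)" "\<And>N. F N \<subseteq> F (Suc N)"
  shows "(\<lambda>N. enat (sig_mat \<sigma> (S_set (F N)))) \<longlonglongrightarrow> limit_sig \<sigma> (\<Union>N. F N)"
    and "limit_sig \<sigma> (\<Union>N. F N) = (SUP N. enat (sig_mat \<sigma> (S_set (F N))))"
proof -
  have mono: "incseq (\<lambda>N. enat (sig_mat \<sigma> (S_set (F N))))"
    using F by (intro incseq_SucI) (simp add: sig_mat_S_set_mono[OF \<sigma>])
  show eq: "limit_sig \<sigma> (\<Union>N. F N) = (SUP N. enat (sig_mat \<sigma> (S_set (F N))))"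
  proof (rule antisym)
    have "enat (sig_mat \<sigma> (S_set G)) \<le> (SUP N. enat (sig_mat \<sigma> (S_set (F N))))"
      if G: "finite G" "G \<subseteq> (\<Union>N. F N)" for G
    proof -
      have "\<exists>N. G \<subseteq> F N"
        using G
      proof (induction G rule: finite_induct)
        case (insert x G)
        then obtain N M where "G \<subseteq> F N" "x \<in> F M" by auto
        then have "insert x G \<subseteq> F (max N M)"
          using lift_Suc_mono_le[of F N "max N M"] lift_Suc_mono_le[of F M "max N M"] F(2) by auto
        then show ?case by blast
      qed simp
      then obtain N where "G \<subseteq> F N" by blast
      then show ?thesis
        using F(1) by (intro SUP_upper2[of N]) (auto intro: sig_mat_S_set_mono[OF \<sigma>])
    qed
    then show "limit_sig \<sigma> (\<Union>N. F N) \<le> (SUP N. enat (sig_mat \<sigma> (S_set (F N))))"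
      unfolding limit_sig_def by (intro SUP_least) auto
    show "(SUP N. enat (sig_mat \<sigma> (S_set (F N)))) \<le> limit_sig \<sigma> (\<Union>N. F N)"
      unfolding limit_sig_def using F(1) by (intro SUP_least SUP_upper) auto
  qed
  show "(\<lambda>N. enat (sig_mat \<sigma> (S_set (F N)))) \<longlonglongrightarrow> limit_sig \<sigma> (\<Union>N. F N)"
    unfolding eq by (rule LIMSEQ_SUP[OF mono])
qed

section \<open>Dense sequences and i.i.d. samples\<close>

lemma separable_dense_sequence:
  assumes "separable_space (euclidean :: 'a::metric_space topology)"
  obtains x :: "nat \<Rightarrow> 'a::metric_space" where "closure (range x) = UNIV"
proof -
  obtain C :: "'a set" where C: "countable C" "closure C = UNIV"
    using assms by (auto simp: separable_space_def)
  then have "C \<noteq> {}" by auto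
  then show ?thesis using C that[of "from_nat_into C"] by (simp add: range_from_nat_into)
qed

text \<open>With p the mass of U, the first N + 1 draws all miss U with probability (1 - p)^(N + 1),
  which tends to 0.\<close>

lemma AE_iid_visits:
  assumes "prob_space P" and indep: "prob_space.indep_vars P (\<lambda>_. borel) \<xi> (UNIV :: nat set)"
    and distr: "\<And>i. distr P borel (\<xi> i) = \<mu>" and U: "open U" "emeasure \<mu> U > 0"
  shows "AE \<omega> in P. \<exists>i. \<xi> i \<omega> \<in> U"
proof -
  interpret prob_space P by fact
  have meas: "\<xi> i \<in> borel_measurable P" for i
    using indep unfolding indep_vars_def by auto
  define A where "A i = \<xi> i -` (- U) \<inter> space P" for i
  have A_ev: "A i \<in> events" for i
    unfolding A_def using U(1) by (intro measurable_sets[OF meas]) auto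
  define p where "p = measure \<mu> U"
  have p: "0 < p"
  proof -
    have "emeasure \<mu> U = emeasure P (\<xi> 0 -` U \<inter> space P)"
      using U(1) meas by (subst distr[of 0, symmetric], subst emeasure_distr) auto
    also have "\<dots> < \<top>" by (simp add: less_top[symmetric])
    finally show ?thesis
      using U(2) by (simp add: p_def measure_def enn2real_positive_iff)
  qed
  have pA: "prob (A i) = 1 - p" for i
  proof -
    have "prob (\<xi> i -` U \<inter> space P) = p"
      using U(1) meas by (simp add: p_def distr[of i, symmetric] measure_distr)
    moreover have "A i = space P - (\<xi> i -` U \<inter> space P)" by (auto simp: A_def)
    moreover have "\<xi> i -` U \<inter> space P \<in> events"
      using U(1) by (intro measurable_sets[OF meas]) auto
    ultimately show ?thesis by (simp add: prob_compl)
  qed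
  define B where "B = (\<Inter>i. A i)"
  have B_ev: "B \<in> events" unfolding B_def using A_ev by auto
  have "prob B \<le> (1 - p) ^ Suc N" for N
  proof -
    have "prob B \<le> prob (\<Inter>i\<in>{..N}. A i)"
      using A_ev by (intro finite_measure_mono) (auto simp: B_def)
    also have "\<dots> = (\<Prod>i\<in>{..N}. prob (A i))"
      unfolding A_def using U(1) by (intro indep_varsD[OF indep]) auto
    finally show ?thesis by (simp add: pA)
  qed
  moreover have "(\<lambda>N. (1 - p) ^ Suc N) \<longlonglongrightarrow> 0"
    using p pA[of 0] measure_nonneg[of P "A 0"] by (intro LIMSEQ_Suc LIMSEQ_realpow_zero) auto
  ultimately have "prob B \<le> 0"
    by (intro LIMSEQ_le_const) auto
  then have "prob B = 0"
    using measure_nonneg[of P B] by linarith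
  then have "B \<in> null_sets P" using B_ev by (simp add: null_sets_def emeasure_eq_measure)
  then have "AE \<omega> in P. \<omega> \<notin> B" by (rule AE_not_in)
  then show ?thesis using AE_space by eventually_elim (auto simp: B_def A_def)
qed

text \<open>It suffices to visit the countably many balls of radius 1 / (n + 1) around a dense
  sequence; full support gives each of them positive mass.\<close>

lemma AE_iid_dense:
  fixes \<mu> :: "'a::metric_space measure"
  assumes sep: "separable_space (euclidean :: 'a topology)"
    and P: "prob_space P" and indep: "prob_space.indep_vars P (\<lambda>_. borel) \<xi> (UNIV :: nat set)"
    and distr: "\<And>i. distr P borel (\<xi> i) = \<mu>" and supp: "msupport \<mu> = UNIV"
  shows "AE \<omega> in P. closure (range (\<lambda>i. \<xi> i \<omega>)) = UNIV"
proof -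
  obtain x :: "nat \<Rightarrow> 'a" where x: "closure (range x) = UNIV"
    using separable_dense_sequence[OF sep] .
  have "AE \<omega> in P. \<exists>i. \<xi> i \<omega> \<in> ball (x a) (1 / real (Suc n))" for a n
  proof (rule AE_iid_visits[OF P indep distr])
    have "x a \<in> msupport \<mu>" using supp by simp
    then show "emeasure \<mu> (ball (x a) (1 / real (Suc n))) > 0"
      unfolding msupport_def by auto
  qed simp
  then have "AE \<omega> in P. \<forall>a n. \<exists>i. \<xi> i \<omega> \<in> ball (x a) (1 / real (Suc n))"
    by (simp add: AE_all_countable)
  then show ?thesis
  proof eventually_elim
    fix \<omega> assume *: "\<forall>a n. \<exists>i. \<xi> i \<omega> \<in> ball (x a) (1 / real (Suc n))"
    have "\<exists>y\<in>range (\<lambda>i. \<xi> i \<omega>). dist y (x a) < e" if e: "e > 0" for a e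
    proof -
      obtain n where n: "1 / real (Suc n) < e" using nat_approx_posE[OF e] .
      obtain i where "\<xi> i \<omega> \<in> ball (x a) (1 / real (Suc n))" using * by blast
      then show ?thesis using n by (intro bexI[of _ "\<xi> i \<omega>"]) (auto simp: dist_commute)
    qed
    then have "range x \<subseteq> closure (range (\<lambda>i. \<xi> i \<omega>))"
      by (auto simp: closure_approachable)
    then show "closure (range (\<lambda>i. \<xi> i \<omega>)) = UNIV"
      using x closure_minimal[OF _ closed_closure] by blast
  qed
qed

section \<open>The operator K\<close>

text \<open>The smallest index among 0, ..., N whose point has minimal distance to z, since an index
  is replaced only by a strictly closer one. Finitely many values turn integrals into finite sums
  over cells.\<close>

primrec nearest :: "(nat \<Rightarrow> 'a::metric_space) \<Rightarrow> nat \<Rightarrow> 'a \<Rightarrow> nat" where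
  "nearest x 0 z = 0"
| "nearest x (Suc N) z =
    (if dist (x (Suc N)) z < dist (x (nearest x N z)) z then Suc N else nearest x N z)"

lemma nearest_le: "nearest x N z \<le> N"
  by (induction N) auto

lemma dist_nearest_le: "a \<le> N \<Longrightarrow> dist (x (nearest x N z)) z \<le> dist (x a) z"
  by (induction N) (auto simp: le_Suc_eq not_less intro: order.trans less_imp_le)

lemma tendsto_nearest:
  assumes "closure (range x) = UNIV"
  shows "(\<lambda>N. x (nearest x N z)) \<longlonglongrightarrow> z"
proof (rule tendstoI)
  fix e :: real assume "e > 0"
  then obtain a where a: "dist (x a) z < e"
    using assms closure_approachable[of z "range x"] by auto
  have "dist (x (nearest x N z)) z < e" if "N \<ge> a" for N
    using dist_nearest_le[OF that, of x z] a by simp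
  then show "\<forall>\<^sub>F N in sequentially. dist (x (nearest x N z)) z < e"
    by (auto simp: eventually_sequentially)
qed

lemma measurable_nearest: "nearest x N \<in> borel \<rightarrow>\<^sub>M count_space UNIV"
proof (induction N)
  case (Suc N)
  have *: "(\<lambda>z. dist (x a) z) \<in> borel_measurable borel" for a
    by (intro borel_measurable_continuous_onI continuous_intros)
  have "(\<lambda>z. dist (x (nearest x N z)) z) \<in> borel_measurable borel"
    by (rule measurable_compose_countable[OF * Suc])
  then have "Measurable.pred borel (\<lambda>z. dist (x (Suc N)) z < dist (x (nearest x N z)) z)"
    using * by measurable
  then show ?case using Suc by (simp add: measurable_If)
qed simp

text \<open>If f is not integrable, its integral is 0 by convention, and g is nonnegative.\<close>

lemma abs_integral_le_integral:
  fixes f g :: "'b \<Rightarrow> real"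
  assumes g: "integrable M g" and le: "\<And>x. \<bar>f x\<bar> \<le> g x"
  shows "\<bar>LINT x|M. f x\<bar> \<le> (LINT x|M. g x)"
proof (cases "integrable M f")
  case True
  then have "(LINT x|M. \<bar>f x\<bar>) \<le> (LINT x|M. g x)"
    using g le by (intro integral_mono) auto
  then show ?thesis using integral_abs_bound[of M f] by linarith
next
  case False
  have "0 \<le> g x" for x using le[of x] by linarith
  then show ?thesis using False by (simp add: not_integrable_integral_eq)
qed

lemma L2_bounded:
  assumes u: "u \<in> borel_measurable \<mu>" and v: "v \<in> L2 \<mu>" and le: "\<And>x. \<bar>u x\<bar> \<le> v x"
  shows "u \<in> L2 \<mu>" and "L2_norm \<mu> u \<le> L2_norm \<mu> v"
proof -
  have sq: "(u x)\<^sup>2 \<le> (v x)\<^sup>2" for x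
    using le[of x] by (metis abs_ge_zero power2_abs power_mono)
  have v2: "integrable \<mu> (\<lambda>x. (v x)\<^sup>2)" using v by (simp add: L2_def)
  have u2: "integrable \<mu> (\<lambda>x. (u x)\<^sup>2)"
    by (rule Bochner_Integration.integrable_bound[OF v2]) (use u sq in auto)
  show "u \<in> L2 \<mu>" using u u2 by (simp add: L2_def)
  show "L2_norm \<mu> u \<le> L2_norm \<mu> v"
    unfolding L2_norm_def L2_inner_def
    using integral_mono[OF u2 v2 sq] by (simp add: power2_eq_square)
qed

text \<open>The dense sequence is a parameter because the discretisation depends on it. Its first
  point is the base point of the moment, so that the moment condition puts the squared distance to
  \<open>x 0\<close> into L2.\<close>

locale fourth_moment_measure = prob_space \<mu> for \<mu> :: "'a::metric_space measure" +
  fixes x :: "nat \<Rightarrow> 'a"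
  assumes sets_borel: "sets \<mu> = sets borel"
    and dense: "closure (range x) = UNIV"
    and moment: "integrable \<mu> (\<lambda>y. dist (x 0) y ^ 4)"
begin

definition \<rho> :: "'a \<Rightarrow> real" where "\<rho> y = dist (x 0) y"

lemma measurable_continuous: "continuous_on UNIV f \<Longrightarrow> f \<in> borel_measurable \<mu>"
  for f :: "'a \<Rightarrow> real"
  unfolding measurable_cong_sets[OF sets_borel refl] by (rule borel_measurable_continuous_onI)

lemma \<rho>_nonneg: "0 \<le> \<rho> y"
  by (simp add: \<rho>_def)

lemma continuous_on_\<rho>: "continuous_on S \<rho>"
  unfolding \<rho>_def by (intro continuous_intros)

lemma L2_one: "(\<lambda>_. 1) \<in> L2 \<mu>"
  by (simp add: L2_def)

lemma L2_norm_one: "L2_norm \<mu> (\<lambda>_. 1) = 1"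
  by (simp add: L2_norm_def L2_inner_def prob_space)

lemma L2_integrable: "u \<in> L2 \<mu> \<Longrightarrow> integrable \<mu> u"
  using L2_integrable_mult[OF _ L2_one] by simp

lemma L2_abs: "u \<in> L2 \<mu> \<Longrightarrow> (\<lambda>y. \<bar>u y\<bar>) \<in> L2 \<mu>"
  by (auto simp: L2_def intro: borel_measurable_abs)

lemma L2_norm_abs: "L2_norm \<mu> (\<lambda>y. \<bar>u y\<bar>) = L2_norm \<mu> u"
  by (simp add: L2_norm_def L2_inner_def)

lemma \<rho>_sq_L2: "(\<lambda>y. (\<rho> y)\<^sup>2) \<in> L2 \<mu>"
  using moment
  by (simp add: L2_def \<rho>_def measurable_continuous continuous_intros flip: power_mult)

lemma \<rho>_L2: "\<rho> \<in> L2 \<mu>"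
  using L2_integrable[OF \<rho>_sq_L2] measurable_continuous[OF continuous_on_\<rho>] by (simp add: L2_def)

lemma abs_sq_kernel_le: "\<bar>sq_kernel z y\<bar> \<le> (\<rho> z)\<^sup>2 + (\<rho> y)\<^sup>2"
proof -
  have "(dist z y)\<^sup>2 \<le> (\<rho> z + \<rho> y)\<^sup>2"
    using dist_triangle[of z y "x 0"] by (intro power_mono) (auto simp: \<rho>_def dist_commute)
  also have "\<dots> \<le> 2 * ((\<rho> z)\<^sup>2 + (\<rho> y)\<^sup>2)"
    using sum_squares_bound[of "\<rho> z" "\<rho> y"] by (simp add: power2_sum)
  finally show ?thesis by (simp add: sq_kernel_def)
qed

lemma measurable_sq_kernel: "(\<lambda>y. sq_kernel z y) \<in> borel_measurable \<mu>"
  unfolding sq_kernel_def by (intro measurable_continuous continuous_intros)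

lemma sq_kernel_L2: "(\<lambda>y. sq_kernel z y) \<in> L2 \<mu>"
proof (rule L2_bounded(1)[OF measurable_sq_kernel])
  show "(\<lambda>y. (\<rho> z)\<^sup>2 * 1 + 1 * (\<rho> y)\<^sup>2) \<in> L2 \<mu>"
    by (intro L2_lin L2_one \<rho>_sq_L2)
qed (use abs_sq_kernel_le in auto)

lemma K_op_eq: "K_op \<mu> u z = (LINT y|\<mu>. sq_kernel z y * u y)"
  by (simp add: K_op_def sq_kernel_def flip: integral_mult_right_zero)

lemma K_op_lin:
  assumes "u \<in> L2 \<mu>" "v \<in> L2 \<mu>"
  shows "K_op \<mu> (\<lambda>y. a * u y + b * v y) = (\<lambda>z. a * K_op \<mu> u z + b * K_op \<mu> v z)"
  using L2_inner_lin_right[OF assms sq_kernel_L2] by (intro ext) (simp add: K_op_eq L2_inner_def)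

text \<open>The signed measure with density u is pushed forward by the nearest-point map; this is
  the weight it puts on index a.\<close>

definition cell_integral :: "nat \<Rightarrow> ('a \<Rightarrow> real) \<Rightarrow> nat \<Rightarrow> real" where
  "cell_integral N u a = (LINT y|\<mu>. of_bool (nearest x N y = a) * u y)"

lemma measurable_nearest_of_bool: "(\<lambda>y. of_bool (nearest x N y = a) :: real) \<in> borel_measurable \<mu>"
  unfolding measurable_cong_sets[OF sets_borel refl]
  using measurable_compose[OF measurable_nearest, of "\<lambda>b. of_bool (b = a) :: real" borel x N] by simp

lemma integrable_cell:
  assumes "u \<in> L2 \<mu>"
  shows "integrable \<mu> (\<lambda>y. of_bool (nearest x N y = a) * u y)"
proof (rule Bochner_Integration.integrable_bound[OF L2_integrable[OF assms]])
  show "(\<lambda>y. of_bool (nearest x N y = a) * u y) \<in> borel_measurable \<mu>"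
    by (intro borel_measurable_times measurable_nearest_of_bool L2_measurable[OF assms])
qed auto

text \<open>The case h = 1 shows that the weights add up to the total mass of u.\<close>

lemma integral_nearest:
  assumes "u \<in> L2 \<mu>"
  shows "(LINT y|\<mu>. h (nearest x N y) * u y) = (\<Sum>a\<le>N. h a * cell_integral N u a)"
proof -
  have "h (nearest x N y) * u y = (\<Sum>a\<le>N. h a * (of_bool (nearest x N y = a) * u y))" for y
  proof -
    have "(\<Sum>a\<le>N. h a * (of_bool (nearest x N y = a) * u y)) =
        (\<Sum>a\<le>N. if a = nearest x N y then h (nearest x N y) * u y else 0)"
      by (intro sum.cong) auto
    then show ?thesis using nearest_le[of x N y] by simp
  qed
  then show ?thesis
    using integrable_cell[OF assms] by (simp add: cell_integral_def)
qed

text \<open>Both arguments of the kernel are projected. Hence the result is a step function of z,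
  and pairing it with another function gives a finite double sum.\<close>

definition approx_K :: "nat \<Rightarrow> ('a \<Rightarrow> real) \<Rightarrow> 'a \<Rightarrow> real" where
  "approx_K N u z = (LINT y|\<mu>. sq_kernel (x (nearest x N z)) (x (nearest x N y)) * u y)"

text \<open>Since \<open>x 0\<close> competes, the projection of z is no farther from z than
  \<open>x 0\<close> is. The resulting factor is the same for all N, which provides dominating
  functions for the limits.\<close>

lemma \<rho>_nearest_le: "(\<rho> (x (nearest x N z)))\<^sup>2 \<le> 4 * (\<rho> z)\<^sup>2"
proof -
  have "\<rho> (x (nearest x N z)) \<le> 2 * \<rho> z"
    using dist_nearest_le[of 0 N x z] dist_triangle[of "x 0" "x (nearest x N z)" z]
    by (simp add: \<rho>_def dist_commute)
  then have "(\<rho> (x (nearest x N z)))\<^sup>2 \<le> (2 * \<rho> z)\<^sup>2"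
    using \<rho>_nonneg by (intro power_mono) auto
  then show ?thesis by (simp add: power_mult_distrib)
qed

lemma abs_sq_kernel_nearest_le:
  "\<bar>sq_kernel (x (nearest x N z)) (x (nearest x N y))\<bar> \<le> 4 * ((\<rho> z)\<^sup>2 + (\<rho> y)\<^sup>2)"
  using order.trans[OF abs_sq_kernel_le add_mono[OF \<rho>_nearest_le \<rho>_nearest_le]] by simp

lemma approx_K_eq: "u \<in> L2 \<mu> \<Longrightarrow>
  approx_K N u z = (\<Sum>b\<le>N. sq_kernel (x (nearest x N z)) (x b) * cell_integral N u b)"
  unfolding approx_K_def by (rule integral_nearest)

lemma measurable_approx_K:
  assumes "u \<in> L2 \<mu>"
  shows "approx_K N u \<in> borel_measurable \<mu>"
proof -
  have "approx_K N u = (\<lambda>z. (\<lambda>a. \<Sum>b\<le>N. sq_kernel (x a) (x b) * cell_integral N u b) (nearest x N z))"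
    using approx_K_eq[OF assms] by auto
  then show ?thesis
    unfolding measurable_cong_sets[OF sets_borel refl]
    using measurable_compose[OF measurable_nearest, of _ borel x N] by simp
qed

lemma integrable_dominating:
  assumes "u \<in> L2 \<mu>"
  shows "integrable \<mu> (\<lambda>y. (c + (\<rho> y)\<^sup>2) * \<bar>u y\<bar>)"
  using L2_integrable_mult[OF L2_lin[OF L2_one \<rho>_sq_L2, of c 1] L2_abs[OF assms]] by simp

lemma tendsto_approx_K:
  assumes u: "u \<in> L2 \<mu>"
  shows "(\<lambda>N. approx_K N u z) \<longlonglongrightarrow> K_op \<mu> u z"
  unfolding K_op_eq approx_K_def
proof (rule integral_dominated_convergence)
  show "(\<lambda>y. sq_kernel z y * u y) \<in> borel_measurable \<mu>"
    by (intro borel_measurable_times measurable_sq_kernel L2_measurable[OF u])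
  show "(\<lambda>y. sq_kernel (x (nearest x N z)) (x (nearest x N y)) * u y) \<in> borel_measurable \<mu>" for N
  proof (intro borel_measurable_times L2_measurable[OF u])
    show "(\<lambda>y. sq_kernel (x (nearest x N z)) (x (nearest x N y))) \<in> borel_measurable \<mu>"
      unfolding measurable_cong_sets[OF sets_borel refl]
      using measurable_compose[OF measurable_nearest, of "\<lambda>b. sq_kernel (x (nearest x N z)) (x b)" borel x N]
      by simp
  qed
  show "integrable \<mu> (\<lambda>y. 4 * (((\<rho> z)\<^sup>2 + (\<rho> y)\<^sup>2) * \<bar>u y\<bar>))"
    using integrable_dominating[OF u] by simp
  show "AE y in \<mu>. (\<lambda>N. sq_kernel (x (nearest x N z)) (x (nearest x N y)) * u y) \<longlonglongrightarrow> sq_kernel z y * u y"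
    by (intro AE_I2 tendsto_intros tendsto_sq_kernel tendsto_nearest dense)
  show "AE y in \<mu>. norm (sq_kernel (x (nearest x N z)) (x (nearest x N y)) * u y)
      \<le> 4 * (((\<rho> z)\<^sup>2 + (\<rho> y)\<^sup>2) * \<bar>u y\<bar>)" for N
    using mult_right_mono[OF abs_sq_kernel_nearest_le abs_ge_zero]
    by (intro AE_I2) (simp add: abs_mult mult.assoc[symmetric])
qed

text \<open>Inherited from the step functions \<open>approx_K\<close>, which converge at every
  point.\<close>

lemma measurable_K_op: "u \<in> L2 \<mu> \<Longrightarrow> K_op \<mu> u \<in> borel_measurable \<mu>"
  by (rule borel_measurable_LIMSEQ_real[OF tendsto_approx_K measurable_approx_K])

text \<open>By Cauchy-Schwarz this bounds K u at z for all u in the unit ball. The fourth moment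
  puts it into L2, so it dominates all these functions at once.\<close>

definition K_bound :: "'a \<Rightarrow> real" where
  "K_bound z = (\<rho> z)\<^sup>2 + L2_norm \<mu> (\<lambda>y. (\<rho> y)\<^sup>2)"

lemma K_bound_L2: "K_bound \<in> L2 \<mu>"
  unfolding K_bound_def using L2_lin[OF \<rho>_sq_L2 L2_one, of 1] by simp

lemma integral_dominating_le:
  assumes u: "u \<in> L2 \<mu>"
  shows "(LINT y|\<mu>. ((\<rho> z)\<^sup>2 + (\<rho> y)\<^sup>2) * \<bar>u y\<bar>) \<le> K_bound z * L2_norm \<mu> u"
proof -
  have "(LINT y|\<mu>. ((\<rho> z)\<^sup>2 + (\<rho> y)\<^sup>2) * \<bar>u y\<bar>) =
      L2_inner \<mu> (\<lambda>y. (\<rho> z)\<^sup>2 * 1 + 1 * (\<rho> y)\<^sup>2) (\<lambda>y. \<bar>u y\<bar>)"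
    by (simp add: L2_inner_def)
  also have "\<dots> = (\<rho> z)\<^sup>2 * L2_inner \<mu> (\<lambda>_. 1) (\<lambda>y. \<bar>u y\<bar>) +
      1 * L2_inner \<mu> (\<lambda>y. (\<rho> y)\<^sup>2) (\<lambda>y. \<bar>u y\<bar>)"
    by (rule L2_inner_lin_left[OF L2_one \<rho>_sq_L2 L2_abs[OF u]])
  also have "\<dots> \<le> (\<rho> z)\<^sup>2 * L2_norm \<mu> u + 1 * (L2_norm \<mu> (\<lambda>y. (\<rho> y)\<^sup>2) * L2_norm \<mu> u)"
    using L2_Cauchy_Schwarz[OF L2_one L2_abs[OF u]] L2_Cauchy_Schwarz[OF \<rho>_sq_L2 L2_abs[OF u]]
    by (intro add_mono mult_left_mono) (auto simp: L2_norm_one L2_norm_abs)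
  finally show ?thesis by (simp add: K_bound_def distrib_right)
qed

lemma abs_integral_le:
  assumes u: "u \<in> L2 \<mu>" and f: "\<And>y. \<bar>f y\<bar> \<le> c * ((\<rho> z)\<^sup>2 + (\<rho> y)\<^sup>2)" and c: "c \<ge> 0"
  shows "\<bar>LINT y|\<mu>. f y * u y\<bar> \<le> c * (K_bound z * L2_norm \<mu> u)"
proof -
  have "\<bar>LINT y|\<mu>. f y * u y\<bar> \<le> (LINT y|\<mu>. c * (((\<rho> z)\<^sup>2 + (\<rho> y)\<^sup>2) * \<bar>u y\<bar>))"
  proof (rule abs_integral_le_integral)
    show "integrable \<mu> (\<lambda>y. c * (((\<rho> z)\<^sup>2 + (\<rho> y)\<^sup>2) * \<bar>u y\<bar>))"
      using integrable_dominating[OF u] by simp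
    show "\<bar>f y * u y\<bar> \<le> c * (((\<rho> z)\<^sup>2 + (\<rho> y)\<^sup>2) * \<bar>u y\<bar>)" for y
      using mult_right_mono[OF f abs_ge_zero[of "u y"], of y] by (simp add: abs_mult mult.assoc)
  qed
  also have "\<dots> \<le> c * (K_bound z * L2_norm \<mu> u)"
    using integral_dominating_le[OF u, of z] c by (simp add: mult_left_mono)
  finally show ?thesis .
qed

lemma abs_K_op_le: "u \<in> L2 \<mu> \<Longrightarrow> \<bar>K_op \<mu> u z\<bar> \<le> K_bound z * L2_norm \<mu> u"
  unfolding K_op_eq using abs_integral_le[of u "sq_kernel z" 1 z] abs_sq_kernel_le by simp

lemma abs_approx_K_le: "u \<in> L2 \<mu> \<Longrightarrow> \<bar>approx_K N u z\<bar> \<le> 4 * (K_bound z * L2_norm \<mu> u)"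
  unfolding approx_K_def by (rule abs_integral_le) (use abs_sq_kernel_nearest_le in auto)

lemma K_op_L2:
  assumes u: "u \<in> L2 \<mu>"
  shows "K_op \<mu> u \<in> L2 \<mu>" and "L2_norm \<mu> (K_op \<mu> u) \<le> L2_norm \<mu> K_bound * L2_norm \<mu> u"
proof -
  have le: "\<bar>K_op \<mu> u z\<bar> \<le> L2_norm \<mu> u * K_bound z" for z
    using abs_K_op_le[OF u] by (simp add: mult.commute)
  note * = L2_bounded[OF measurable_K_op[OF u] L2_scale[OF K_bound_L2] le]
  show "K_op \<mu> u \<in> L2 \<mu>" by (rule *)
  show "L2_norm \<mu> (K_op \<mu> u) \<le> L2_norm \<mu> K_bound * L2_norm \<mu> u"
    using *(2) by (simp add: L2_norm_scale mult.commute)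
qed

text \<open>The inner integral converges at every z, and dominated convergence handles the outer
  one. The left side is the form of a finite configuration with the cell integrals as
  weights.\<close>

lemma tendsto_form:
  assumes u: "u \<in> L2 \<mu>" and v: "v \<in> L2 \<mu>"
  shows "(\<lambda>N. \<Sum>a\<le>N. \<Sum>b\<le>N. cell_integral N v a * cell_integral N u b * sq_kernel (x a) (x b))
    \<longlonglongrightarrow> L2_inner \<mu> (K_op \<mu> u) v"
proof -
  have "(LINT z|\<mu>. approx_K N u z * v z) =
      (\<Sum>a\<le>N. \<Sum>b\<le>N. cell_integral N v a * cell_integral N u b * sq_kernel (x a) (x b))" for N
    unfolding approx_K_eq[OF u]
    by (subst integral_nearest[OF v, where h = "\<lambda>a. \<Sum>b\<le>N. sq_kernel (x a) (x b) * cell_integral N u b"])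
      (simp add: sum_distrib_left sum_distrib_right mult_ac)
  moreover have "(\<lambda>N. LINT z|\<mu>. approx_K N u z * v z) \<longlonglongrightarrow> L2_inner \<mu> (K_op \<mu> u) v"
    unfolding L2_inner_def
  proof (rule integral_dominated_convergence)
    show "(\<lambda>z. K_op \<mu> u z * v z) \<in> borel_measurable \<mu>"
      by (intro borel_measurable_times measurable_K_op[OF u] L2_measurable[OF v])
    show "(\<lambda>z. approx_K N u z * v z) \<in> borel_measurable \<mu>" for N
      by (intro borel_measurable_times measurable_approx_K[OF u] L2_measurable[OF v])
    show "integrable \<mu> (\<lambda>z. 4 * L2_norm \<mu> u * (K_bound z * \<bar>v z\<bar>))"
      using L2_integrable_mult[OF K_bound_L2 L2_abs[OF v]] by simp
    show "AE z in \<mu>. (\<lambda>N. approx_K N u z * v z) \<longlonglongrightarrow> K_op \<mu> u z * v z"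
      by (intro AE_I2 tendsto_intros tendsto_approx_K u)
    show "AE z in \<mu>. norm (approx_K N u z * v z) \<le> 4 * L2_norm \<mu> u * (K_bound z * \<bar>v z\<bar>)" for N
      using mult_right_mono[OF abs_approx_K_le[OF u] abs_ge_zero]
      by (intro AE_I2) (simp add: abs_mult mult_ac)
  qed
  ultimately show ?thesis by simp
qed

text \<open>The kernel is symmetric, so exchanging the two finite sums exchanges u and v; the
  identity survives in the limit.\<close>

lemma K_op_sym:
  assumes u: "u \<in> L2 \<mu>" and v: "v \<in> L2 \<mu>"
  shows "L2_inner \<mu> (K_op \<mu> u) v = L2_inner \<mu> u (K_op \<mu> v)"
proof -
  have "(\<Sum>a\<le>N. \<Sum>b\<le>N. cell_integral N v a * cell_integral N u b * sq_kernel (x a) (x b)) =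
      (\<Sum>a\<le>N. \<Sum>b\<le>N. cell_integral N u a * cell_integral N v b * sq_kernel (x a) (x b))" for N
    by (subst sum.swap) (simp add: sq_kernel_commute mult_ac)
  then have "L2_inner \<mu> (K_op \<mu> u) v = L2_inner \<mu> (K_op \<mu> v) u"
    using LIMSEQ_unique[OF tendsto_form[OF u v]] tendsto_form[OF v u] by simp
  then show ?thesis by (simp add: L2_inner_commute)
qed

text \<open>A difference of squared distances factors: one factor is at most
  \<open>dist z w\<close>, the other at most \<rho> z + \<rho> w + 2 \<rho> y. Integration against u
  gives a local Lipschitz estimate that depends on u only through its norm.\<close>

lemma K_op_equicontinuous:
  assumes u: "u \<in> L2 \<mu>"
  shows "\<bar>K_op \<mu> u z - K_op \<mu> u w\<bar> \<le> dist z w * (\<rho> z + \<rho> w + 2 * L2_norm \<mu> \<rho>) * L2_norm \<mu> u"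
proof -
  define c where "c = \<rho> z + \<rho> w"
  have int: "integrable \<mu> (\<lambda>y. sq_kernel z y * u y)" "integrable \<mu> (\<lambda>y. sq_kernel w y * u y)"
    using L2_integrable_mult[OF sq_kernel_L2 u] by auto
  have L: "(\<lambda>y. c * 1 + 2 * \<rho> y) \<in> L2 \<mu>" by (intro L2_lin L2_one \<rho>_L2)
  have "\<bar>K_op \<mu> u z - K_op \<mu> u w\<bar> = \<bar>LINT y|\<mu>. (sq_kernel z y - sq_kernel w y) * u y\<bar>"
    using int by (simp add: K_op_eq left_diff_distrib)
  also have "\<dots> \<le> (LINT y|\<mu>. dist z w * ((c * 1 + 2 * \<rho> y) * \<bar>u y\<bar>))"
  proof (rule abs_integral_le_integral)
    show "integrable \<mu> (\<lambda>y. dist z w * ((c * 1 + 2 * \<rho> y) * \<bar>u y\<bar>))"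
      using L2_integrable_mult[OF L L2_abs[OF u]] by simp
    fix y
    have "\<bar>sq_kernel z y - sq_kernel w y\<bar> = 1/2 * (\<bar>dist z y - dist w y\<bar> * (dist z y + dist w y))"
    proof -
      have "sq_kernel z y - sq_kernel w y = - 1/2 * ((dist z y - dist w y) * (dist z y + dist w y))"
        by (simp add: sq_kernel_def power2_eq_square algebra_simps)
      then show ?thesis by (simp add: abs_mult)
    qed
    also have "\<dots> \<le> 1 * (dist z w * (c + 2 * \<rho> y))"
    proof (intro mult_mono)
      show "\<bar>dist z y - dist w y\<bar> \<le> dist z w"
        using dist_triangle[of z y w] dist_triangle[of w y z] by (simp add: dist_commute)
      show "dist z y + dist w y \<le> c + 2 * \<rho> y"
        using dist_triangle[of z y "x 0"] dist_triangle[of w y "x 0"]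
        by (simp add: c_def \<rho>_def dist_commute)
    qed auto
    finally have "\<bar>sq_kernel z y - sq_kernel w y\<bar> * \<bar>u y\<bar> \<le> 1 * (dist z w * (c + 2 * \<rho> y)) * \<bar>u y\<bar>"
      by (rule mult_right_mono) simp
    then show "\<bar>(sq_kernel z y - sq_kernel w y) * u y\<bar> \<le> dist z w * ((c * 1 + 2 * \<rho> y) * \<bar>u y\<bar>)"
      by (simp add: abs_mult mult.assoc)
  qed
  also have "\<dots> = dist z w * L2_inner \<mu> (\<lambda>y. c * 1 + 2 * \<rho> y) (\<lambda>y. \<bar>u y\<bar>)"
    by (simp add: L2_inner_def)
  also have "\<dots> \<le> dist z w * ((c + 2 * L2_norm \<mu> \<rho>) * L2_norm \<mu> u)"
  proof (rule mult_left_mono)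
    have "L2_inner \<mu> (\<lambda>y. c * 1 + 2 * \<rho> y) (\<lambda>y. \<bar>u y\<bar>) =
        c * L2_inner \<mu> (\<lambda>_. 1) (\<lambda>y. \<bar>u y\<bar>) + 2 * L2_inner \<mu> \<rho> (\<lambda>y. \<bar>u y\<bar>)"
      by (rule L2_inner_lin_left[OF L2_one \<rho>_L2 L2_abs[OF u]])
    also have "\<dots> \<le> c * L2_norm \<mu> u + 2 * (L2_norm \<mu> \<rho> * L2_norm \<mu> u)"
      using L2_Cauchy_Schwarz[OF L2_one L2_abs[OF u]] L2_Cauchy_Schwarz[OF \<rho>_L2 L2_abs[OF u]]
        \<rho>_nonneg[of z] \<rho>_nonneg[of w]
      by (intro add_mono mult_left_mono) (auto simp: L2_norm_one L2_norm_abs c_def)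
    finally show "L2_inner \<mu> (\<lambda>y. c * 1 + 2 * \<rho> y) (\<lambda>y. \<bar>u y\<bar>) \<le> (c + 2 * L2_norm \<mu> \<rho>) * L2_norm \<mu> u"
      by (simp add: distrib_right)
  qed simp
  finally show ?thesis by (simp add: c_def mult.assoc)
qed

text \<open>An Arzela-Ascoli argument: a diagonal subsequence converges on the countable dense set,
  and equicontinuity spreads the convergence to every point.\<close>

lemma K_op_pointwise_limit:
  assumes u: "\<And>n. u n \<in> L2 \<mu>" "\<And>n. L2_norm \<mu> (u n) \<le> 1"
  shows "\<exists>r. strict_mono (r :: nat \<Rightarrow> nat) \<and> (\<forall>z. convergent (\<lambda>n. K_op \<mu> (u (r n)) z))"
proof -
  have bound: "\<bar>K_op \<mu> (u n) z\<bar> \<le> K_bound z" for n z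
  proof -
    have "K_bound z \<ge> 0" by (simp add: K_bound_def)
    then show ?thesis
      using abs_K_op_le[OF u(1), of n z] mult_left_mono[OF u(2), of "K_bound z" n] by simp
  qed
  \<comment> \<open>Division by 1 + \<open>K_bound\<close> makes the functions uniformly bounded, as
    the diagonal subsequence requires; the 1 keeps the denominator positive.\<close>
  define f where "f n z = K_op \<mu> (u n) z / (1 + K_bound z)" for n z
  have K1: "1 + K_bound z > 0" for z
    by (simp add: K_bound_def add_pos_nonneg)
  have f_bound: "norm (f n z) \<le> 1" for n z
    using bound[of n z] K1[of z] by (simp add: f_def)
  obtain r where r: "strict_mono (r :: nat \<Rightarrow> nat)"
    "\<And>z. z \<in> range x \<Longrightarrow> \<exists>l. (\<lambda>n. f (r n) z) \<longlonglongrightarrow> l"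
    by (rule function_convergent_subsequence[of "range x" f 1]) (use f_bound in auto)
  have conv_dense: "convergent (\<lambda>n. K_op \<mu> (u (r n)) (x a))" for a
  proof -
    obtain l where "(\<lambda>n. f (r n) (x a)) \<longlonglongrightarrow> l" using r(2) by blast
    then have "(\<lambda>n. f (r n) (x a) * (1 + K_bound (x a))) \<longlonglongrightarrow> l * (1 + K_bound (x a))"
      by (intro tendsto_intros)
    then show ?thesis using K1[of "x a"] by (auto simp: f_def convergent_def)
  qed
  have "convergent (\<lambda>n. K_op \<mu> (u (r n)) z)" for z
  proof (rule Cauchy_convergent, rule metric_CauchyI)
    fix e :: real assume e: "e > 0"
    define h where "h w = dist z w * (\<rho> z + \<rho> w + 2 * L2_norm \<mu> \<rho>)" for w
    have near: "\<bar>K_op \<mu> (u n) z - K_op \<mu> (u n) w\<bar> \<le> h w" for n w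
    proof -
      have "h w \<ge> 0" using \<rho>_nonneg by (simp add: h_def)
      then show ?thesis
        using K_op_equicontinuous[OF u(1), of n z w] mult_left_mono[OF u(2), of "h w" n]
        by (simp add: h_def)
    qed
    \<comment> \<open>Some point of the dense sequence is so close to z that the oscillation is
      below e / 3. Two such errors and one Cauchy estimate add up to e.\<close>
    have "(\<lambda>N. h (x (nearest x N z))) \<longlonglongrightarrow> h z"
      unfolding h_def \<rho>_def by (intro tendsto_intros tendsto_nearest dense)
    then have "\<forall>\<^sub>F N in sequentially. h (x (nearest x N z)) < e / 3"
      using e by (intro order_tendstoD(2)) (auto simp: h_def)
    then obtain a where a: "h (x a) < e / 3"
      by (meson eventually_happens trivial_limit_sequentially)
    have "Cauchy (\<lambda>n. K_op \<mu> (u (r n)) (x a))"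
      using conv_dense by (simp add: Cauchy_convergent_iff)
    then obtain M where M: "\<And>m n. m \<ge> M \<Longrightarrow> n \<ge> M \<Longrightarrow>
        dist (K_op \<mu> (u (r m)) (x a)) (K_op \<mu> (u (r n)) (x a)) < e / 3"
      using metric_CauchyD[of _ "e / 3"] e by (metis divide_pos_pos zero_less_numeral)
    have "dist (K_op \<mu> (u (r m)) z) (K_op \<mu> (u (r n)) z) < e" if "m \<ge> M" "n \<ge> M" for m n
      using M[OF that] near[of "r m" "x a"] near[of "r n" "x a"] a
      unfolding dist_real_def by linarith
    then show "\<exists>M. \<forall>m\<ge>M. \<forall>n\<ge>M. dist (K_op \<mu> (u (r m)) z) (K_op \<mu> (u (r n)) z) < e"
      by blast
  qed
  then show ?thesis using r(1) by blast
qed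

text \<open>Pointwise convergence along the subsequence becomes convergence in norm by dominated
  convergence, with 2 * \<open>K_bound\<close> dominating the differences.\<close>

lemma K_op_compact:
  assumes u: "\<And>n. u n \<in> L2 \<mu>" "\<And>n. L2_norm \<mu> (u n) \<le> 1"
  shows "\<exists>r g. strict_mono (r :: nat \<Rightarrow> nat) \<and> g \<in> L2 \<mu> \<and>
        (\<lambda>n. L2_norm \<mu> (\<lambda>z. K_op \<mu> (u (r n)) z - g z)) \<longlonglongrightarrow> 0"
proof -
  obtain r where r: "strict_mono (r :: nat \<Rightarrow> nat)" "\<And>z. convergent (\<lambda>n. K_op \<mu> (u (r n)) z)"
    using K_op_pointwise_limit[of u] u by blast
  define g where "g z = lim (\<lambda>n. K_op \<mu> (u (r n)) z)" for z
  have lim: "(\<lambda>n. K_op \<mu> (u (r n)) z) \<longlonglongrightarrow> g z" for z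
    unfolding g_def using r(2) by (simp add: convergent_LIMSEQ_iff)
  have bound: "\<bar>K_op \<mu> (u n) z\<bar> \<le> K_bound z" for n z
  proof -
    have "K_bound z \<ge> 0" by (simp add: K_bound_def)
    then show ?thesis
      using abs_K_op_le[OF u(1), of n z] mult_left_mono[OF u(2), of "K_bound z" n] by simp
  qed
  have g_bound: "\<bar>g z\<bar> \<le> K_bound z" for z
    by (rule LIMSEQ_le_const2[OF tendsto_rabs[OF lim]]) (use bound in auto)
  have g_meas: "g \<in> borel_measurable \<mu>"
    by (rule borel_measurable_LIMSEQ_real[OF lim measurable_K_op[OF u(1)]])
  have g: "g \<in> L2 \<mu>"
    by (rule L2_bounded(1)[OF g_meas K_bound_L2 g_bound])
  have "(\<lambda>n. LINT z|\<mu>. (K_op \<mu> (u (r n)) z - g z)\<^sup>2) \<longlonglongrightarrow> (LINT z|\<mu>. 0)"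
  proof (rule integral_dominated_convergence)
    show "(\<lambda>z. (K_op \<mu> (u (r n)) z - g z)\<^sup>2) \<in> borel_measurable \<mu>" for n
      by (intro borel_measurable_power borel_measurable_diff measurable_K_op u g_meas)
    show "integrable \<mu> (\<lambda>z. (2 * K_bound z)\<^sup>2)"
      using L2_scale[OF K_bound_L2, of 2] by (simp add: L2_def)
    show "AE z in \<mu>. (\<lambda>n. (K_op \<mu> (u (r n)) z - g z)\<^sup>2) \<longlonglongrightarrow> 0"
    proof (rule AE_I2)
      fix z
      have "(\<lambda>n. (K_op \<mu> (u (r n)) z - g z)\<^sup>2) \<longlonglongrightarrow> (g z - g z)\<^sup>2"
        by (intro tendsto_intros lim)
      then show "(\<lambda>n. (K_op \<mu> (u (r n)) z - g z)\<^sup>2) \<longlonglongrightarrow> 0" by simp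
    qed
    show "AE z in \<mu>. norm ((K_op \<mu> (u (r n)) z - g z)\<^sup>2) \<le> (2 * K_bound z)\<^sup>2" for n
    proof (rule AE_I2)
      fix z
      have "\<bar>K_op \<mu> (u (r n)) z - g z\<bar> \<le> 2 * K_bound z"
        using bound[of "r n" z] g_bound[of z] by linarith
      then have "\<bar>K_op \<mu> (u (r n)) z - g z\<bar>\<^sup>2 \<le> (2 * K_bound z)\<^sup>2"
        by (rule power_mono) simp
      then show "norm ((K_op \<mu> (u (r n)) z - g z)\<^sup>2) \<le> (2 * K_bound z)\<^sup>2"
        by simp
    qed
  qed simp
  then have "(\<lambda>n. sqrt (LINT z|\<mu>. (K_op \<mu> (u (r n)) z - g z)\<^sup>2)) \<longlonglongrightarrow> sqrt 0"
    by (intro tendsto_real_sqrt) simp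
  then have "(\<lambda>n. L2_norm \<mu> (\<lambda>z. K_op \<mu> (u (r n)) z - g z)) \<longlonglongrightarrow> 0"
    by (simp add: L2_norm_def L2_inner_def power2_eq_square)
  then show ?thesis using r(1) g by blast
qed

lemma compact_L2_operator_K_op: "compact_L2_operator \<mu> (K_op \<mu>) (L2_norm \<mu> K_bound)"
  by unfold_locales (use K_op_compact in \<open>auto simp: K_op_L2 K_op_lin K_op_sym\<close>)

end

section \<open>The projection onto mean zero and compressed operators\<close>

context prob_space
begin

lemma P_op_L2: "u \<in> L2 M \<Longrightarrow> P_op M u \<in> L2 M"
  using P_op_orthogonal_projector(1)[OF prob_space_axioms] .

lemma L2_const: "(\<lambda>_. c) \<in> L2 M"
  by (simp add: L2_def)

lemma P_op_lin:
  assumes "u \<in> L2 M" "v \<in> L2 M"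
  shows "P_op M (\<lambda>y. a * u y + b * v y) = (\<lambda>y. a * P_op M u y + b * P_op M v y)"
  using L2_inner_lin_left[OF assms L2_const] by (auto simp: P_op_def algebra_simps)

lemma L2_inner_P_op:
  assumes "u \<in> L2 M" "v \<in> L2 M"
  shows "L2_inner M (P_op M u) v = L2_inner M u v - L2_inner M u (\<lambda>_. 1) * L2_inner M v (\<lambda>_. 1)"
proof -
  have "L2_inner M (P_op M u) v = L2_inner M u v - L2_inner M (\<lambda>_. L2_inner M u (\<lambda>_. 1)) v"
    unfolding P_op_def using assms L2_const by (rule_tac L2_inner_diff_left) auto
  then show ?thesis by (simp add: L2_inner_def)
qed

lemma P_op_sym:
  assumes "u \<in> L2 M" "v \<in> L2 M"
  shows "L2_inner M (P_op M u) v = L2_inner M u (P_op M v)"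
  using L2_inner_P_op[OF assms] L2_inner_P_op[OF assms(2,1)] by (simp add: L2_inner_commute)

lemma L2_norm_P_op:
  assumes u: "u \<in> L2 M"
  shows "L2_norm M (P_op M u) \<le> L2_norm M u"
proof -
  have "L2_inner M (P_op M u) (P_op M u) = L2_inner M u u - (L2_inner M u (\<lambda>_. 1))\<^sup>2"
    using P_op_orthogonal_projector(2)[OF prob_space_axioms u]
    by (simp add: L2_inner_P_op u P_op_L2 L2_inner_commute[of M u "P_op M u"] power2_eq_square)
  then show ?thesis by (simp add: L2_norm_def)
qed

text \<open>P is symmetric and does not increase norms. The bound takes the absolute value of C,
  since passing from the norm of P u to that of u requires a nonnegative factor.\<close>

lemma compact_L2_operator_compression:
  assumes "compact_L2_operator M K C"
  shows "compact_L2_operator M (\<lambda>u. P_op M (K (P_op M u))) \<bar>C\<bar>"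
proof -
  interpret compact_L2_operator M K C by fact
  show ?thesis
  proof
    fix u v and a b :: real assume u: "u \<in> L2 M" and v: "v \<in> L2 M"
    show "P_op M (K (P_op M (\<lambda>x. a * u x + b * v x))) =
        (\<lambda>x. a * P_op M (K (P_op M u)) x + b * P_op M (K (P_op M v)) x)"
      using u v by (simp add: P_op_lin A_lin P_op_L2 A_L2)
    show "L2_inner M (P_op M (K (P_op M u))) v = L2_inner M u (P_op M (K (P_op M v)))"
      using u v by (simp add: P_op_sym A_sym P_op_L2 A_L2)
  next
    fix u assume u: "u \<in> L2 M"
    show "P_op M (K (P_op M u)) \<in> L2 M"
      using u by (simp add: P_op_L2 A_L2)
    have "L2_norm M (P_op M (K (P_op M u))) \<le> C * L2_norm M (P_op M u)"
      using L2_norm_P_op[OF A_L2[OF P_op_L2[OF u]]] A_bdd[OF P_op_L2[OF u]] by simp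
    also have "\<dots> \<le> \<bar>C\<bar> * L2_norm M (P_op M u)"
      by (intro mult_right_mono) auto
    also have "\<dots> \<le> \<bar>C\<bar> * L2_norm M u"
      using L2_norm_P_op[OF u] by (intro mult_left_mono) auto
    finally show "L2_norm M (P_op M (K (P_op M u))) \<le> \<bar>C\<bar> * L2_norm M u" .
  next
    fix U :: "nat \<Rightarrow> 'a \<Rightarrow> real"
    assume U: "\<And>n. U n \<in> L2 M" "\<And>n. L2_norm M (U n) \<le> 1"
    have "L2_norm M (P_op M (U n)) \<le> 1" for n
      using L2_norm_P_op[OF U(1)] U(2) by (meson order.trans)
    then obtain r g where r: "strict_mono (r :: nat \<Rightarrow> nat)" and g: "g \<in> L2 M"
      and lim: "(\<lambda>n. L2_norm M (\<lambda>x. K (P_op M (U (r n))) x - g x)) \<longlonglongrightarrow> 0"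
      using A_compact[of "\<lambda>n. P_op M (U n)"] U(1) P_op_L2 by blast
    have "L2_norm M (\<lambda>x. P_op M (K (P_op M (U (r n)))) x - P_op M g x) \<le>
        L2_norm M (\<lambda>x. K (P_op M (U (r n))) x - g x)" for n
    proof -
      have k: "K (P_op M (U (r n))) \<in> L2 M" using U(1) by (simp add: A_L2 P_op_L2)
      show ?thesis
        using L2_norm_P_op[OF L2_diff[OF k g]] P_op_lin[OF k g, of 1 "-1"] by simp
    qed
    then have "(\<lambda>n. L2_norm M (\<lambda>x. P_op M (K (P_op M (U (r n)))) x - P_op M g x)) \<longlonglongrightarrow> 0"
      by (intro Lim_null_comparison[OF _ lim] always_eventually) simp
    then show "\<exists>r g. strict_mono (r :: nat \<Rightarrow> nat) \<and> g \<in> L2 M \<and>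
        (\<lambda>n. L2_norm M (\<lambda>x. P_op M (K (P_op M (U (r n)))) x - g x)) \<longlonglongrightarrow> 0"
      using r P_op_L2[OF g] by blast
  qed
qed

end

section \<open>Criteria for the signatures of K and T\<close>

context fourth_moment_measure
begin

text \<open>The counterpart of \<open>form_index_ge\<close> with functions in place of weighted
  points. The flag Z restricts to mean zero, so that T is described by the form of K as
  well.\<close>

definition op_index_ge :: "real \<Rightarrow> bool \<Rightarrow> nat \<Rightarrow> bool" where
  "op_index_ge \<sigma> Z n \<longleftrightarrow>
     (\<exists>u. (\<forall>i<n. u i \<in> L2 \<mu> \<and> (Z \<longrightarrow> L2_inner \<mu> (u i) (\<lambda>_. 1) = 0)) \<and>
       posdef {..<n} (\<lambda>i j. \<sigma> * L2_inner \<mu> (K_op \<mu> (u i)) (u j)))"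

lemma enat_le_sig_op_K_op_iff:
  assumes "\<sigma> \<in> {1, -1}"
  shows "enat n \<le> sig_op \<sigma> \<mu> (K_op \<mu>) \<longleftrightarrow> op_index_ge \<sigma> False n"
  unfolding op_index_ge_def enat_le_sig_op_iff[OF compact_L2_operator_K_op assms] by simp

lemma compact_L2_operator_T_op: "compact_L2_operator \<mu> (T_op \<mu>) \<bar>L2_norm \<mu> K_bound\<bar>"
  using compact_L2_operator_compression[OF compact_L2_operator_K_op] by (simp add: T_op_def[abs_def])

text \<open>The form of T at u and v is the form of K at their projections, and the projection fixes
  functions of mean zero. So projecting the test functions keeps the Gram matrix.\<close>

lemma enat_le_sig_op_T_op_iff:
  assumes "\<sigma> \<in> {1, -1}"
  shows "enat n \<le> sig_op \<sigma> \<mu> (T_op \<mu>) \<longleftrightarrow> op_index_ge \<sigma> True n"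
proof -
  have T: "L2_inner \<mu> (T_op \<mu> u) v = L2_inner \<mu> (K_op \<mu> (P_op \<mu> u)) (P_op \<mu> v)"
    if "u \<in> L2 \<mu>" "v \<in> L2 \<mu>" for u v
    using that by (simp add: T_op_def P_op_sym P_op_L2 K_op_L2)
  have P_id: "P_op \<mu> u = u" if "L2_inner \<mu> u (\<lambda>_. 1) = 0" for u
    using that by (simp add: P_op_def)
  have "enat n \<le> sig_op \<sigma> \<mu> (T_op \<mu>) \<longleftrightarrow>
      (\<exists>u. (\<forall>i<n. u i \<in> L2 \<mu>) \<and> posdef {..<n} (\<lambda>i j. \<sigma> * L2_inner \<mu> (T_op \<mu> (u i)) (u j)))"
    by (rule enat_le_sig_op_iff[OF compact_L2_operator_T_op assms])
  also have "\<dots> \<longleftrightarrow> op_index_ge \<sigma> True n"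
    unfolding op_index_ge_def
  proof (intro iffI; elim exE conjE)
    fix u assume u: "\<forall>i<n. u i \<in> L2 \<mu>"
      and pd: "posdef {..<n} (\<lambda>i j. \<sigma> * L2_inner \<mu> (T_op \<mu> (u i)) (u j))"
    have "posdef {..<n} (\<lambda>i j. \<sigma> * L2_inner \<mu> (K_op \<mu> (P_op \<mu> (u i))) (P_op \<mu> (u j)))"
      using pd u by (subst posdef_cong[OF refl]) (auto simp: T)
    then show "\<exists>u. (\<forall>i<n. u i \<in> L2 \<mu> \<and> (True \<longrightarrow> L2_inner \<mu> (u i) (\<lambda>_. 1) = 0)) \<and>
        posdef {..<n} (\<lambda>i j. \<sigma> * L2_inner \<mu> (K_op \<mu> (u i)) (u j))"
      using u P_op_orthogonal_projector(1,2)[OF prob_space_axioms]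
      by (intro exI[of _ "\<lambda>i. P_op \<mu> (u i)"]) auto
  next
    fix u assume u: "\<forall>i<n. u i \<in> L2 \<mu> \<and> (True \<longrightarrow> L2_inner \<mu> (u i) (\<lambda>_. 1) = 0)"
      and pd: "posdef {..<n} (\<lambda>i j. \<sigma> * L2_inner \<mu> (K_op \<mu> (u i)) (u j))"
    have "posdef {..<n} (\<lambda>i j. \<sigma> * L2_inner \<mu> (T_op \<mu> (u i)) (u j))"
      using pd u by (subst posdef_cong[OF refl]) (auto simp: T P_id)
    then show "\<exists>u. (\<forall>i<n. u i \<in> L2 \<mu>) \<and> posdef {..<n} (\<lambda>i j. \<sigma> * L2_inner \<mu> (T_op \<mu> (u i)) (u j))"
      using u by blast
  qed
  finally show ?thesis .
qed

lemma op_index_ge_imp_form_index_ge: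
  assumes "op_index_ge \<sigma> Z n"
  shows "\<exists>xs :: 'a list. form_index_ge \<sigma> Z n xs"
proof -
  obtain u where u: "\<And>i. i < n \<Longrightarrow> u i \<in> L2 \<mu>" "\<And>i. Z \<Longrightarrow> i < n \<Longrightarrow> L2_inner \<mu> (u i) (\<lambda>_. 1) = 0"
    and pd: "posdef {..<n} (\<lambda>i j. \<sigma> * L2_inner \<mu> (K_op \<mu> (u i)) (u j))"
    using assms unfolding op_index_ge_def by blast
  \<comment> \<open>In \<open>tendsto_form\<close> the first weight belongs to the second argument
    of the inner product; the Gram matrix is transposed to match.\<close>
  have "L2_inner \<mu> (K_op \<mu> (u i)) (u j) = L2_inner \<mu> (K_op \<mu> (u j)) (u i)" if "i < n" "j < n" for i j
    using K_op_sym[OF u(1)[OF that(1)] u(1)[OF that(2)]] by (simp add: L2_inner_commute)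
  then have pd': "posdef {..<n} (\<lambda>i j. \<sigma> * L2_inner \<mu> (K_op \<mu> (u j)) (u i))"
    using pd by (subst posdef_cong[OF refl]) auto
  have "\<forall>\<^sub>F N in sequentially. posdef {..<n} (\<lambda>i j. \<sigma> * (\<Sum>a\<le>N. \<Sum>b\<le>N.
      cell_integral N (u i) a * cell_integral N (u j) b * sq_kernel (x a) (x b)))"
    by (rule eventually_posdef[OF _ pd'])
      (use u(1) in \<open>auto intro!: tendsto_mult_left tendsto_form\<close>)
  then obtain N where N: "posdef {..<n} (\<lambda>i j. \<sigma> * (\<Sum>a\<le>N. \<Sum>b\<le>N.
      cell_integral N (u i) a * cell_integral N (u j) b * sq_kernel (x a) (x b)))"
    by (meson eventually_happens trivial_limit_sequentially)
  define xs where "xs = map x [0..<Suc N]"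
  have xs: "{..<length xs} = {..N}" "\<And>a. a \<le> N \<Longrightarrow> xs ! a = x a"
    by (auto simp: xs_def nth_append less_Suc_eq_le simp del: upt_Suc)
  \<comment> \<open>The weights add up to the mean, so mean zero becomes total mass 0 without
    error.\<close>
  have "(\<Sum>a\<le>N. cell_integral N (u i) a) = L2_inner \<mu> (u i) (\<lambda>_. 1)" if "i < n" for i
    using integral_nearest[OF u(1)[OF that], of "\<lambda>_. 1" N] by (simp add: L2_inner_def)
  moreover have "(\<Sum>a\<le>N. \<Sum>b\<le>N. cell_integral N (u i) a * cell_integral N (u j) b * sq_kernel (xs ! a) (xs ! b)) =
      (\<Sum>a\<le>N. \<Sum>b\<le>N. cell_integral N (u i) a * cell_integral N (u j) b * sq_kernel (x a) (x b))" for i j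
    by (intro sum.cong) (auto simp: xs(2))
  ultimately have "form_index_ge \<sigma> Z n xs"
    unfolding form_index_ge_def xs(1)
    using N u(2) by (intro exI[of _ "\<lambda>i. cell_integral N (u i)"]) auto
  then show ?thesis by blast
qed

end

section \<open>Approximate point masses\<close>

lemma abs_integral_average_le:
  fixes f w :: "'b \<Rightarrow> real"
  assumes w: "integrable M w" "(LINT y|M. w y) = 1" "\<And>y. 0 \<le> w y"
    and f: "integrable M (\<lambda>y. f y * w y)" "\<And>y. w y \<noteq> 0 \<Longrightarrow> \<bar>f y - c\<bar> \<le> e"
  shows "\<bar>(LINT y|M. f y * w y) - c\<bar> \<le> e"
proof -
  have "(LINT y|M. f y * w y) - c = (LINT y|M. (f y - c) * w y)"
    using w(1,2) f(1) by (simp add: left_diff_distrib)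
  also have "\<bar>\<dots>\<bar> \<le> (LINT y|M. e * w y)"
  proof (rule abs_integral_le_integral)
    show "integrable M (\<lambda>y. e * w y)" using w(1) by simp
    show "\<bar>(f y - c) * w y\<bar> \<le> e * w y" for y
      using f(2)[of y] w(3)[of y] by (cases "w y = 0") (auto simp: abs_mult intro: mult_right_mono)
  qed
  finally show ?thesis using w(2) by simp
qed

text \<open>The two distances differ by at most 2 r and add up to at most 2 (dist p q + r); the
  kernel contributes the factor 1/2.\<close>

lemma abs_sq_kernel_diff_le:
  assumes "dist z p < r" "dist y q < r"
  shows "\<bar>sq_kernel z y - sq_kernel p q\<bar> \<le> 2 * r * (dist p q + r)"
proof -
  have d: "\<bar>dist z y - dist p q\<bar> \<le> 2 * r" "dist z y + dist p q \<le> 2 * (dist p q + r)"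
    using assms dist_triangle[of z y p] dist_triangle[of p y q] dist_triangle[of p q z] dist_triangle[of z q y]
    by (auto simp: dist_commute abs_le_iff)
  have "sq_kernel z y - sq_kernel p q = - 1/2 * ((dist z y - dist p q) * (dist z y + dist p q))"
    by (simp add: sq_kernel_def power2_eq_square algebra_simps)
  then have "\<bar>sq_kernel z y - sq_kernel p q\<bar> = 1/2 * (\<bar>dist z y - dist p q\<bar> * (dist z y + dist p q))"
    by (simp add: abs_mult)
  also have "\<dots> \<le> 1/2 * ((2 * r) * (2 * (dist p q + r)))"
    using d by (intro mult_left_mono mult_mono) auto
  finally show ?thesis by (simp add: algebra_simps)
qed

context fourth_moment_measure
begin

text \<open>An approximate point mass at p. On a ball of measure 0 the quotient is 0 by convention;
  full support excludes this for positive radius, and the integral is then 1.\<close>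

definition bump :: "'a \<Rightarrow> real \<Rightarrow> 'a \<Rightarrow> real" where
  "bump p r y = indicator (ball p r) y / measure \<mu> (ball p r)"

lemma bump_L2: "bump p r \<in> L2 \<mu>"
proof (rule L2_bounded(1))
  have "(indicator (ball p r) :: 'a \<Rightarrow> real) \<in> borel_measurable \<mu>"
    by (intro borel_measurable_indicator) (simp add: sets_borel)
  then show "bump p r \<in> borel_measurable \<mu>"
    unfolding bump_def by (intro borel_measurable_divide) auto
  show "(\<lambda>_. 1 / measure \<mu> (ball p r)) \<in> L2 \<mu>" by (rule L2_const)
  show "\<bar>bump p r y\<bar> \<le> 1 / measure \<mu> (ball p r)" for y
    by (simp add: bump_def indicator_def)
qed

lemma bump_nonneg: "0 \<le> bump p r y"
  by (simp add: bump_def)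

lemma bump_nonzero: "bump p r y \<noteq> 0 \<Longrightarrow> dist y p < r"
  by (auto simp: bump_def indicator_def dist_commute split: if_splits)

lemma integral_bump:
  assumes "msupport \<mu> = UNIV" "r > 0"
  shows "(LINT y|\<mu>. bump p r y) = 1"
proof -
  have "p \<in> msupport \<mu>" using assms(1) by simp
  then have "emeasure \<mu> (ball p r) > 0"
    using assms(2) unfolding msupport_def by auto
  then have "measure \<mu> (ball p r) > 0"
    by (simp add: emeasure_eq_measure)
  then show ?thesis
    by (simp add: bump_def sets_borel)
qed

text \<open>An average of values within e of a constant is within e of it, so the error bound for
  the kernel passes unchanged through the averages in both variables.\<close>

lemma abs_inner_bump_le:
  assumes supp: "msupport \<mu> = UNIV" and r: "r > 0"
  shows "\<bar>L2_inner \<mu> (K_op \<mu> (bump q r)) (bump p r) - sq_kernel p q\<bar> \<le> 2 * r * (dist p q + r)"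
  unfolding L2_inner_def
proof (rule abs_integral_average_le)
  show "integrable \<mu> (\<lambda>y. K_op \<mu> (bump q r) y * bump p r y)"
    by (intro L2_integrable_mult K_op_L2 bump_L2)
  fix z assume z: "bump p r z \<noteq> 0"
  show "\<bar>K_op \<mu> (bump q r) z - sq_kernel p q\<bar> \<le> 2 * r * (dist p q + r)"
    unfolding K_op_eq
  proof (rule abs_integral_average_le)
    show "integrable \<mu> (\<lambda>y. sq_kernel z y * bump q r y)"
      by (intro L2_integrable_mult sq_kernel_L2 bump_L2)
    show "\<bar>sq_kernel z y - sq_kernel p q\<bar> \<le> 2 * r * (dist p q + r)" if "bump q r y \<noteq> 0" for y
      using bump_nonzero[OF z] bump_nonzero[OF that] by (rule abs_sq_kernel_diff_le)
  qed (use integral_bump[OF supp r] bump_nonneg L2_integrable[OF bump_L2] in auto)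
qed (use integral_bump[OF supp r] bump_nonneg L2_integrable[OF bump_L2] in auto)

text \<open>Each weight is spread over a small ball without changing its amount. Total masses agree
  exactly at every radius; only the Gram matrix is approximate.\<close>

lemma form_index_ge_imp_op_index_ge:
  fixes xs :: "'a list"
  assumes supp: "msupport \<mu> = UNIV" and xs: "form_index_ge \<sigma> Z n xs"
  shows "op_index_ge \<sigma> Z n"
proof -
  interpret K: compact_L2_operator \<mu> "K_op \<mu>" "L2_norm \<mu> K_bound"
    by (rule compact_L2_operator_K_op)
  define m where "m = length xs"
  obtain v where v: "Z \<longrightarrow> (\<forall>i<n. (\<Sum>a<m. v i a) = 0)"
    and pd: "posdef {..<n} (\<lambda>i j. \<sigma> * (\<Sum>a<m. \<Sum>b<m. v i a * v j b * sq_kernel (xs ! a) (xs ! b)))"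
    using xs unfolding form_index_ge_def m_def by blast
  define r where "r k = 1 / real (Suc k)" for k
  have r: "r k > 0" for k by (simp add: r_def)
  have r_lim: "r \<longlonglongrightarrow> 0"
    unfolding r_def by (rule LIMSEQ_Suc[OF lim_1_over_n])
  define u where "u k i = (\<lambda>y. \<Sum>a<m. v i a * bump (xs ! a) (r k) y)" for k i
  have uL: "u k i \<in> L2 \<mu>" for k i
    unfolding u_def by (intro L2_sum bump_L2)
  have lim: "(\<lambda>k. L2_inner \<mu> (K_op \<mu> (bump q (r k))) (bump p (r k))) \<longlonglongrightarrow> sq_kernel q p" for p q
  proof -
    have "(\<lambda>k. 2 * r k * (dist p q + r k)) \<longlonglongrightarrow> 2 * 0 * (dist p q + 0)"
      by (intro tendsto_intros r_lim)
    then have "(\<lambda>k. 2 * r k * (dist p q + r k)) \<longlonglongrightarrow> 0" by simp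
    then have "(\<lambda>k. L2_inner \<mu> (K_op \<mu> (bump q (r k))) (bump p (r k)) - sq_kernel p q) \<longlonglongrightarrow> 0"
      by (rule Lim_null_comparison[rotated])
        (use abs_inner_bump_le[OF supp r] in \<open>auto intro: always_eventually\<close>)
    then show ?thesis by (simp add: LIM_zero_iff sq_kernel_commute)
  qed
  have form: "L2_inner \<mu> (K_op \<mu> (u k i)) (u k j) =
      (\<Sum>a<m. \<Sum>b<m. v i a * v j b * L2_inner \<mu> (K_op \<mu> (bump (xs ! a) (r k))) (bump (xs ! b) (r k)))" for k i j
  proof -
    have "L2_inner \<mu> (K_op \<mu> (u k i)) (u k j) =
        (\<Sum>a<m. v i a * L2_inner \<mu> (K_op \<mu> (bump (xs ! a) (r k))) (u k j))"
      unfolding u_def[of k i] using uL[of k j] bump_L2 K.A_L2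
      by (subst K.A_sum) (auto intro!: L2_inner_sum_left)
    also have "\<dots> = (\<Sum>a<m. v i a * (\<Sum>b<m. v j b * L2_inner \<mu> (K_op \<mu> (bump (xs ! a) (r k))) (bump (xs ! b) (r k))))"
      unfolding u_def using bump_L2 K.A_L2 by (subst L2_inner_sum_right) auto
    finally show ?thesis by (simp add: sum_distrib_left mult.assoc)
  qed
  have "\<forall>\<^sub>F k in sequentially. posdef {..<n} (\<lambda>i j. \<sigma> * L2_inner \<mu> (K_op \<mu> (u k i)) (u k j))"
    unfolding form by (rule eventually_posdef[OF _ pd]) (intro tendsto_intros lim finite_lessThan)+
  then obtain k where k: "posdef {..<n} (\<lambda>i j. \<sigma> * L2_inner \<mu> (K_op \<mu> (u k i)) (u k j))"
    by (meson eventually_happens trivial_limit_sequentially)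
  have "L2_inner \<mu> (u k i) (\<lambda>_. 1) = (\<Sum>a<m. v i a)" for i
  proof -
    have "L2_inner \<mu> (u k i) (\<lambda>_. 1) = (\<Sum>a<m. v i a * L2_inner \<mu> (bump (xs ! a) (r k)) (\<lambda>_. 1))"
      unfolding u_def by (intro L2_inner_sum_left bump_L2 L2_one)
    then show ?thesis using integral_bump[OF supp r] by (simp add: L2_inner_def)
  qed
  then show ?thesis
    unfolding op_index_ge_def using k uL v by (intro exI[of _ "u k"]) auto
qed

text \<open>The right side does not mention \<mu>. For false Z it is the criterion for the limit
  signature; for true Z it makes the signature of T independent of the measure.\<close>

lemma op_index_ge_iff_form_index_ge:
  assumes "msupport \<mu> = UNIV"
  shows "op_index_ge \<sigma> Z n \<longleftrightarrow> (\<exists>xs :: 'a list. form_index_ge \<sigma> Z n xs)"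
  using form_index_ge_imp_op_index_ge[OF assms] op_index_ge_imp_form_index_ge by blast

section \<open>Comparison of T with K\<close>

lemma op_index_ge_True_imp_False: "op_index_ge \<sigma> True n \<Longrightarrow> op_index_ge \<sigma> False n"
  unfolding op_index_ge_def by blast

text \<open>The mean is a single linear functional. A vector \<open>u p\<close> of nonzero mean, if
  there is one, is used to correct the means of the others and is then given up.\<close>

lemma op_index_ge_codim_1:
  assumes "op_index_ge \<sigma> False n"
  shows "op_index_ge \<sigma> True (n - 1)"
proof (cases "n = 0")
  case True
  then show ?thesis by (simp add: op_index_ge_def posdef_def)
next
  case False
  interpret K: compact_L2_operator \<mu> "K_op \<mu>" "L2_norm \<mu> K_bound"
    by (rule compact_L2_operator_K_op)
  obtain u where u: "\<And>i. i < n \<Longrightarrow> u i \<in> L2 \<mu>"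
    and pd: "posdef {..<n} (\<lambda>i j. \<sigma> * L2_inner \<mu> (K_op \<mu> (u i)) (u j))"
    using assms unfolding op_index_ge_def by blast
  define l where "l i = L2_inner \<mu> (u i) (\<lambda>_. 1)" for i
  have "\<exists>p<n. (\<exists>i<n. l i \<noteq> 0) \<longrightarrow> l p \<noteq> 0"
    using False by auto
  then obtain p where p: "p < n" "(\<exists>i<n. l i \<noteq> 0) \<longrightarrow> l p \<noteq> 0" by blast
  define I where "I = {..<n} - {p}"
  have I: "finite I" "card I = n - 1" "{..<n} = insert p I" "p \<notin> I" "\<And>i. i \<in> I \<Longrightarrow> i < n"
    using p(1) by (auto simp: I_def)
  \<comment> \<open>if all \<open>l i\<close> vanish, then so do all the quotients, because of \<open>0 / 0 = 0\<close>\<close>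
  define w where "w i = (\<lambda>y. u i y - l i / l p * u p y)" for i
  have wL: "w i \<in> L2 \<mu>" if "i \<in> I" for i
    unfolding w_def using I(5)[OF that] p(1) by (intro L2_diff L2_scale u)
  have w_mass: "L2_inner \<mu> (w i) (\<lambda>_. 1) = 0" if "i \<in> I" for i
  proof -
    have "L2_inner \<mu> (w i) (\<lambda>_. 1) = l i - l i / l p * l p"
      unfolding w_def L2_inner_diff_left[OF u[OF I(5)[OF that]] L2_scale[OF u[OF p(1)]] L2_one]
        L2_inner_scale_left l_def[symmetric] ..
    then show ?thesis using p(2) I(5)[OF that] by (cases "l p = 0") auto
  qed
  have pdI: "posdef I (\<lambda>i j. \<sigma> * L2_inner \<mu> (K_op \<mu> (w i)) (w j))"
    unfolding posdef_def
  proof (intro allI impI)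
    fix c :: "nat \<Rightarrow> real" assume c: "\<exists>i\<in>I. c i \<noteq> 0"
    \<comment> \<open>A combination of the \<open>w i\<close> is rewritten in the
      \<open>u i\<close>; the coefficient of \<open>u p\<close> collects the corrections. The other
      coefficients are those of c, so d is not zero on the n indices.\<close>
    define d where "d = c(p := - (\<Sum>i\<in>I. c i * (l i / l p)))"
    have d: "d i = c i" if "i \<in> I" for i using that I(4) by (auto simp: d_def)
    have "(\<Sum>i\<in>I. c i * w i y) = (\<Sum>i<n. d i * u i y)" for y
    proof -
      have "(\<Sum>i<n. d i * u i y) = d p * u p y + (\<Sum>i\<in>I. c i * u i y)"
        unfolding I(3) using I(1,4) d by simp
      then show ?thesis
        by (simp add: w_def d_def right_diff_distrib sum_subtractf sum_distrib_right mult.assoc)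
    qed
    then have eq: "(\<lambda>y. \<Sum>i\<in>I. c i * w i y) = (\<lambda>y. \<Sum>i<n. d i * u i y)" by simp
    have "(\<Sum>i\<in>I. \<Sum>j\<in>I. c i * c j * (\<sigma> * L2_inner \<mu> (K_op \<mu> (w i)) (w j))) =
        \<sigma> * L2_inner \<mu> (K_op \<mu> (\<lambda>y. \<Sum>i\<in>I. c i * w i y)) (\<lambda>y. \<Sum>i\<in>I. c i * w i y)"
      using wL by (intro K.scaled_inner_A_sum[symmetric])
    also have "\<dots> = (\<Sum>i<n. \<Sum>j<n. d i * d j * (\<sigma> * L2_inner \<mu> (K_op \<mu> (u i)) (u j)))"
      unfolding eq using u by (intro K.scaled_inner_A_sum) auto
    also have "\<dots> > 0"
    proof -
      obtain i where "i \<in> I" "c i \<noteq> 0" using c by blast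
      then have "i \<in> {..<n}" "d i \<noteq> 0" using d I(5) by auto
      then show ?thesis by (rule posdefD[OF pd])
    qed
    finally show "0 < (\<Sum>i\<in>I. \<Sum>j\<in>I. c i * c j * (\<sigma> * L2_inner \<mu> (K_op \<mu> (w i)) (w j)))" .
  qed
  have "n - 1 \<le> card I" using I(2) by simp
  from posdef_le_card[OF pdI I(1) this] obtain f where
    "f ` {..<n - 1} \<subseteq> I" "posdef {..<n - 1} (\<lambda>i j. \<sigma> * L2_inner \<mu> (K_op \<mu> (w (f i))) (w (f j)))" .
  then show ?thesis
    unfolding op_index_ge_def using wL w_mass by (intro exI[of _ "\<lambda>i. w (f i)"]) auto
qed

text \<open>Adding multiples of a kernel vector leaves the form of K unchanged, by symmetry in both
  arguments. If the kernel vector has nonzero mean, the multiples can be chosen to cancel the mean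
  of each \<open>u i\<close>.\<close>

lemma op_index_ge_kernel:
  assumes "op_index_ge \<sigma> False n"
    and w: "w \<in> L2_ker \<mu> (K_op \<mu>)" "L2_inner \<mu> (\<lambda>_. 1) w \<noteq> 0"
  shows "op_index_ge \<sigma> True n"
proof -
  interpret K: compact_L2_operator \<mu> "K_op \<mu>" "L2_norm \<mu> K_bound"
    by (rule compact_L2_operator_K_op)
  obtain u where u: "\<And>i. i < n \<Longrightarrow> u i \<in> L2 \<mu>"
    and pd: "posdef {..<n} (\<lambda>i j. \<sigma> * L2_inner \<mu> (K_op \<mu> (u i)) (u j))"
    using assms(1) unfolding op_index_ge_def by blast
  have wL: "w \<in> L2 \<mu>" and w0: "AE y in \<mu>. K_op \<mu> w y = 0"
    using w(1) by (auto simp: L2_eigenspace_def)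
  define t where "t i = - L2_inner \<mu> (u i) (\<lambda>_. 1) / L2_inner \<mu> (\<lambda>_. 1) w" for i
  define u' where "u' i = (\<lambda>y. 1 * u i y + t i * w y)" for i
  have u'L: "u' i \<in> L2 \<mu>" if "i < n" for i
    unfolding u'_def by (intro L2_lin u wL that)
  have "L2_inner \<mu> (u' i) (\<lambda>_. 1) = 0" if "i < n" for i
    unfolding u'_def L2_inner_lin_left[OF u[OF that] wL L2_one]
    using w(2) by (simp add: t_def L2_inner_commute[of _ w])
  moreover have "L2_inner \<mu> (K_op \<mu> (u' i)) (u' j) = L2_inner \<mu> (K_op \<mu> (u i)) (u j)"
    if ij: "i < n" "j < n" for i j
  proof -
    have Kw: "L2_inner \<mu> (K_op \<mu> w) v = 0" if "v \<in> L2 \<mu>" for v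
      using L2_inner_cong_AE[OF w0 K.A_L2[OF wL] L2_zero that] by (simp add: L2_inner_def)
    have "L2_inner \<mu> (K_op \<mu> (u' i)) (u' j) =
        1 * L2_inner \<mu> (K_op \<mu> (u i)) (u' j) + t i * L2_inner \<mu> (K_op \<mu> w) (u' j)"
      unfolding u'_def[of i] K.A_lin[OF u[OF ij(1)] wL]
      by (intro L2_inner_lin_left K.A_L2 u u'L wL ij)
    also have "\<dots> = L2_inner \<mu> (K_op \<mu> (u i)) (u' j)"
      using Kw[OF u'L[OF ij(2)]] by simp
    also have "\<dots> = 1 * L2_inner \<mu> (K_op \<mu> (u i)) (u j) + t j * L2_inner \<mu> (K_op \<mu> (u i)) w"
      unfolding u'_def by (intro L2_inner_lin_right K.A_L2 u wL ij)
    also have "L2_inner \<mu> (K_op \<mu> (u i)) w = 0"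
      using K.A_sym[OF u[OF ij(1)] wL] Kw[OF u[OF ij(1)]] by (simp add: L2_inner_commute)
    finally show ?thesis by simp
  qed
  then have "posdef {..<n} (\<lambda>i j. \<sigma> * L2_inner \<mu> (K_op \<mu> (u' i)) (u' j))"
    using pd by (subst posdef_cong[OF refl]) auto
  ultimately show ?thesis
    unfolding op_index_ge_def using u'L by (intro exI[of _ u']) auto
qed

end

text \<open>The moment is given for some base point, whereas the discretisation needs it at
  \<open>x 0\<close>. Applying (a + b)^2 \<le> 2 (a^2 + b^2) twice produces the factor 8.\<close>

lemma integrable_dist_pow4:
  fixes \<mu> :: "'a::metric_space measure"
  assumes \<mu>: "borel_prob \<mu>" and fin: "finite_4th_moment \<mu>"
  shows "integrable \<mu> (\<lambda>y. dist p y ^ 4)"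
proof -
  interpret prob_space \<mu> using \<mu> by (simp add: borel_prob_def)
  have sets: "sets \<mu> = sets borel" using \<mu> by (simp add: borel_prob_def)
  have meas: "(\<lambda>y. dist q y ^ 4) \<in> borel_measurable \<mu>" for q
    unfolding measurable_cong_sets[OF sets refl]
    by (intro borel_measurable_continuous_onI continuous_intros)
  obtain q where "(\<integral>\<^sup>+ y. ennreal (dist q y ^ 4) \<partial>\<mu>) < \<infinity>"
    using fin by (auto simp: finite_4th_moment_def)
  then have q: "integrable \<mu> (\<lambda>y. dist q y ^ 4)"
    by (intro integrableI_nonneg meas) auto
  show ?thesis
  proof (rule Bochner_Integration.integrable_bound[OF _ meas])
    show "integrable \<mu> (\<lambda>y. 8 * (dist p q ^ 4 + dist q y ^ 4))" using q by simp
    show "AE y in \<mu>. norm (dist p y ^ 4) \<le> norm (8 * (dist p q ^ 4 + dist q y ^ 4))"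
    proof (rule AE_I2)
      fix y
      have sq: "(a + b)\<^sup>2 \<le> 2 * (a\<^sup>2 + b\<^sup>2)" for a b :: real
        using sum_squares_bound[of a b] by (simp add: power2_sum)
      have "dist p y ^ 4 \<le> (dist p q + dist q y) ^ 4"
        by (intro power_mono dist_triangle) auto
      also have "\<dots> = ((dist p q + dist q y)\<^sup>2)\<^sup>2" by (simp flip: power_mult)
      also have "\<dots> \<le> (2 * ((dist p q)\<^sup>2 + (dist q y)\<^sup>2))\<^sup>2"
        by (intro power_mono sq) auto
      also have "\<dots> = 4 * ((dist p q)\<^sup>2 + (dist q y)\<^sup>2)\<^sup>2"
        by (simp only: power_mult_distrib) simp
      also have "\<dots> \<le> 4 * (2 * (((dist p q)\<^sup>2)\<^sup>2 + ((dist q y)\<^sup>2)\<^sup>2))"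
        by (intro mult_left_mono sq) auto
      also have "\<dots> = 8 * (dist p q ^ 4 + dist q y ^ 4)" by (simp flip: power_mult)
      finally show "norm (dist p y ^ 4) \<le> norm (8 * (dist p q ^ 4 + dist q y ^ 4))" by simp
    qed
  qed
qed

lemma fourth_moment_measureI:
  fixes \<mu> :: "'a::metric_space measure"
  assumes "borel_prob \<mu>" "finite_4th_moment \<mu>" "closure (range x) = UNIV"
  shows "fourth_moment_measure \<mu> x"
  using assms integrable_dist_pow4[OF assms(1,2)]
  by (simp add: fourth_moment_measure_def fourth_moment_measure_axioms_def borel_prob_def)

text \<open>An infinite a stays infinite after subtracting 1, so b must be infinite: level n of b
  comes from level n + 1 of a. For finite a the level a itself suffices.\<close>

lemma enat_minus_1_le:
  assumes "\<And>n. enat n \<le> a \<Longrightarrow> enat (n - 1) \<le> b"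
  shows "a - 1 \<le> b"
proof (cases a)
  case (enat n)
  then show ?thesis using assms[of n] by (simp add: one_enat_def)
next
  case infinity
  have "enat n \<le> b" for n using assms[of "Suc n"] infinity by simp
  then have "b = \<infinity>" using enat_eqI[of b \<infinity>] by simp
  then show ?thesis by simp
qed

lemma enat_leI:
  assumes "\<And>n. enat n \<le> a \<Longrightarrow> enat n \<le> b"
  shows "a \<le> b"
proof -
  have "enat n \<le> min a b \<longleftrightarrow> enat n \<le> a" for n
    using assms[of n] by (auto simp: min_le_iff_disj)
  then have "min a b = a" by (rule enat_eqI)
  then show ?thesis by (metis min.cobounded2)
qed

theorem theorem4p2:
  fixes \<sigma> :: real
  assumes separable: "separable_space (euclidean :: 'a::metric_space topology)"
    and sign: "\<sigma> \<in> {1, -1}"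
  shows
    "(countable (UNIV :: 'a set) \<longrightarrow>
        (\<forall>F :: nat \<Rightarrow> 'a set.
           (\<forall>N. finite (F N)) \<and> (\<forall>N. F N \<subseteq> F (Suc N)) \<and> (\<Union>N. F N) = UNIV \<longrightarrow>
             (\<lambda>N. enat (sig_mat \<sigma> (S_set (F N)))) \<longlonglongrightarrow> limit_sig \<sigma> (UNIV :: 'a set) \<and>
             limit_sig \<sigma> (UNIV :: 'a set) = (SUP N. enat (sig_mat \<sigma> (S_set (F N)))))) \<and>
     (finite (UNIV :: 'a set) \<longrightarrow>
        limit_sig \<sigma> (UNIV :: 'a set) = enat (sig_mat \<sigma> (S_set (UNIV :: 'a set)))) \<and>
     (infinite (UNIV :: 'a set) \<longrightarrow>
        (\<forall>D :: 'a set. countable D \<and> closure D = UNIV \<longrightarrow>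
           limit_sig \<sigma> (UNIV :: 'a set) = limit_sig \<sigma> D)) \<and>
     (\<forall>(\<mu> :: 'a measure) (P :: 'w measure) (\<xi> :: nat \<Rightarrow> 'w \<Rightarrow> 'a).
        borel_prob \<mu> \<and> msupport \<mu> = UNIV \<and>
        prob_space P \<and> prob_space.indep_vars P (\<lambda>_. borel) \<xi> UNIV \<and>
        (\<forall>i. distr P borel (\<xi> i) = \<mu>) \<longrightarrow>
          (AE \<omega> in P.
             (\<lambda>m. enat (sig_mat \<sigma> (S_seq (map (\<lambda>i. \<xi> i \<omega>) [0..<m]))))
               \<longlonglongrightarrow> limit_sig \<sigma> (UNIV :: 'a set) \<and>
             (\<lambda>m. enat (sig_mat \<sigma> (S_set ((\<lambda>i. \<xi> i \<omega>) ` {0..<m}))))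
               \<longlonglongrightarrow> limit_sig \<sigma> (UNIV :: 'a set))) \<and>
     (\<forall>\<mu> :: 'a measure.
        borel_prob \<mu> \<and> finite_4th_moment \<mu> \<and> msupport \<mu> = UNIV \<longrightarrow>
          sig_op \<sigma> \<mu> (K_op \<mu>) = limit_sig \<sigma> (UNIV :: 'a set) \<and>
          sig_op \<sigma> \<mu> (K_op \<mu>) - 1 \<le> sig_op \<sigma> \<mu> (T_op \<mu>) \<and>
          sig_op \<sigma> \<mu> (T_op \<mu>) \<le> sig_op \<sigma> \<mu> (K_op \<mu>) \<and>
          (\<not> (\<forall>u\<in>L2_ker \<mu> (K_op \<mu>). L2_inner \<mu> (\<lambda>_. 1) u = 0) \<longrightarrow>
             sig_op \<sigma> \<mu> (T_op \<mu>) = sig_op \<sigma> \<mu> (K_op \<mu>))) \<and>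
     (\<forall>(\<mu> :: 'a measure) (\<nu> :: 'a measure).
        borel_prob \<mu> \<and> finite_4th_moment \<mu> \<and> msupport \<mu> = UNIV \<and>
        borel_prob \<nu> \<and> finite_4th_moment \<nu> \<and> msupport \<nu> = UNIV \<longrightarrow>
          sig_op \<sigma> \<mu> (T_op \<mu>) = sig_op \<sigma> \<nu> (T_op \<nu>))"
proof (intro conjI)
  show "countable (UNIV :: 'a set) \<longrightarrow>
        (\<forall>F :: nat \<Rightarrow> 'a set.
           (\<forall>N. finite (F N)) \<and> (\<forall>N. F N \<subseteq> F (Suc N)) \<and> (\<Union>N. F N) = UNIV \<longrightarrow>
             (\<lambda>N. enat (sig_mat \<sigma> (S_set (F N)))) \<longlonglongrightarrow> limit_sig \<sigma> (UNIV :: 'a set) \<and>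
             limit_sig \<sigma> (UNIV :: 'a set) = (SUP N. enat (sig_mat \<sigma> (S_set (F N)))))"
    using limit_sig_exhaustion[OF sign] by metis
  show "finite (UNIV :: 'a set) \<longrightarrow>
        limit_sig \<sigma> (UNIV :: 'a set) = enat (sig_mat \<sigma> (S_set (UNIV :: 'a set)))"
    using limit_sig_finite[OF sign] by blast
  show "infinite (UNIV :: 'a set) \<longrightarrow>
        (\<forall>D :: 'a set. countable D \<and> closure D = UNIV \<longrightarrow>
           limit_sig \<sigma> (UNIV :: 'a set) = limit_sig \<sigma> D)"
    using limit_sig_dense[OF sign] by metis
  show "\<forall>(\<mu> :: 'a measure) (P :: 'w measure) (\<xi> :: nat \<Rightarrow> 'w \<Rightarrow> 'a).
        borel_prob \<mu> \<and> msupport \<mu> = UNIV \<and>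
        prob_space P \<and> prob_space.indep_vars P (\<lambda>_. borel) \<xi> UNIV \<and>
        (\<forall>i. distr P borel (\<xi> i) = \<mu>) \<longrightarrow>
          (AE \<omega> in P.
             (\<lambda>m. enat (sig_mat \<sigma> (S_seq (map (\<lambda>i. \<xi> i \<omega>) [0..<m]))))
               \<longlonglongrightarrow> limit_sig \<sigma> (UNIV :: 'a set) \<and>
             (\<lambda>m. enat (sig_mat \<sigma> (S_set ((\<lambda>i. \<xi> i \<omega>) ` {0..<m}))))
               \<longlonglongrightarrow> limit_sig \<sigma> (UNIV :: 'a set))"
  proof (intro allI impI; elim conjE)
    fix \<mu> :: "'a measure" and P :: "'w measure" and \<xi> :: "nat \<Rightarrow> 'w \<Rightarrow> 'a"
    assume "msupport \<mu> = UNIV" "prob_space P" "prob_space.indep_vars P (\<lambda>_. borel) \<xi> UNIV"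
      "\<forall>i. distr P borel (\<xi> i) = \<mu>"
    then have "AE \<omega> in P. closure (range (\<lambda>i. \<xi> i \<omega>)) = UNIV"
      by (intro AE_iid_dense[OF separable]) auto
    then show "AE \<omega> in P.
        (\<lambda>m. enat (sig_mat \<sigma> (S_seq (map (\<lambda>i. \<xi> i \<omega>) [0..<m])))) \<longlonglongrightarrow> limit_sig \<sigma> (UNIV :: 'a set) \<and>
        (\<lambda>m. enat (sig_mat \<sigma> (S_set ((\<lambda>i. \<xi> i \<omega>) ` {0..<m})))) \<longlonglongrightarrow> limit_sig \<sigma> (UNIV :: 'a set)"
    proof eventually_elim
      fix \<omega> assume dense: "closure (range (\<lambda>i. \<xi> i \<omega>)) = UNIV"
      \<comment> \<open>The sampled points are exhausted by the first m of them, which gives their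
        limit signature; density identifies it with that of the whole space.\<close>
      have "(\<Union>m. (\<lambda>i. \<xi> i \<omega>) ` {0..<m}) = range (\<lambda>i. \<xi> i \<omega>)"
      proof -
        have "\<xi> i \<omega> \<in> (\<Union>m. (\<lambda>i. \<xi> i \<omega>) ` {0..<m})" for i
          by (rule UN_I[of "Suc i"]) simp_all
        then show ?thesis by blast
      qed
      moreover have "(\<lambda>m. enat (sig_mat \<sigma> (S_set ((\<lambda>i. \<xi> i \<omega>) ` {0..<m})))) \<longlonglongrightarrow>
          limit_sig \<sigma> (\<Union>m. (\<lambda>i. \<xi> i \<omega>) ` {0..<m})"
        by (rule limit_sig_exhaustion(1)[OF sign]) auto
      ultimately have lim: "(\<lambda>m. enat (sig_mat \<sigma> (S_set ((\<lambda>i. \<xi> i \<omega>) ` {0..<m})))) \<longlonglongrightarrow>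
          limit_sig \<sigma> (UNIV :: 'a set)"
        by (simp add: limit_sig_dense[OF sign dense])
      \<comment> \<open>Repetitions in the sample do not change the signature, so the random
        sequences follow the random sets.\<close>
      moreover have "sig_mat \<sigma> (S_set ((\<lambda>i. \<xi> i \<omega>) ` {0..<m})) =
          sig_mat \<sigma> (S_seq (map (\<lambda>i. \<xi> i \<omega>) [0..<m]))" for m
        using sig_mat_S_set_eq_S_seq[OF sign, of "map (\<lambda>i. \<xi> i \<omega>) [0..<m]"] by simp
      ultimately show "(\<lambda>m. enat (sig_mat \<sigma> (S_seq (map (\<lambda>i. \<xi> i \<omega>) [0..<m])))) \<longlonglongrightarrow> limit_sig \<sigma> (UNIV :: 'a set) \<and>
          (\<lambda>m. enat (sig_mat \<sigma> (S_set ((\<lambda>i. \<xi> i \<omega>) ` {0..<m})))) \<longlonglongrightarrow> limit_sig \<sigma> (UNIV :: 'a set)"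
        by simp
    qed
  qed
next
  \<comment> \<open>One dense sequence serves all measures on the space.\<close>
  obtain x :: "nat \<Rightarrow> 'a" where x: "closure (range x) = UNIV"
    using separable_dense_sequence[OF separable] .
  show "\<forall>\<mu> :: 'a measure.
        borel_prob \<mu> \<and> finite_4th_moment \<mu> \<and> msupport \<mu> = UNIV \<longrightarrow>
          sig_op \<sigma> \<mu> (K_op \<mu>) = limit_sig \<sigma> (UNIV :: 'a set) \<and>
          sig_op \<sigma> \<mu> (K_op \<mu>) - 1 \<le> sig_op \<sigma> \<mu> (T_op \<mu>) \<and>
          sig_op \<sigma> \<mu> (T_op \<mu>) \<le> sig_op \<sigma> \<mu> (K_op \<mu>) \<and>
          (\<not> (\<forall>u\<in>L2_ker \<mu> (K_op \<mu>). L2_inner \<mu> (\<lambda>_. 1) u = 0) \<longrightarrow>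
             sig_op \<sigma> \<mu> (T_op \<mu>) = sig_op \<sigma> \<mu> (K_op \<mu>))"
  proof (intro allI impI; elim conjE)
    fix \<mu> :: "'a measure"
    assume \<mu>: "borel_prob \<mu>" "finite_4th_moment \<mu>" and supp: "msupport \<mu> = UNIV"
    interpret fourth_moment_measure \<mu> x
      by (rule fourth_moment_measureI[OF \<mu> x])
    note K = enat_le_sig_op_K_op_iff[OF sign] and T = enat_le_sig_op_T_op_iff[OF sign]
    have "sig_op \<sigma> \<mu> (K_op \<mu>) = limit_sig \<sigma> (UNIV :: 'a set)"
      by (rule enat_eqI) (simp add: K op_index_ge_iff_form_index_ge[OF supp] enat_le_limit_sig_iff[OF sign])
    moreover have "sig_op \<sigma> \<mu> (K_op \<mu>) - 1 \<le> sig_op \<sigma> \<mu> (T_op \<mu>)"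
      by (rule enat_minus_1_le) (simp only: K T op_index_ge_codim_1)
    moreover have le: "sig_op \<sigma> \<mu> (T_op \<mu>) \<le> sig_op \<sigma> \<mu> (K_op \<mu>)"
      by (rule enat_leI) (simp add: K T op_index_ge_True_imp_False)
    moreover have "sig_op \<sigma> \<mu> (T_op \<mu>) = sig_op \<sigma> \<mu> (K_op \<mu>)"
      if "\<not> (\<forall>u\<in>L2_ker \<mu> (K_op \<mu>). L2_inner \<mu> (\<lambda>_. 1) u = 0)"
      by (rule antisym[OF le enat_leI]) (use that in \<open>auto simp: K T intro: op_index_ge_kernel\<close>)
    ultimately show "sig_op \<sigma> \<mu> (K_op \<mu>) = limit_sig \<sigma> (UNIV :: 'a set) \<and>
          sig_op \<sigma> \<mu> (K_op \<mu>) - 1 \<le> sig_op \<sigma> \<mu> (T_op \<mu>) \<and>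
          sig_op \<sigma> \<mu> (T_op \<mu>) \<le> sig_op \<sigma> \<mu> (K_op \<mu>) \<and>
          (\<not> (\<forall>u\<in>L2_ker \<mu> (K_op \<mu>). L2_inner \<mu> (\<lambda>_. 1) u = 0) \<longrightarrow>
             sig_op \<sigma> \<mu> (T_op \<mu>) = sig_op \<sigma> \<mu> (K_op \<mu>))"
      by blast
  qed
  \<comment> \<open>The criterion on the right is the same for every admissible measure, so two
    signatures of T agree at every finite level.\<close>
  have T: "enat n \<le> sig_op \<sigma> \<mu> (T_op \<mu>) \<longleftrightarrow> (\<exists>xs :: 'a list. form_index_ge \<sigma> True n xs)"
    if "borel_prob \<mu>" "finite_4th_moment \<mu>" "msupport \<mu> = UNIV" for \<mu> :: "'a measure" and n
  proof -
    interpret fourth_moment_measure \<mu> x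
      by (rule fourth_moment_measureI[OF that(1,2) x])
    show ?thesis
      by (simp add: enat_le_sig_op_T_op_iff[OF sign] op_index_ge_iff_form_index_ge[OF that(3)])
  qed
  show "\<forall>(\<mu> :: 'a measure) (\<nu> :: 'a measure).
        borel_prob \<mu> \<and> finite_4th_moment \<mu> \<and> msupport \<mu> = UNIV \<and>
        borel_prob \<nu> \<and> finite_4th_moment \<nu> \<and> msupport \<nu> = UNIV \<longrightarrow>
          sig_op \<sigma> \<mu> (T_op \<mu>) = sig_op \<sigma> \<nu> (T_op \<nu>)"
    by (intro allI impI enat_eqI) (simp add: T)
qed

end
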